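(* Fix $\eta\in(0,1)$. There exist constants $0<c\le C<\infty$, depending on $\eta$, such that, for $G=\mathbb Z^3$ or $G=\mathbb Z^4$ and for all $N,p\in\mathbb N$ with $p\le N$, $$c\exp\Big(-\frac{CN}{p}\Big)\le \mathbb P_0\Big(\mathrm{cap}(\overline X_{B(N)})\le \mathrm{cap}(\mathcal R_{N,p})\Big)\le\begin{cases} C\exp\Big(-\Big(\dfrac{cN}{p}\Big)^{1-\eta}\Big)&\text{if }G=\mathbb Z^3,\\[2mm] C\exp\Big(-\dfrac{cN}{p\,(\log(p)\vee1)^2}\Big)&\text{if }G=\mathbb Z^4.\end{cases}$$
   Context: $\mathbb Z^d$ is the nearest-neighbour lattice with unit edge weights, so $\lambda_x=2d$ for each $x$. Under $\mathbb P_x$, $(X_k)_{k\ge0}$ is simple random walk on $\mathbb Z^d$ started at $x$. For finite $A\subset\mathbb Z^d$, let $\tilde H_A=\inf\{n\ge1:X_n\in A\}$ and $\mathrm{cap}(A)=\sum_{x\in A}\lambda_x\mathbb P_x(\tilde H_A=\infty)$. $B(N)$ is the set of points of $\mathbb Z^d$ at Euclidean distance at most $N$ from $0$. $T_A=\inf\{k\in\mathbb N:X_k\notin A\}$ is the first exit time of $A$, and $\overline X_A=\{X_k:0\le k<T_A\}$ is the set of points visited before exiting $A$. $\mathcal R_{N,p}=([0,N]\times[-p,p]^{d-1})\cap\mathbb Z^d$. Here $a\vee b=\max(a,b)$. *)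

theory Defs
  imports "HOL-Probability.Probability"
begin

text \<open>
  The lattice of dimension \<open>d\<close> is the type \<^typ>\<open>int ^ 'd\<close> with \<open>d = CARD('d)\<close>.
  Only \<open>rectangle\<close> needs a distinguished coordinate; it is the one indexed by \<open>1 :: 'd\<close>, which is
  why the index type is required there to be of class \<^class>\<open>one\<close> (as the numeral types \<open>3\<close>
  and \<open>4\<close> are).
\<close>

definition unit_steps :: "(int ^ 'd) set" where
  "unit_steps = (\<Union>i. {axis i 1, axis i (-1)})"

text \<open>
  The law \<open>P\<^sub>x\<close> on the space of paths \<^typ>\<open>nat \<Rightarrow> int ^ 'd\<close> of the walk started at \<open>x\<close>: partial
  sums of independent uniform unit steps. The process itself is the coordinate process,
  \<open>X\<^sub>k \<omega> = \<omega> k\<close>.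
\<close>

definition srw :: "int ^ 'd \<Rightarrow> (nat \<Rightarrow> int ^ 'd) measure" where
  "srw x = distr (\<Pi>\<^sub>M k\<in>UNIV. measure_pmf (pmf_of_set unit_steps))
                 (\<Pi>\<^sub>M k\<in>UNIV. count_space UNIV)
                 (\<lambda>\<xi> k. x + (\<Sum>i<k. \<xi> i))"

lemma prob_space_srw:
  fixes x :: "int ^ 'd"
  shows "prob_space (srw x)"
proof -
  interpret S: product_prob_space
    "\<lambda>_::nat. measure_pmf (pmf_of_set (unit_steps :: (int ^ 'd) set))" UNIV
    by unfold_locales
  have coord: "(\<lambda>\<xi>. \<xi> i) \<in> (\<Pi>\<^sub>M k\<in>UNIV. measure_pmf (pmf_of_set unit_steps))
      \<rightarrow>\<^sub>M (count_space UNIV :: (int ^ 'd) measure)" for i :: nat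
    using measurable_component_singleton[of i UNIV
        "\<lambda>_. measure_pmf (pmf_of_set (unit_steps :: (int ^ 'd) set))"]
    by (simp cong: measurable_cong_sets)
  have "(\<lambda>\<xi>. \<Sum>i<k. \<xi> i) \<in> (\<Pi>\<^sub>M k\<in>UNIV. measure_pmf (pmf_of_set unit_steps))
      \<rightarrow>\<^sub>M (count_space UNIV :: (int ^ 'd) measure)" for k :: nat
  proof (induction k)
    case (Suc k)
    have "(\<lambda>\<xi>. a + \<xi> k) \<in> (\<Pi>\<^sub>M k\<in>UNIV. measure_pmf (pmf_of_set unit_steps))
        \<rightarrow>\<^sub>M (count_space UNIV :: (int ^ 'd) measure)" for a
      by (rule measurable_compose[OF coord]) simp
    from measurable_compose_countable[OF this Suc] show ?case by simp
  qed simp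
  then have shifted: "(\<lambda>\<xi>. x + (\<Sum>i<k. \<xi> i)) \<in> (\<Pi>\<^sub>M k\<in>UNIV. measure_pmf (pmf_of_set unit_steps))
      \<rightarrow>\<^sub>M count_space UNIV" for k :: nat
    by (rule measurable_compose) simp
  have "(\<lambda>\<xi> (k::nat). x + (\<Sum>i<k. \<xi> i)) \<in> (\<Pi>\<^sub>M k\<in>UNIV. measure_pmf (pmf_of_set unit_steps))
      \<rightarrow>\<^sub>M (\<Pi>\<^sub>M k\<in>UNIV. count_space UNIV)"
    by (rule measurable_PiM_single'[OF shifted]) simp
  then show ?thesis
    unfolding srw_def by (rule S.prob_space_distr)
qed

definition hitting_time :: "'a set \<Rightarrow> (nat \<Rightarrow> 'a) \<Rightarrow> enat" where
  "hitting_time A \<omega> = Inf {enat n | n. n \<ge> 1 \<and> \<omega> n \<in> A}"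

definition exit_time :: "'a set \<Rightarrow> (nat \<Rightarrow> 'a) \<Rightarrow> enat" where
  "exit_time A \<omega> = Inf {enat k | k. \<omega> k \<notin> A}"

definition visited :: "'a set \<Rightarrow> (nat \<Rightarrow> 'a) \<Rightarrow> 'a set" where
  "visited A \<omega> = {\<omega> k | k. enat k < exit_time A \<omega>}"

text \<open>
  The factor \<open>2 d\<close> is the total weight \<open>\<lambda>\<^sub>x\<close> of the edges at \<open>x\<close>. Meaningful for finite \<open>A\<close> only.
\<close>

definition cap :: "(int ^ 'd) set \<Rightarrow> real" where
  "cap A = (\<Sum>x\<in>A. (2 * real CARD('d)) * \<P>(\<omega> in srw x. hitting_time A \<omega> = \<infinity>))"

definition lattice_ball :: "nat \<Rightarrow> (int ^ 'd) set" where
  "lattice_ball N = {x. norm (\<chi> i. real_of_int (x $ i)) \<le> real N}"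

definition rectangle :: "nat \<Rightarrow> nat \<Rightarrow> (int ^ 'd::{finite, one}) set" where
  "rectangle N p = {x. x $ 1 \<in> {0..int N} \<and> (\<forall>i. i \<noteq> 1 \<longrightarrow> x $ i \<in> {- int p..int p})}"

end

(*
  The capacity of a set is compared with Green potentials of point measures: if the potential of
  a measure is at least 1 on A, its mass bounds the capacity of A from above; if the measure lives
  on A and its potential is at most 1 there, its mass bounds the capacity from below.

  Lower bound: the walk is forced to stay, until it leaves the ball, in a translate of the
  rectangle.  The probability is estimated with harmonic products of one sinh and several sines.

  Upper bound: cut the ball into m shells of width 4L and look at the first n steps after the walk
  reaches each shell, n a small multiple of L^2.  Except with probability exp(-m), most of these
  pieces stay in their shell and have a small potential on most of their points, so that the
  occupation measure bounds the capacity of the range from below.  In dimension four crude bounds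
  on the Green function suffice; in dimension three the constants matter and one needs
  |x| g(x) -> c, which follows by writing 1/sqrt(|x|^2 + 15) as the Green potential of a summable
  density and from a gradient estimate for g.
*)
theory Submission
  imports Defs "HOL-Real_Asymp.Real_Asymp"
begin

subsection \<open>Increments of the walk\<close>

text \<open>The analytic input is elementary: explicit radial functions whose discrete Laplacian has
  a known sign, the maximum principle, and telescoping along the walk; no local limit theorem
  enters. In the lower bound the obstacle is the length of the rectangle, which is exactly N: a walk
  started on an end face has no room behind it, and moving the rectangle back makes its front face
  fall short of the sphere. By Pythagoras a lateral offset of about p/2 pays for a shift of order
  p^2/N, which costs only a power of p/N in probability. In the upper bound the shells are spaced so
  that a piece staying within L of its start ends before the next shell is reached. Hence failures
  in different shells multiply as if independent, although all pieces come from one path. In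
  dimension three both capacities are N over a logarithm with the same leading constant, so only the
  ratio of the logarithms of m and of N/p separates them; losing a constant factor would spoil the
  exponent 1 - \<eta>.\<close>

abbreviation step_pmf :: "(int ^ 'd) pmf" where
  "step_pmf \<equiv> pmf_of_set unit_steps"

definition steps_M :: "(nat \<Rightarrow> int ^ 'd) measure" where
  "steps_M = (\<Pi>\<^sub>M k\<in>UNIV. measure_pmf step_pmf)"

definition part :: "(nat \<Rightarrow> int ^ 'd) \<Rightarrow> nat \<Rightarrow> int ^ 'd" where
  "part \<xi> k = (\<Sum>i<k. \<xi> i)"

definition shift :: "nat \<Rightarrow> (nat \<Rightarrow> 'a) \<Rightarrow> nat \<Rightarrow> 'a" where
  "shift k \<xi> = (\<lambda>i. \<xi> (k + i))"

definition nbr_avg :: "(int ^ 'd \<Rightarrow> real) \<Rightarrow> int ^ 'd \<Rightarrow> real" where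
  "nbr_avg f x = (\<Sum>s\<in>unit_steps. f (x + s)) / real (card (unit_steps :: (int ^ 'd) set))"

lemma finite_unit_steps [simp]: "finite (unit_steps :: (int ^ 'd) set)"
  by (simp add: unit_steps_def)

lemma unit_steps_nonempty [simp]: "unit_steps \<noteq> ({} :: (int ^ 'd) set)"
  by (auto simp: unit_steps_def)

lemma axis_eq_iff: "a \<noteq> 0 \<Longrightarrow> axis i a = axis j b \<longleftrightarrow> i = j \<and> a = b"
  by (auto simp: axis_def vec_eq_iff)

lemma sum_unit_steps:
  fixes f :: "int ^ 'd \<Rightarrow> 'b::comm_monoid_add"
  shows "(\<Sum>s\<in>unit_steps. f s) = (\<Sum>i\<in>UNIV. f (axis i 1) + f (axis i (-1)))"
  unfolding unit_steps_def
  by (subst sum.UNION_disjoint) (auto simp: axis_eq_iff)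

lemma card_unit_steps: "card (unit_steps :: (int ^ 'd) set) = 2 * CARD('d)"
  using sum_unit_steps[of "\<lambda>_::int^'d. 1::nat"] by simp

lemma card_unit_steps_pos: "0 < card (unit_steps :: (int ^ 'd) set)"
  by (simp add: card_unit_steps)

lemma uminus_unit_step: "- s \<in> unit_steps" if "s \<in> unit_steps" for s :: "int ^ 'd"
proof -
  have "- axis i 1 = axis i (- 1 :: int)" "- axis i (-1) = axis i (1::int)" for i :: 'd
    by (simp_all add: axis_def vec_eq_iff)
  with that show ?thesis by (auto simp: unit_steps_def)
qed

lemma nbr_avg_def2:
  "nbr_avg f x = (\<Sum>i\<in>UNIV. f (x + axis i 1) + f (x + axis i (-1))) / (2 * real CARD('d))"
  for f :: "int ^ 'd \<Rightarrow> real"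
  by (simp add: nbr_avg_def sum_unit_steps card_unit_steps)

section \<open>Product space of steps: measurability, independence, Markov property\<close>

lemma space_steps_M [simp]: "space steps_M = UNIV"
  by (simp add: steps_M_def space_PiM)

lemma prob_space_steps_M: "prob_space (steps_M :: (nat \<Rightarrow> int ^ 'd) measure)"
  unfolding steps_M_def by (intro prob_space_PiM prob_space_measure_pmf)

lemma measurable_step [measurable]:
  "(\<lambda>\<xi>. \<xi> i) \<in> (steps_M :: (nat \<Rightarrow> int ^ 'd) measure) \<rightarrow>\<^sub>M count_space UNIV"
proof -
  have "(\<lambda>\<xi>. \<xi> i) \<in> (steps_M :: (nat \<Rightarrow> int ^ 'd) measure) \<rightarrow>\<^sub>M measure_pmf step_pmf"
    unfolding steps_M_def by (rule measurable_component_singleton) simp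
  then show ?thesis by (simp cong: measurable_cong_sets)
qed

lemma sets_Collect_steps: "Measurable.pred steps_M P \<Longrightarrow> {\<xi>. P \<xi>} \<in> sets steps_M"
  by (simp add: pred_def)

lemma measurable_prefix:
  "(\<lambda>\<xi>. map \<xi> [0..<k]) \<in> (steps_M :: (nat \<Rightarrow> int ^ 'd) measure) \<rightarrow>\<^sub>M count_space UNIV"
proof (induction k)
  case (Suc k)
  have "(\<lambda>\<xi>. l @ [\<xi> k]) \<in> (steps_M :: (nat \<Rightarrow> int ^ 'd) measure) \<rightarrow>\<^sub>M count_space UNIV" for l
    by (rule measurable_compose[OF measurable_step]) simp
  from measurable_compose_countable[OF this Suc] show ?case by simp
qed simp

text \<open>Stands in for measurability with respect to the first \<open>k\<close> steps: steps
  range over a countable type, so invariance under changes of later steps already implies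
  measurability.\<close>

definition prefix_determined :: "nat \<Rightarrow> ((nat \<Rightarrow> 'a) \<Rightarrow> 'b) \<Rightarrow> bool" where
  "prefix_determined k F \<longleftrightarrow> (\<forall>\<xi> \<xi>'. (\<forall>i<k. \<xi> i = \<xi>' i) \<longrightarrow> F \<xi> = F \<xi>')"

lemma prefix_determinedD: "prefix_determined k F \<Longrightarrow> (\<And>i. i < k \<Longrightarrow> \<xi> i = \<xi>' i) \<Longrightarrow> F \<xi> = F \<xi>'"
  unfolding prefix_determined_def by blast

lemma measurable_prefix_determined:
  fixes F :: "(nat \<Rightarrow> int ^ 'd) \<Rightarrow> 'b"
  assumes "prefix_determined k F"
  shows "F \<in> steps_M \<rightarrow>\<^sub>M count_space UNIV"
proof -
  \<comment> \<open>Later steps are filled with the arbitrary value 0, so that \<open>F\<close>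
    factors through the list of the first \<open>k\<close> steps, an element of a countable
    type.\<close>
  have "F = (\<lambda>\<xi>. F (\<lambda>i. if i < k then map \<xi> [0..<k] ! i else 0))"
    by (rule ext, rule prefix_determinedD[OF assms]) simp
  then have "F = (\<lambda>l. F (\<lambda>i. if i < k then l ! i else 0)) \<circ> (\<lambda>\<xi>. map \<xi> [0..<k])"
    by (simp add: fun_eq_iff o_def)
  with measurable_comp[OF measurable_prefix[of k], of "\<lambda>l. F (\<lambda>i. if i < k then l ! i else 0)" "count_space UNIV"]
  show ?thesis by simp
qed

lemma prefix_determined_part: "i \<le> k \<Longrightarrow> prefix_determined k (\<lambda>\<xi>. part \<xi> i)"
  by (auto simp: prefix_determined_def part_def intro!: sum.cong)

lemma measurable_part [measurable]:
  "(\<lambda>\<xi>. part \<xi> i) \<in> (steps_M :: (nat \<Rightarrow> int ^ 'd) measure) \<rightarrow>\<^sub>M count_space UNIV"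
  by (rule measurable_prefix_determined[OF prefix_determined_part[OF order_refl]])

lemma measurable_shift [measurable]:
  "shift k \<in> (steps_M :: (nat \<Rightarrow> int ^ 'd) measure) \<rightarrow>\<^sub>M steps_M"
  unfolding shift_def by (subst (2) steps_M_def, rule measurable_PiM_single')
    (auto intro: measurable_step cong: measurable_cong_sets)

lemma part_0 [simp]: "part \<xi> 0 = 0"
  by (simp add: part_def)

lemma part_Suc: "part \<xi> (Suc k) = part \<xi> k + \<xi> k"
  by (simp add: part_def)

lemma part_shift: "part (shift k \<xi>) i = part \<xi> (k + i) - part \<xi> k"
  by (induction i) (simp_all add: part_Suc shift_def algebra_simps)

lemma part_case_nat: "part (case_nat s \<xi>) (Suc k) = s + part \<xi> k"
  by (induction k) (simp_all add: part_Suc algebra_simps)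

lemma sequence_space_steps: "sequence_space (measure_pmf (step_pmf :: (int ^ 'd) pmf))"
  by unfold_locales

text \<open>The product measure is the image of two independent copies under
  \<open>comb_seq\<close>, which glues \<open>k\<close> steps of the first copy to the whole of the
  second; the event pulls back to a product set.\<close>

lemma prob_prefix_shift:
  fixes A B :: "(nat \<Rightarrow> int ^ 'd) \<Rightarrow> bool"
  assumes A: "prefix_determined k A" and B [measurable]: "Measurable.pred steps_M B"
  shows "\<P>(\<xi> in steps_M. A \<xi> \<and> B (shift k \<xi>)) = \<P>(\<xi> in steps_M. A \<xi>) * \<P>(\<xi> in steps_M. B \<xi>)"
proof -
  interpret sequence_space "measure_pmf (step_pmf :: (int ^ 'd) pmf)"
    by (rule sequence_space_steps)
  interpret st: prob_space "steps_M :: (nat \<Rightarrow> int ^ 'd) measure"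
    by (rule prob_space_steps_M)
  have [measurable]: "Measurable.pred steps_M A"
    using measurable_prefix_determined[OF A] .
  have S: "S = steps_M" by (simp add: steps_M_def)
  let ?f = "\<lambda>(\<omega>, \<omega>'). comb_seq k \<omega> \<omega>' :: nat \<Rightarrow> int ^ 'd"
  have meas: "?f \<in> steps_M \<Otimes>\<^sub>M steps_M \<rightarrow>\<^sub>M steps_M"
    using measurable_comb_seq[of k "measure_pmf (step_pmf :: (int ^ 'd) pmf)"] by (simp add: S)
  have "emeasure steps_M {\<xi>. A \<xi> \<and> B (shift k \<xi>)}
      = emeasure (distr (steps_M \<Otimes>\<^sub>M steps_M) steps_M ?f) {\<xi>. A \<xi> \<and> B (shift k \<xi>)}"
    using PiM_comb_seq[of k] by (simp add: S)
  also have "\<dots> = emeasure (steps_M \<Otimes>\<^sub>M steps_M) (?f -` {\<xi>. A \<xi> \<and> B (shift k \<xi>)} \<inter> space (steps_M \<Otimes>\<^sub>M steps_M))"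
    by (rule emeasure_distr[OF meas]) (rule sets_Collect_steps, measurable)
  also have "?f -` {\<xi>. A \<xi> \<and> B (shift k \<xi>)} \<inter> space (steps_M \<Otimes>\<^sub>M steps_M) = {\<xi>. A \<xi>} \<times> {\<xi>. B \<xi>}"
  proof -
    have 1: "A (comb_seq k \<omega> \<omega>') = A \<omega>" for \<omega> \<omega>'
      by (rule prefix_determinedD[OF A]) (simp add: comb_seq_def)
    have 2: "shift k (comb_seq k \<omega> \<omega>') = \<omega>'" for \<omega> \<omega>' :: "nat \<Rightarrow> int ^ 'd"
      by (simp add: shift_def comb_seq_def)
    show ?thesis by (auto simp: space_pair_measure 1 2)
  qed
  also have "emeasure (steps_M \<Otimes>\<^sub>M steps_M) ({\<xi>. A \<xi>} \<times> {\<xi>. B \<xi>})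
      = emeasure steps_M {\<xi>. A \<xi>} * emeasure steps_M {\<xi>. B \<xi>}"
    by (rule st.emeasure_pair_measure_Times; rule sets_Collect_steps; measurable)
  finally show ?thesis
    by (simp add: st.emeasure_eq_measure ennreal_mult[symmetric])
qed

lemma prob_shift:
  fixes B :: "(nat \<Rightarrow> int ^ 'd) \<Rightarrow> bool"
  assumes "Measurable.pred steps_M B"
  shows "\<P>(\<xi> in steps_M. B (shift k \<xi>)) = \<P>(\<xi> in steps_M. B \<xi>)"
proof -
  interpret st: prob_space "steps_M :: (nat \<Rightarrow> int ^ 'd) measure"
    by (rule prob_space_steps_M)
  show ?thesis
    using prob_prefix_shift[of k "\<lambda>_. True" B] assms st.prob_space
    by (simp add: prefix_determined_def)
qed

lemma distr_shift: "distr steps_M steps_M (shift k) = (steps_M :: (nat \<Rightarrow> int ^ 'd) measure)"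
proof (rule measure_eqI)
  interpret st: prob_space "steps_M :: (nat \<Rightarrow> int ^ 'd) measure"
    by (rule prob_space_steps_M)
  fix E :: "(nat \<Rightarrow> int ^ 'd) set"
  assume "E \<in> sets (distr steps_M steps_M (shift k))"
  then have E: "E \<in> sets steps_M" by simp
  then have "Measurable.pred steps_M (\<lambda>\<xi>. \<xi> \<in> E)" by measurable
  from prob_shift[OF this, of k] E
  show "emeasure (distr steps_M steps_M (shift k)) E = emeasure steps_M E"
    by (simp add: emeasure_distr st.emeasure_eq_measure vimage_def)
qed simp

text \<open>Markov property at a time on which the walk stops: \<open>A k\<close> is the event of stopping at time \<open>k\<close>.\<close>

lemma prob_stopped_shift_le:
  fixes A :: "nat \<Rightarrow> (nat \<Rightarrow> int ^ 'd) \<Rightarrow> bool"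
  assumes A: "\<And>k. prefix_determined k (A k)" and B [measurable]: "Measurable.pred steps_M B"
    and disj: "\<And>k l \<xi>. A k \<xi> \<Longrightarrow> A l \<xi> \<Longrightarrow> k = l"
  shows "\<P>(\<xi> in steps_M. \<exists>k. A k \<xi> \<and> B (shift k \<xi>))
    \<le> \<P>(\<xi> in steps_M. \<exists>k. A k \<xi>) * \<P>(\<xi> in steps_M. B \<xi>)"
proof -
  interpret st: prob_space "steps_M :: (nat \<Rightarrow> int ^ 'd) measure"
    by (rule prob_space_steps_M)
  have [measurable]: "Measurable.pred steps_M (A k)" for k
    using measurable_prefix_determined[OF A] .
  have "(\<lambda>k. measure steps_M {\<xi>. A k \<xi> \<and> B (shift k \<xi>)}) sums measure steps_M (\<Union>k. {\<xi>. A k \<xi> \<and> B (shift k \<xi>)})"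
    by (rule st.finite_measure_UNION)
      (auto simp: disjoint_family_on_def dest: disj intro!: sets_Collect_steps)
  moreover have "(\<lambda>k. measure steps_M {\<xi>. A k \<xi>}) sums measure steps_M (\<Union>k. {\<xi>. A k \<xi>})"
    by (rule st.finite_measure_UNION)
      (auto simp: disjoint_family_on_def dest: disj intro!: sets_Collect_steps)
  then have "(\<lambda>k. measure steps_M {\<xi>. A k \<xi>} * measure steps_M {\<xi>. B \<xi>}) sums
     (measure steps_M (\<Union>k. {\<xi>. A k \<xi>}) * measure steps_M {\<xi>. B \<xi>})"
    by (rule sums_mult2)
  moreover have "measure steps_M {\<xi>. A k \<xi> \<and> B (shift k \<xi>)} = measure steps_M {\<xi>. A k \<xi>} * measure steps_M {\<xi>. B \<xi>}" for k
    using prob_prefix_shift[OF A B] by simp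
  ultimately have "measure steps_M (\<Union>k. {\<xi>. A k \<xi> \<and> B (shift k \<xi>)}) = measure steps_M (\<Union>k. {\<xi>. A k \<xi>}) * measure steps_M {\<xi>. B \<xi>}"
    by (simp add: sums_iff)
  then show ?thesis
    by (simp add: Collect_ex_eq)
qed

text \<open>By \<open>PiM_iter\<close> the step sequence is a uniform first step followed by an
  independent copy of itself. Through this, hitting probabilities become solutions of difference
  equations.\<close>

lemma nn_integral_first_step:
  fixes F :: "(nat \<Rightarrow> int ^ 'd) \<Rightarrow> ennreal"
  assumes [measurable]: "F \<in> borel_measurable steps_M"
  shows "(\<integral>\<^sup>+\<xi>. F \<xi> \<partial>steps_M)
     = (\<Sum>s\<in>unit_steps. \<integral>\<^sup>+\<xi>. F (case_nat s \<xi>) \<partial>steps_M) / ennreal (real (card (unit_steps :: (int ^ 'd) set)))"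
proof -
  interpret sequence_space "measure_pmf (step_pmf :: (int ^ 'd) pmf)"
    by (rule sequence_space_steps)
  interpret st: prob_space "steps_M :: (nat \<Rightarrow> int ^ 'd) measure"
    by (rule prob_space_steps_M)
  have S: "S = steps_M" by (simp add: steps_M_def)
  let ?P = "measure_pmf (step_pmf :: (int ^ 'd) pmf)"
  have meas: "(\<lambda>(s, \<omega>). case_nat s \<omega>) \<in> ?P \<Otimes>\<^sub>M steps_M \<rightarrow>\<^sub>M steps_M"
    unfolding S[symmetric] by measurable
  have "(\<integral>\<^sup>+\<xi>. F \<xi> \<partial>steps_M) = (\<integral>\<^sup>+\<xi>. F \<xi> \<partial>distr (?P \<Otimes>\<^sub>M steps_M) steps_M (\<lambda>(s, \<omega>). case_nat s \<omega>))"
    using PiM_iter by (simp add: S)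
  also have "\<dots> = (\<integral>\<^sup>+z. F (case z of (s, \<omega>) \<Rightarrow> case_nat s \<omega>) \<partial>(?P \<Otimes>\<^sub>M steps_M))"
    by (rule nn_integral_distr[OF meas]) simp
  also have "\<dots> = (\<integral>\<^sup>+s. \<integral>\<^sup>+\<omega>. F (case_nat s \<omega>) \<partial>steps_M \<partial>?P)"
    by (subst st.nn_integral_fst[symmetric]) (use meas in measurable)
  also have "\<dots> = (\<Sum>s\<in>unit_steps. \<integral>\<^sup>+\<xi>. F (case_nat s \<xi>) \<partial>steps_M) / ennreal (real (card (unit_steps :: (int ^ 'd) set)))"
    by (subst nn_integral_pmf_of_set) (auto simp: ennreal_of_nat_eq_real_of_nat)
  finally show ?thesis .
qed

lemma measurable_case_nat_steps [measurable]:
  "case_nat s \<in> (steps_M :: (nat \<Rightarrow> int ^ 'd) measure) \<rightarrow>\<^sub>M steps_M"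
proof (subst (2) steps_M_def, rule measurable_PiM_single')
  show "(\<lambda>\<omega>. case i of 0 \<Rightarrow> s | Suc k \<Rightarrow> \<omega> k) \<in> (steps_M :: (nat \<Rightarrow> int ^ 'd) measure) \<rightarrow>\<^sub>M measure_pmf step_pmf" for i
    using measurable_step by (cases i) (auto cong: measurable_cong_sets)
qed simp

lemma prob_first_step:
  fixes Q :: "(nat \<Rightarrow> int ^ 'd) \<Rightarrow> bool"
  assumes [measurable]: "Measurable.pred steps_M Q"
  shows "\<P>(\<xi> in steps_M. Q \<xi>)
     = (\<Sum>s\<in>unit_steps. \<P>(\<xi> in steps_M. Q (case_nat s \<xi>))) / real (card (unit_steps :: (int ^ 'd) set))"
proof -
  interpret st: prob_space "steps_M :: (nat \<Rightarrow> int ^ 'd) measure"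
    by (rule prob_space_steps_M)
  have "(\<integral>\<^sup>+\<xi>. indicator {\<xi>. Q \<xi>} \<xi> \<partial>steps_M) = (\<Sum>s\<in>unit_steps. \<integral>\<^sup>+\<xi>. indicator {\<xi>. Q \<xi>} (case_nat s \<xi>) \<partial>steps_M) / ennreal (real (card (unit_steps :: (int ^ 'd) set)))"
    by (rule nn_integral_first_step) (simp add: sets_Collect_steps)
  moreover have "(\<integral>\<^sup>+\<xi>. indicator {\<xi>. Q \<xi>} (case_nat s \<xi>) \<partial>steps_M) = (\<integral>\<^sup>+\<xi>. indicator {\<xi>. Q (case_nat s \<xi>)} \<xi> \<partial>steps_M)" for s
    by (intro nn_integral_cong) (auto simp: indicator_def)
  ultimately have "ennreal (measure steps_M {\<xi>. Q \<xi>}) = (\<Sum>s\<in>unit_steps. ennreal (measure steps_M {\<xi>. Q (case_nat s \<xi>)})) / ennreal (real (card (unit_steps :: (int ^ 'd) set)))"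
    by (subst (asm) (1 2) nn_integral_indicator) (auto intro!: sets_Collect_steps simp: st.emeasure_eq_measure)
  also have "\<dots> = ennreal ((\<Sum>s\<in>unit_steps. measure steps_M {\<xi>. Q (case_nat s \<xi>)}) / real (card (unit_steps :: (int ^ 'd) set)))"
    using card_unit_steps_pos[where 'd='d]
    by (subst sum_ennreal) (auto simp: divide_ennreal sum_nonneg)
  finally show ?thesis
    by (simp add: sum_nonneg)
qed

lemma nbr_avg_nonneg: "(\<And>x. 0 \<le> f x) \<Longrightarrow> 0 \<le> nbr_avg f x"
  by (simp add: nbr_avg_def sum_nonneg)

lemma nbr_avg_pow_nonneg: "(\<And>x. 0 \<le> f x) \<Longrightarrow> 0 \<le> (nbr_avg ^^ k) f x"
  by (induction k arbitrary: x) (auto intro: nbr_avg_nonneg)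

text \<open>\<open>nbr_avg\<close> is the transition operator of the walk, so its powers give
  expectations at fixed times. This is the passage from path space to functions on the
  lattice.\<close>

lemma nn_integral_walk:
  fixes f :: "int ^ 'd \<Rightarrow> real"
  assumes "\<And>x. 0 \<le> f x"
  shows "(\<integral>\<^sup>+\<xi>. ennreal (f (x + part \<xi> k)) \<partial>steps_M) = ennreal ((nbr_avg ^^ k) f x)"
proof (induction k arbitrary: x)
  case 0
  interpret st: prob_space "steps_M :: (nat \<Rightarrow> int ^ 'd) measure"
    by (rule prob_space_steps_M)
  show ?case by (simp add: st.emeasure_space_1[simplified])
next
  case (Suc k)
  have [measurable]: "(\<lambda>\<xi>. ennreal (f (x + part \<xi> j))) \<in> borel_measurable steps_M" for j
    by measurable
  have "(\<integral>\<^sup>+\<xi>. ennreal (f (x + part \<xi> (Suc k))) \<partial>steps_M)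
     = (\<Sum>s\<in>unit_steps. \<integral>\<^sup>+\<xi>. ennreal (f (x + part (case_nat s \<xi>) (Suc k))) \<partial>steps_M) / ennreal (real (card (unit_steps :: (int ^ 'd) set)))"
    by (rule nn_integral_first_step) simp
  also have "\<dots> = (\<Sum>s\<in>unit_steps. ennreal ((nbr_avg ^^ k) f (x + s))) / ennreal (real (card (unit_steps :: (int ^ 'd) set)))"
    using Suc by (simp add: part_case_nat add.assoc[symmetric])
  also have "\<dots> = ennreal (nbr_avg ((nbr_avg ^^ k) f) x)"
    unfolding nbr_avg_def[of "(nbr_avg ^^ k) f"]
    using nbr_avg_pow_nonneg[of f k, OF assms] card_unit_steps_pos[where 'd='d]
    by (subst sum_ennreal) (auto simp: divide_ennreal sum_nonneg)
  finally show ?case by simp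
qed

lemma prob_walk_in:
  fixes A :: "(int ^ 'd) set"
  shows "\<P>(\<xi> in steps_M. x + part \<xi> k \<in> A) = (nbr_avg ^^ k) (indicator A) x"
proof -
  interpret st: prob_space "steps_M :: (nat \<Rightarrow> int ^ 'd) measure"
    by (rule prob_space_steps_M)
  have "emeasure steps_M {\<xi>. x + part \<xi> k \<in> A} = (\<integral>\<^sup>+\<xi>. indicator {\<xi>. x + part \<xi> k \<in> A} \<xi> \<partial>steps_M)"
    by (subst nn_integral_indicator) (auto intro!: sets_Collect_steps)
  also have "\<dots> = (\<integral>\<^sup>+\<xi>. ennreal (indicator A (x + part \<xi> k)) \<partial>steps_M)"
    by (intro nn_integral_cong) (auto simp: indicator_def)
  also have "\<dots> = ennreal ((nbr_avg ^^ k) (indicator A) x)"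
    by (rule nn_integral_walk) simp
  finally show ?thesis
    by (simp add: st.emeasure_eq_measure nbr_avg_pow_nonneg)
qed

lemma measurable_walk [measurable]:
  "(\<lambda>\<xi> k. x + part \<xi> k) \<in> (steps_M :: (nat \<Rightarrow> int ^ 'd) measure) \<rightarrow>\<^sub>M (\<Pi>\<^sub>M k\<in>UNIV. count_space UNIV)"
  by (rule measurable_PiM_single') (auto intro: measurable_compose[OF measurable_part])

lemma prob_srw:
  fixes x :: "int ^ 'd"
  assumes "Measurable.pred (\<Pi>\<^sub>M k\<in>UNIV. count_space UNIV) Q"
  shows "\<P>(\<omega> in srw x. Q \<omega>) = \<P>(\<xi> in steps_M. Q (\<lambda>k. x + part \<xi> k))"
proof -
  have "srw x = distr steps_M (\<Pi>\<^sub>M k\<in>UNIV. count_space UNIV) (\<lambda>\<xi> k. x + part \<xi> k)"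
    by (simp add: srw_def steps_M_def part_def)
  moreover have "measure (distr steps_M (\<Pi>\<^sub>M k\<in>UNIV. count_space UNIV) (\<lambda>\<xi> k. x + part \<xi> k)) {\<omega> \<in> space (\<Pi>\<^sub>M k\<in>UNIV. count_space UNIV). Q \<omega>}
     = measure steps_M {\<xi> \<in> space steps_M. Q (\<lambda>k. x + part \<xi> k)}"
    by (subst measure_distr[OF measurable_walk])
      (use assms in \<open>auto simp: space_PiM pred_def intro!: arg_cong[where f="measure steps_M"]\<close>)
  ultimately show ?thesis by simp
qed

subsection \<open>Green function and capacity\<close>

lemma nbr_avg_add: "nbr_avg (\<lambda>x. f x + g x) = (\<lambda>x. nbr_avg f x + nbr_avg g x)"
  by (simp add: nbr_avg_def fun_eq_iff sum.distrib add_divide_distrib)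

lemma nbr_avg_diff: "nbr_avg (\<lambda>x. f x - g x) = (\<lambda>x. nbr_avg f x - nbr_avg g x)"
  by (simp add: nbr_avg_def fun_eq_iff sum_subtractf diff_divide_distrib)

lemma nbr_avg_scale: "nbr_avg (\<lambda>x. c * f x) = (\<lambda>x. c * nbr_avg f x)"
  by (simp add: nbr_avg_def fun_eq_iff sum_distrib_left)

lemma nbr_avg_const [simp]: "nbr_avg (\<lambda>x::int^'d. c) x = c"
  using card_unit_steps_pos[where 'd='d] by (simp add: nbr_avg_def)

lemma nbr_avg_sum: "nbr_avg (\<lambda>x. \<Sum>i\<in>I. f i x) = (\<lambda>x. \<Sum>i\<in>I. nbr_avg (f i) x)"
  unfolding nbr_avg_def by (subst sum.swap) (simp add: sum_divide_distrib)

lemma nbr_avg_mono: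
  assumes "\<And>s. s \<in> unit_steps \<Longrightarrow> f (x + s) \<le> g (x + s)"
  shows "nbr_avg f x \<le> nbr_avg g x"
  unfolding nbr_avg_def by (intro divide_right_mono sum_mono assms) auto

lemma nbr_avg_translate: "nbr_avg (\<lambda>x. f (x - z)) = (\<lambda>x. nbr_avg f (x - z))"
  by (simp add: nbr_avg_def fun_eq_iff algebra_simps)

lemma nbr_avg_reflect: "nbr_avg (\<lambda>x. f (- x)) = (\<lambda>x. nbr_avg f (- x))" for f :: "int ^ 'd \<Rightarrow> real"
proof
  fix x :: "int ^ 'd"
  have "(\<Sum>s\<in>unit_steps. f (- (x + s))) = (\<Sum>s\<in>unit_steps. f (- x + s))"
    by (rule sum.reindex_bij_witness[of _ uminus uminus]) (auto simp: uminus_unit_step)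
  then show "nbr_avg (\<lambda>x. f (- x)) x = nbr_avg f (- x)"
    by (simp add: nbr_avg_def)
qed

lemma nbr_avg_pow_add: "(nbr_avg ^^ n) (\<lambda>x. f x + g x) = (\<lambda>x. (nbr_avg ^^ n) f x + (nbr_avg ^^ n) g x)"
  by (induction n) (simp_all add: nbr_avg_add)

lemma nbr_avg_pow_scale: "(nbr_avg ^^ n) (\<lambda>x. c * f x) = (\<lambda>x. c * (nbr_avg ^^ n) f x)"
  by (induction n) (simp_all add: nbr_avg_scale)

lemma nbr_avg_pow_sum: "(nbr_avg ^^ n) (\<lambda>x. \<Sum>i\<in>I. f i x) = (\<lambda>x. \<Sum>i\<in>I. (nbr_avg ^^ n) (f i) x)"
  by (induction n) (simp_all add: nbr_avg_sum)

lemma nbr_avg_pow_translate: "(nbr_avg ^^ n) (\<lambda>x. f (x - z)) = (\<lambda>x. (nbr_avg ^^ n) f (x - z))"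
  by (induction n) (simp_all add: nbr_avg_translate)

lemma nbr_avg_pow_reflect: "(nbr_avg ^^ n) (\<lambda>x. f (- x)) = (\<lambda>x. (nbr_avg ^^ n) f (- x))"
  by (induction n) (simp_all add: nbr_avg_reflect)

lemma nbr_avg_pow_mono:
  assumes "\<And>x. f x \<le> g x"
  shows "(nbr_avg ^^ n) f x \<le> (nbr_avg ^^ n) g x"
  by (induction n arbitrary: x) (auto intro: nbr_avg_mono assms)

lemma nbr_avg_pow_const [simp]: "(nbr_avg ^^ n) (\<lambda>x::int^'d. c) x = c"
proof (induction n arbitrary: x)
  case (Suc n)
  have "(nbr_avg ^^ n) (\<lambda>x::int^'d. c) = (\<lambda>x. c)" by (rule ext) (rule Suc)
  then show ?case by simp
qed simp

text \<open>Dynkin's formula at the fixed time \<open>n\<close>, in operator form: expected sums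
  along the walk are read off from any function having the summand as its Laplacian.\<close>

lemma nbr_avg_telescope:
  "(nbr_avg ^^ n) f x + (\<Sum>k<n. (nbr_avg ^^ k) (\<lambda>x. f x - nbr_avg f x) x) = f x"
proof (induction n)
  case (Suc n)
  have "(nbr_avg ^^ n) f x = (nbr_avg ^^ n) (\<lambda>x. (f x - nbr_avg f x) + nbr_avg f x) x"
    by simp
  also have "\<dots> = (nbr_avg ^^ n) (\<lambda>x. f x - nbr_avg f x) x + (nbr_avg ^^ n) (nbr_avg f) x"
    unfolding nbr_avg_pow_add by simp
  finally show ?case
    using Suc by (simp add: funpow_swap1)
qed simp

text \<open>The nonnegative remainder \<open>(nbr_avg ^^ n) f\<close> is dropped from the telescoped
  identity, which makes the bound uniform in \<open>n\<close>.\<close>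

lemma nbr_avg_superharmonic_sum:
  assumes "\<And>x. nbr_avg f x \<le> f x - r x" "\<And>x. 0 \<le> f x"
  shows "(\<Sum>k<n. (nbr_avg ^^ k) r x) \<le> f x"
proof -
  have "(\<Sum>k<n. (nbr_avg ^^ k) r x) \<le> (\<Sum>k<n. (nbr_avg ^^ k) (\<lambda>x. f x - nbr_avg f x) x)"
    by (intro sum_mono nbr_avg_pow_mono) (use assms(1) in \<open>simp add: le_diff_eq add.commute\<close>)
  also have "\<dots> \<le> f x"
    using nbr_avg_telescope[of n f x] nbr_avg_pow_nonneg[of f n x] assms(2) by simp
  finally show ?thesis .
qed

text \<open>The heat kernel, given as an iterated average so that recursion and linearity are
  immediate. The resulting \<open>green\<close> is the expected number of visits, without division
  by 2d; the weight 2d stays a separate factor of \<open>cap\<close>.\<close>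

definition hk :: "nat \<Rightarrow> int ^ 'd \<Rightarrow> real" where
  "hk n = (nbr_avg ^^ n) (indicator {0})"

definition green :: "int ^ 'd \<Rightarrow> real" where
  "green x = (\<Sum>n. hk n x)"

lemma hk_nonneg [simp]: "0 \<le> hk n x"
  unfolding hk_def by (rule nbr_avg_pow_nonneg) simp

lemma hk_le_1: "hk n x \<le> 1"
  using nbr_avg_pow_mono[of "indicator {0}" "\<lambda>_. 1" n x] by (auto simp: hk_def indicator_def)

lemma hk_minus: "hk n (- x) = hk n x" for x :: "int ^ 'd"
proof -
  have "(\<lambda>x::int^'d. indicator {0} (- x)) = (indicator {0} :: _ \<Rightarrow> real)"
    by (auto simp: fun_eq_iff indicator_def)
  then show ?thesis
    using fun_cong[OF nbr_avg_pow_reflect[of n "indicator {0}"], of x] unfolding hk_def by simp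
qed

lemma nbr_avg_pow_indicator:
  assumes "finite A"
  shows "(nbr_avg ^^ n) (indicator A) x = (\<Sum>z\<in>A. hk n (x - z))"
proof -
  have "(indicator A :: _ \<Rightarrow> real) = (\<lambda>x. \<Sum>z\<in>A. indicator {0} (x - z))"
    using assms by (auto simp: fun_eq_iff indicator_def sum.delta if_distrib cong: if_cong)
  then show ?thesis
    by (simp add: nbr_avg_pow_sum nbr_avg_pow_translate hk_def)
qed

section \<open>Escape and hitting probabilities\<close>

definition esc :: "(int ^ 'd) set \<Rightarrow> int ^ 'd \<Rightarrow> real" where
  "esc A x = \<P>(\<xi> in steps_M. \<forall>n. x + part \<xi> (Suc n) \<notin> A)"

definition hit :: "(int ^ 'd) set \<Rightarrow> int ^ 'd \<Rightarrow> real" where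
  "hit A x = \<P>(\<xi> in steps_M. \<exists>n. x + part \<xi> n \<in> A)"

lemma pred_part [measurable]: "Measurable.pred steps_M (\<lambda>\<xi>. P (part \<xi> n))"
  by (rule measurable_compose[OF measurable_part]) simp

lemma cap_eq_esc:
  fixes A :: "(int ^ 'd) set"
  shows "cap A = 2 * real CARD('d) * (\<Sum>x\<in>A. esc A x)"
proof -
  have eq: "hitting_time A \<omega> = \<infinity> \<longleftrightarrow> (\<forall>n. \<omega> (Suc n) \<notin> A)" for \<omega> :: "nat \<Rightarrow> int ^ 'd"
  proof -
    have "hitting_time A \<omega> = \<infinity> \<longleftrightarrow> {enat n | n. n \<ge> 1 \<and> \<omega> n \<in> A} = {}"
    proof
      assume *: "hitting_time A \<omega> = \<infinity>"
      show "{enat n | n. n \<ge> 1 \<and> \<omega> n \<in> A} = {}"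
      proof (rule ccontr)
        assume "\<not> ?thesis"
        then obtain n where "n \<ge> 1" "\<omega> n \<in> A" by auto
        then have "hitting_time A \<omega> \<le> enat n"
          unfolding hitting_time_def by (intro Inf_lower) auto
        with * show False by simp
      qed
    next
      assume "{enat n | n. n \<ge> 1 \<and> \<omega> n \<in> A} = {}"
      then show "hitting_time A \<omega> = \<infinity>"
        unfolding hitting_time_def by (simp only: Inf_empty top_enat_def)
    qed
    also have "\<dots> \<longleftrightarrow> (\<forall>n. \<omega> (Suc n) \<notin> A)"
      by (auto simp: gr0_conv_Suc Suc_le_eq)
    finally show ?thesis .
  qed
  have "\<P>(\<omega> in srw x. hitting_time A \<omega> = \<infinity>) = esc A x" for x
    unfolding eq esc_def
  proof (rule prob_srw)
    show "Measurable.pred (\<Pi>\<^sub>M k\<in>UNIV. count_space UNIV) (\<lambda>\<omega>. \<forall>n. \<omega> (Suc n) \<notin> A)"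
    proof (rule pred_intros_countable)
      show "Measurable.pred (\<Pi>\<^sub>M k\<in>UNIV. count_space UNIV) (\<lambda>\<omega>. \<omega> (Suc n) \<notin> A)" for n
        by (rule measurable_compose[OF measurable_component_singleton]) auto
    qed
  qed
  then show ?thesis
    by (simp add: cap_def sum_distrib_left)
qed

lemma esc_nonneg [simp]: "0 \<le> esc A x" by (simp add: esc_def)
lemma hit_nonneg [simp]: "0 \<le> hit A x" by (simp add: hit_def)
lemma hit_le_1: "hit A x \<le> 1"
  unfolding hit_def by (rule prob_space.prob_le_1[OF prob_space_steps_M])
lemma hit_in: "x \<in> A \<Longrightarrow> hit A x = 1"
proof -
  interpret st: prob_space "steps_M :: (nat \<Rightarrow> int ^ 'd) measure"
    by (rule prob_space_steps_M)
  assume x: "x \<in> A"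
  then have "x + part \<xi> 0 \<in> A" for \<xi> by simp
  then have "{\<xi>. \<exists>n. x + part \<xi> n \<in> A} = UNIV" by blast
  then show "hit A x = 1"
    using st.prob_space by (simp add: hit_def)
qed

lemma nbr_avg_hit: "nbr_avg (hit A) x = 1 - esc A x"
proof -
  interpret st: prob_space "steps_M :: (nat \<Rightarrow> int ^ 'd) measure"
    by (rule prob_space_steps_M)
  have "\<P>(\<xi> in steps_M. \<exists>n. x + part \<xi> (Suc n) \<in> A) = nbr_avg (hit A) x"
    by (subst prob_first_step) (auto simp: part_case_nat nbr_avg_def hit_def add.assoc)
  moreover have "\<P>(\<xi> in steps_M. \<not> (\<forall>n. x + part \<xi> (Suc n) \<notin> A)) = 1 - esc A x"
    unfolding esc_def by (rule st.prob_neg) measurable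
  ultimately show ?thesis by simp
qed

text \<open>Off \<open>A\<close>, time 0 cannot be a hit, so conditioning on the first step loses
  nothing; on \<open>A\<close> the value is 1 and one step leaves the complement of
  \<open>esc\<close>. This identifies \<open>esc\<close> as the charge of
  \<open>hit A\<close>.\<close>

lemma hit_laplacian: "hit A x - nbr_avg (hit A) x = (if x \<in> A then esc A x else 0)"
proof (cases "x \<in> A")
  case True
  then show ?thesis by (simp add: hit_in nbr_avg_hit)
next
  case False
  have "(\<exists>n. x + part \<xi> n \<in> A) \<longleftrightarrow> (\<exists>n. x + part \<xi> (Suc n) \<in> A)" for \<xi>
    using False by (metis add.right_neutral not0_implies_Suc part_0)
  then have "hit A x = nbr_avg (hit A) x"
    unfolding hit_def[of A x]
    by (simp only:, subst prob_first_step) (auto simp: part_case_nat nbr_avg_def hit_def add.assoc)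
  with False show ?thesis by simp
qed

text \<open>Summability of the heat kernel is all that this potential theory asks of the dimension;
  \<open>transient_3\<close> and \<open>transient_4\<close> supply it.\<close>

locale transient =
  fixes D :: "(int ^ 'd) itself"
  assumes summable_hk: "\<And>x :: int ^ 'd. summable (\<lambda>n. hk n x)"
begin

lemma green_nonneg: "0 \<le> green (x :: int ^ 'd)"
  unfolding green_def by (intro suminf_nonneg summable_hk) simp

lemma green_minus: "green (- x) = green (x :: int ^ 'd)"
  by (simp add: green_def hk_minus)

lemma green_commute: "green (x - y) = green (y - x :: int ^ 'd)"
  using green_minus[of "x - y"] by simp

lemma sum_hk_le_green: "(\<Sum>k<n. hk k x) \<le> green (x :: int ^ 'd)"
  unfolding green_def by (intro sum_le_suminf summable_hk) auto

lemma nbr_avg_green: "nbr_avg green x = green (x :: int ^ 'd) - indicator {0} x"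
proof -
  have "(\<lambda>n. nbr_avg (hk n) x) sums nbr_avg green x"
    unfolding nbr_avg_def green_def
    by (intro sums_divide sums_sum summable_sums summable_hk)
  then have "(\<lambda>n. hk (Suc n) x) sums nbr_avg green x"
    by (simp add: hk_def)
  moreover have "(\<lambda>n. hk (Suc n) x) sums (green x - hk 0 x)"
    unfolding green_def using summable_hk[of x] by (subst sums_Suc_iff) (auto simp: summable_sums)
  ultimately show ?thesis
    by (auto simp: hk_def dest: sums_unique2)
qed

text \<open>The right side is a tail of the Green series; being a null sequence, it controls the
  remainders left by telescoping.\<close>

lemma nbr_avg_pow_green: "(nbr_avg ^^ n) green x = green (x :: int ^ 'd) - (\<Sum>k<n. hk k x)"
  using nbr_avg_telescope[of n green x] by (simp add: nbr_avg_green hk_def)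

lemma nbr_avg_pow_green_tendsto: "(\<lambda>n. (nbr_avg ^^ n) green x) \<longlonglongrightarrow> 0" for x :: "int ^ 'd"
proof -
  have "(\<lambda>n. green x - (\<Sum>k<n. hk k x)) \<longlonglongrightarrow> green x - green x"
    unfolding green_def by (intro tendsto_intros summable_LIMSEQ summable_hk)
  then show ?thesis by (simp add: nbr_avg_pow_green)
qed

lemma hit_le_green:
  fixes A :: "(int ^ 'd) set"
  assumes "finite A"
  shows "hit A y \<le> (\<Sum>x\<in>A. green (y - x))"
proof -
  interpret st: prob_space "steps_M :: (nat \<Rightarrow> int ^ 'd) measure"
    by (rule prob_space_steps_M)
  have eq: "measure steps_M {\<xi>. y + part \<xi> n \<in> A} = (\<Sum>x\<in>A. hk n (y - x))" for n
    using prob_walk_in[of y n A] nbr_avg_pow_indicator[OF assms, of n y] by simp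
  have s: "(\<lambda>n. \<Sum>x\<in>A. hk n (y - x)) sums (\<Sum>x\<in>A. green (y - x))"
    unfolding green_def by (intro sums_sum summable_sums summable_hk)
  have "hit A y = measure steps_M (\<Union>n. {\<xi>. y + part \<xi> n \<in> A})"
    by (simp add: hit_def Collect_ex_eq)
  also have "\<dots> \<le> (\<Sum>n. measure steps_M {\<xi>. y + part \<xi> n \<in> A})"
    by (rule st.finite_measure_subadditive_countably)
      (use s in \<open>auto simp: eq sums_iff intro!: sets_Collect_steps\<close>)
  also have "\<dots> = (\<Sum>x\<in>A. green (y - x))"
    using s by (simp add: eq sums_iff)
  finally show ?thesis .
qed

text \<open>Last-exit decomposition: \<open>hit A - nbr_avg (hit A)\<close> equals \<open>esc A\<close> on \<open>A\<close> and \<open>0\<close> elsewhere.\<close>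

lemma hit_eq_green_esc:
  fixes A :: "(int ^ 'd) set"
  assumes A: "finite A"
  shows "hit A y = (\<Sum>x\<in>A. esc A x * green (y - x))"
proof -
  have lap: "(\<lambda>x. hit A x - nbr_avg (hit A) x) = (\<lambda>x. \<Sum>z\<in>A. esc A z * indicator {0} (x - z))"
    using A by (auto simp: fun_eq_iff hit_laplacian indicator_def sum.delta if_distrib cong: if_cong)
  have tel: "hit A y = (nbr_avg ^^ n) (hit A) y + (\<Sum>z\<in>A. esc A z * (\<Sum>k<n. hk k (y - z)))" for n
  proof -
    have "(nbr_avg ^^ k) (\<lambda>x. hit A x - nbr_avg (hit A) x) y = (\<Sum>z\<in>A. esc A z * hk k (y - z))" for k
      unfolding lap nbr_avg_pow_sum nbr_avg_pow_scale nbr_avg_pow_translate by (simp add: hk_def)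
    then show ?thesis
      using nbr_avg_telescope[of n "hit A" y]
      by (simp add: sum_distrib_left sum.swap[of _ A])
  qed
  \<comment> \<open>The union bound \<open>hit_le_green\<close> dominates \<open>hit A\<close> by
    finitely many translated Green functions, whose iterated averages tend to 0.\<close>
  have lim0: "(\<lambda>n. (nbr_avg ^^ n) (hit A) y) \<longlonglongrightarrow> 0"
  proof (rule tendsto_sandwich[of "\<lambda>_. 0"])
    show "\<forall>\<^sub>F n in sequentially. 0 \<le> (nbr_avg ^^ n) (hit A) y"
      by (simp add: nbr_avg_pow_nonneg)
    show "\<forall>\<^sub>F n in sequentially. (nbr_avg ^^ n) (hit A) y \<le> (\<Sum>x\<in>A. (nbr_avg ^^ n) green (y - x))"
    proof (rule always_eventually, rule allI)
      fix n
      have "(nbr_avg ^^ n) (hit A) y \<le> (nbr_avg ^^ n) (\<lambda>y. \<Sum>x\<in>A. green (y - x)) y"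
        by (rule nbr_avg_pow_mono) (rule hit_le_green[OF A])
      also have "\<dots> = (\<Sum>x\<in>A. (nbr_avg ^^ n) green (y - x))"
        by (simp add: nbr_avg_pow_sum nbr_avg_pow_translate)
      finally show "(nbr_avg ^^ n) (hit A) y \<le> (\<Sum>x\<in>A. (nbr_avg ^^ n) green (y - x))" .
    qed
    show "(\<lambda>n. \<Sum>x\<in>A. (nbr_avg ^^ n) green (y - x)) \<longlonglongrightarrow> 0"
      by (rule tendsto_eq_rhs, rule tendsto_sum, rule nbr_avg_pow_green_tendsto) simp
  qed simp
  have "(\<lambda>n. (nbr_avg ^^ n) (hit A) y + (\<Sum>z\<in>A. esc A z * (\<Sum>k<n. hk k (y - z))))
      \<longlonglongrightarrow> 0 + (\<Sum>z\<in>A. esc A z * green (y - z))"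
    unfolding green_def by (intro tendsto_intros lim0 summable_LIMSEQ summable_hk)
  then show ?thesis
    unfolding tel[symmetric] by (simp add: LIMSEQ_const_iff)
qed

text \<open>The potential of the points \<open>y i\<close> is integrated against the charge
  \<open>esc A\<close>: by symmetry of \<open>green\<close> and the last-exit formula each point
  contributes \<open>hit A (y i)\<close>, which is at most 1.\<close>

lemma cap_upper:
  fixes A :: "(int ^ 'd) set" and y :: "'i \<Rightarrow> int ^ 'd"
  assumes A: "finite A" and "finite I" and \<beta>: "0 < \<beta>"
    and pot: "\<And>x. x \<in> A \<Longrightarrow> \<beta> \<le> (\<Sum>i\<in>I. green (x - y i))"
  shows "(\<Sum>x\<in>A. esc A x) \<le> real (card I) / \<beta>"
proof -
  have "\<beta> * (\<Sum>x\<in>A. esc A x) \<le> (\<Sum>x\<in>A. esc A x * (\<Sum>i\<in>I. green (x - y i)))"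
    unfolding sum_distrib_left[of \<beta>]
    by (intro sum_mono) (use pot in \<open>auto intro!: mult_left_mono simp: mult.commute[of \<beta>]\<close>)
  also have "\<dots> = (\<Sum>i\<in>I. hit A (y i))"
    unfolding hit_eq_green_esc[OF A] sum_distrib_left
    by (subst sum.swap) (simp add: green_commute)
  also have "\<dots> \<le> (\<Sum>i\<in>I. 1)"
    by (intro sum_mono hit_le_1)
  finally show ?thesis
    using \<beta> by (simp add: field_simps)
qed

text \<open>The charges of \<open>A\<close> and \<open>B\<close> are paired through the symmetric
  kernel \<open>green\<close>: \<open>hit B\<close> equals 1 on \<open>A\<close>, whereas
  \<open>hit A\<close> is at most 1 on \<open>B\<close>.\<close>

lemma sum_esc_mono:
  fixes A B :: "(int ^ 'd) set"
  assumes "finite B" "A \<subseteq> B"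
  shows "(\<Sum>x\<in>A. esc A x) \<le> (\<Sum>x\<in>B. esc B x)"
proof -
  have A: "finite A" using assms finite_subset by blast
  have "(\<Sum>x\<in>A. esc A x) = (\<Sum>x\<in>A. esc A x * hit B x)"
    using assms by (intro sum.cong) (auto simp: hit_in)
  also have "\<dots> = (\<Sum>z\<in>B. esc B z * hit A z)"
    unfolding hit_eq_green_esc[OF A] hit_eq_green_esc[OF assms(1)] sum_distrib_left
    by (subst sum.swap) (simp add: green_commute mult_ac)
  also have "\<dots> \<le> (\<Sum>z\<in>B. esc B z)"
    by (intro sum_mono) (simp add: mult_left_le hit_le_1)
  finally show ?thesis .
qed

text \<open>Dual to \<open>cap_upper\<close>, with the charge of the image of \<open>y\<close> as
  test measure; \<open>sum_esc_mono\<close> then passes to \<open>A\<close>. The points form an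
  indexed family because a walk revisits sites and every visit has to count.\<close>

lemma cap_lower:
  fixes A :: "(int ^ 'd) set" and y :: "'i \<Rightarrow> int ^ 'd"
  assumes A: "finite A" and I: "finite I" and yA: "y ` I \<subseteq> A" and \<beta>: "0 < \<beta>"
    and pot: "\<And>j. j \<in> I \<Longrightarrow> (\<Sum>i\<in>I. green (y j - y i)) \<le> \<beta>"
  shows "real (card I) / \<beta> \<le> (\<Sum>x\<in>A. esc A x)"
proof -
  let ?A = "y ` I"
  have fin: "finite ?A" using I by simp
  have "real (card I) = (\<Sum>i\<in>I. hit ?A (y i))"
    by (simp add: hit_in)
  also have "\<dots> = (\<Sum>x\<in>?A. esc ?A x * (\<Sum>i\<in>I. green (x - y i)))"
    unfolding hit_eq_green_esc[OF fin] sum_distrib_left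
    by (subst sum.swap) (simp add: green_commute)
  also have "\<dots> \<le> (\<Sum>x\<in>?A. esc ?A x * \<beta>)"
    by (intro sum_mono mult_left_mono) (auto intro: pot)
  also have "\<dots> = \<beta> * (\<Sum>x\<in>?A. esc ?A x)"
    by (simp add: sum_distrib_left mult.commute)
  also have "\<dots> \<le> \<beta> * (\<Sum>x\<in>A. esc A x)"
    using \<beta> by (intro mult_left_mono sum_esc_mono A yA) auto
  finally show ?thesis
    using \<beta> by (simp add: field_simps)
qed

lemma cap_mono:
  fixes A B :: "(int ^ 'd) set"
  assumes "finite B" "A \<subseteq> B"
  shows "cap A \<le> cap B"
  using sum_esc_mono[OF assms] by (simp add: cap_eq_esc)

end

lemma cap_translate: "cap ((\<lambda>x. x + z) ` A) = cap A" for A :: "(int ^ 'd) set"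
proof -
  have "esc ((\<lambda>x. x + z) ` A) (x + z) = esc A x" for x
  proof -
    have "x + z + v \<in> (\<lambda>x. x + z) ` A \<longleftrightarrow> x + v \<in> A" for v
      by (auto simp: image_iff algebra_simps)
    then show ?thesis by (simp add: esc_def)
  qed
  moreover have "(\<Sum>x\<in>(\<lambda>x. x + z) ` A. esc ((\<lambda>x. x + z) ` A) x) = (\<Sum>x\<in>A. esc ((\<lambda>x. x + z) ` A) (x + z))"
    by (subst sum.reindex) (auto simp: inj_on_def)
  ultimately show ?thesis by (simp add: cap_eq_esc)
qed

text \<open>All partial sums of the Green series stay below \<open>f x / c\<close>, so one explicit
  function yields both transience and a quantitative bound.\<close>

lemma superharmonic_green_bound:
  fixes f :: "int ^ 'd \<Rightarrow> real"
  assumes f: "\<And>x. nbr_avg f x \<le> f x - c * indicator {0} x" "\<And>x. 0 \<le> f x" and c: "0 < c"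
  shows "summable (\<lambda>n. hk n x)" "c * green x \<le> f x"
proof -
  have "(\<Sum>k<n. (nbr_avg ^^ k) (\<lambda>x. c * indicator {0} x) x) \<le> f x" for n
    by (rule nbr_avg_superharmonic_sum) (use f in auto)
  then have b: "(\<Sum>k<n. hk k x) \<le> f x / c" for n
    using c by (simp add: nbr_avg_pow_scale hk_def[symmetric] sum_distrib_left[symmetric] field_simps)
  show s: "summable (\<lambda>n. hk n x)"
    by (rule summableI_nonneg_bounded[OF _ b]) simp
  have "green x \<le> f x / c"
    unfolding green_def by (rule suminf_le_const[OF s b])
  then show "c * green x \<le> f x"
    using c by (simp add: field_simps)
qed

subsection \<open>Radial functions on the lattice\<close>

definition sqn :: "int ^ 'd \<Rightarrow> real" where
  "sqn x = (\<Sum>i\<in>UNIV. (real_of_int (x $ i))\<^sup>2)"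

definition rv :: "int ^ 'd \<Rightarrow> real ^ 'd" where
  "rv x = (\<chi> i. real_of_int (x $ i))"

lemma norm_rv: "norm (rv x) = sqrt (sqn x)"
  by (simp add: norm_vec_def L2_set_def rv_def sqn_def)

lemma sqn_nonneg [simp]: "0 \<le> sqn x"
  by (simp add: sqn_def sum_nonneg)

lemma norm_rv_sq: "(norm (rv x))\<^sup>2 = sqn x"
  by (simp add: norm_rv)

lemma sqn_0 [simp]: "sqn 0 = 0"
  by (simp add: sqn_def)

lemma rv_0 [simp]: "rv 0 = 0"
  by (simp add: rv_def vec_eq_iff)

lemma rv_add: "rv (x + y) = rv x + rv y"
  by (simp add: rv_def vec_eq_iff)

lemma rv_diff: "rv (x - y) = rv x - rv y"
  by (simp add: rv_def vec_eq_iff)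

lemma component_le_sqn: "(real_of_int (x $ i))\<^sup>2 \<le> sqn x"
  unfolding sqn_def by (rule member_le_sum) auto

lemma sqn_add_axis:
  "sqn (x + axis i a) = sqn x + 2 * real_of_int (x $ i) * real_of_int a + (real_of_int a)\<^sup>2" for x :: "int ^ 'd"
proof -
  have "(real_of_int ((x + axis i a) $ j))\<^sup>2
      = (real_of_int (x $ j))\<^sup>2 + (if j = i then 2 * real_of_int (x $ i) * real_of_int a + (real_of_int a)\<^sup>2 else 0)" for j
    by (auto simp: axis_def power2_sum)
  then show ?thesis
    unfolding sqn_def by (simp add: sum.distrib)
qed

lemma norm_rv_unit_step: "s \<in> unit_steps \<Longrightarrow> norm (rv s) = 1" for s :: "int ^ 'd"
  using sqn_add_axis[of "0::int^'d"] by (auto simp: unit_steps_def norm_rv)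

text \<open>Opposite steps are paired coordinate by coordinate, so that odd orders cancel within
  each pair when \<open>\<phi>\<close> is expanded.\<close>

lemma nbr_avg_radial:
  "nbr_avg (\<lambda>x. \<phi> (sqn x)) x
     = (\<Sum>i\<in>UNIV. \<phi> (sqn x + 1 + 2 * real_of_int (x $ i)) + \<phi> (sqn x + 1 - 2 * real_of_int (x $ i))) / (2 * real CARD('d))"
  for x :: "int ^ 'd"
  by (simp add: nbr_avg_def2 sqn_add_axis algebra_simps)

lemma nbr_avg_sqn: "nbr_avg sqn x = sqn x + 1" for x :: "int ^ 'd"
proof -
  have "nbr_avg sqn x = (\<Sum>i\<in>(UNIV::'d set). 2 * (sqn x + 1)) / (2 * real CARD('d))"
    using nbr_avg_radial[of "\<lambda>u. u" x] by (simp add: algebra_simps)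
  then show ?thesis by simp
qed

lemma nbr_avg_pow_sqn: "(nbr_avg ^^ n) sqn x = sqn x + real n" for x :: "int ^ 'd"
proof (induction n arbitrary: x)
  case (Suc n)
  have "(nbr_avg ^^ n) sqn = (\<lambda>x::int^'d. sqn x + real n)" by (rule ext) (rule Suc)
  then show ?case by (simp add: nbr_avg_add nbr_avg_sqn)
qed simp

lemma lattice_ball_eq: "lattice_ball N = {x. norm (rv x) \<le> real N}"
  by (simp add: lattice_ball_def rv_def)

lemma finite_norm_rv_le: "finite {x :: int ^ 'd. norm (rv x) \<le> R}"
proof -
  have "{x :: int ^ 'd. norm (rv x) \<le> R} \<subseteq> {x. \<forall>i. x $ i \<in> {- \<lceil>R\<rceil>..\<lceil>R\<rceil>}}"
  proof safe
    fix x :: "int ^ 'd" and i assume "norm (rv x) \<le> R"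
    then have "\<bar>rv x $ i\<bar> \<le> R" using component_le_norm_cart[of "rv x" i] by linarith
    then have "\<bar>real_of_int (x $ i)\<bar> \<le> R" by (simp add: rv_def)
    then show "x $ i \<in> {- \<lceil>R\<rceil>..\<lceil>R\<rceil>}"
      by (simp add: abs_le_iff) linarith
  qed
  moreover have "finite {x :: int ^ 'd. \<forall>i. x $ i \<in> {- \<lceil>R\<rceil>..\<lceil>R\<rceil>}}"
    by (rule finite_subset[of _ "vec_lambda ` (UNIV \<rightarrow>\<^sub>E {- \<lceil>R\<rceil>..\<lceil>R\<rceil>})"])
      (auto simp: image_iff PiE_iff intro!: bexI[of _ "vec_nth _"] finite_PiE)
  ultimately show ?thesis by (rule finite_subset)
qed

lemma finite_lattice_ball [simp]: "finite (lattice_ball N)"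
  by (simp add: lattice_ball_eq finite_norm_rv_le)

text \<open>The square of the sum is \<open>2 / (1 - y) + 2 / sqrt (1 - y)\<close>, free of
  \<open>z\<close>, so polynomial bounds for these two terms decide the matter. The coefficient 3/4
  is the exact one at first order in \<open>y\<close>; an error there would spoil the cancellation
  in the Laplacian.\<close>

lemma inverse_sqrt_pair:
  fixes y z :: real
  assumes y: "y = z\<^sup>2" and "y \<le> 1/4"
  shows "1 / sqrt (1 + z) + 1 / sqrt (1 - z) \<le> 2 + 3/4 * y + 3/2 * y\<^sup>2" (is "?L \<le> _")
    and "2 + 3/4 * y \<le> 1 / sqrt (1 + z) + 1 / sqrt (1 - z)"
proof -
  have y0: "0 \<le> y" using y by simp
  have "\<bar>z\<bar>\<^sup>2 \<le> (1/2)\<^sup>2" using assms by (simp add: power2_eq_square)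
  then have "\<bar>z\<bar> \<le> 1/2" by (rule power2_le_imp_le) simp
  then have z: "0 < 1 + z" "0 < 1 - z" by auto
  have "?L\<^sup>2 = 1 / (1 + z) + 1 / (1 - z) + 2 / sqrt ((1 + z) * (1 - z))"
    using z by (simp add: power2_sum power_divide real_sqrt_mult)
  also have "\<dots> = 2 / (1 - y) + 2 / sqrt (1 - y)"
    using z by (simp add: y field_simps power2_eq_square)
  finally have sq: "?L\<^sup>2 = 2 / (1 - y) + 2 / sqrt (1 - y)" .
  have u1: "1 / (1 - y) \<le> 1 + y + 2 * y\<^sup>2" "1 + y + y\<^sup>2 \<le> 1 / (1 - y)"
  proof -
    have "0 \<le> y\<^sup>2 * (1 - 2 * y)" using assms y0 by (intro mult_nonneg_nonneg) auto
    then show "1 / (1 - y) \<le> 1 + y + 2 * y\<^sup>2"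
      using assms by (simp add: field_simps power2_eq_square power3_eq_cube)
    have "0 \<le> y ^ 3" using y0 by simp
    then show "1 + y + y\<^sup>2 \<le> 1 / (1 - y)"
      using assms by (simp add: field_simps power2_eq_square power3_eq_cube)
  qed
  have u2: "1 / sqrt (1 - y) \<le> 1 + y/2 + y\<^sup>2"
  proof -
    have "(1 / sqrt (1 - y))\<^sup>2 \<le> (1 + y/2 + y\<^sup>2)\<^sup>2"
    proof -
      have "(1 + y/2 + y\<^sup>2)\<^sup>2 = (1 + y + 2 * y\<^sup>2) + (y\<^sup>2 / 4 + y ^ 3 + y ^ 4)"
        by (simp add: power2_eq_square power3_eq_cube power4_eq_xxxx algebra_simps)
      moreover have "0 \<le> y\<^sup>2" "0 \<le> y ^ 3" "0 \<le> y ^ 4" using y0 by auto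
      ultimately have ge: "1 + y + 2 * y\<^sup>2 \<le> (1 + y/2 + y\<^sup>2)\<^sup>2" by linarith
      have "(1 / sqrt (1 - y))\<^sup>2 = 1 / (1 - y)" using assms by (simp add: power_divide)
      also have "\<dots> \<le> 1 + y + 2 * y\<^sup>2" by fact
      also note ge
      finally show ?thesis .
    qed
    then show ?thesis by (rule power2_le_imp_le) (use y0 in auto)
  qed
  have u3: "1 + y/2 \<le> 1 / sqrt (1 - y)"
  proof -
    have "(1 + y/2)\<^sup>2 \<le> 1 + y + y\<^sup>2" by (simp add: power2_eq_square algebra_simps)
    also have "\<dots> \<le> (1 / sqrt (1 - y))\<^sup>2" using assms u1 by (simp add: power_divide)
    finally show ?thesis by (rule power2_le_imp_le) (use assms in auto)
  qed
  have L0: "0 \<le> ?L" using z by simp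
  have "?L\<^sup>2 \<le> 4 + 3 * y + 6 * y\<^sup>2" using sq u1 u2 by simp
  also have "\<dots> \<le> (2 + 3/4 * y + 3/2 * y\<^sup>2)\<^sup>2"
  proof -
    have "(2 + 3/4 * y + 3/2 * y\<^sup>2)\<^sup>2 = 4 + 3 * y + 6 * y\<^sup>2 + (9/16 * y\<^sup>2 + 9/4 * y ^ 3 + 9/4 * y ^ 4)"
      by (simp add: power2_eq_square power3_eq_cube power4_eq_xxxx algebra_simps)
    moreover have "0 \<le> y\<^sup>2" "0 \<le> y ^ 3" "0 \<le> y ^ 4" using y0 by auto
    ultimately show ?thesis by linarith
  qed
  finally show "?L \<le> 2 + 3/4 * y + 3/2 * y\<^sup>2"
    by (rule power2_le_imp_le) (use y0 in auto)
  have "(2 + 3/4 * y)\<^sup>2 \<le> 4 + 3 * y + 2 * y\<^sup>2" by (simp add: power2_eq_square algebra_simps)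
  also have "\<dots> \<le> ?L\<^sup>2" using sq u1 u3 by simp
  finally show "2 + 3/4 * y \<le> ?L"
    by (rule power2_le_imp_le) (use L0 in auto)
qed

text \<open>The exact first-order coefficient is 1/4; taking 1/2 absorbs all higher orders and is
  good enough for a subharmonic function.\<close>

lemma sqrt_pair:
  fixes y z :: real
  assumes y: "y = z\<^sup>2" and "y \<le> 1/4"
  shows "2 - y / 2 \<le> sqrt (1 + z) + sqrt (1 - z)" (is "_ \<le> ?L")
proof -
  have y0: "0 \<le> y" using y by simp
  have "\<bar>z\<bar>\<^sup>2 \<le> (1/2)\<^sup>2" using assms by (simp add: power2_eq_square)
  then have "\<bar>z\<bar> \<le> 1/2" by (rule power2_le_imp_le) simp
  then have z: "0 < 1 + z" "0 < 1 - z" by auto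
  have "?L\<^sup>2 = 2 + 2 * sqrt ((1 + z) * (1 - z))"
    using z by (simp add: power2_sum real_sqrt_mult)
  also have "(1 + z) * (1 - z) = 1 - y" by (simp add: y algebra_simps power2_eq_square)
  finally have sq: "?L\<^sup>2 = 2 + 2 * sqrt (1 - y)" .
  have "1 - y + y\<^sup>2 / 8 \<le> sqrt (1 - y)"
  proof (rule real_le_rsqrt)
    have "0 \<le> y * (1 - 5/4 * y)" using assms y0 by (intro mult_nonneg_nonneg) auto
    moreover have "0 \<le> y ^ 3 * (1/4 - y/64)" using assms y0 by (intro mult_nonneg_nonneg) auto
    ultimately show "(1 - y + y\<^sup>2 / 8)\<^sup>2 \<le> 1 - y"
      by (simp add: power2_eq_square power3_eq_cube algebra_simps)
  qed
  then have "(2 - y/2)\<^sup>2 \<le> ?L\<^sup>2"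
    unfolding sq by (simp add: power2_eq_square algebra_simps)
  then show ?thesis
    by (rule power2_le_imp_le) (use z in auto)
qed

text \<open>\<open>w\<close> is the mean of \<open>sqn + 15\<close> over the neighbours of
  \<open>x\<close>. Opposite neighbours have the values \<open>w * (1 + z)\<close> and
  \<open>w * (1 - z)\<close> with \<open>z = 2 * x $ i / w\<close>, while \<open>x\<close> itself
  has \<open>w - 1\<close>.\<close>

context
  fixes x :: "int ^ 'd" and w :: real
  assumes w: "w = sqn x + 16"
begin

lemma ratio_bounds:
  fixes y
  assumes y_def: "\<And>i. y i = (2 * real_of_int (x $ i) / w)\<^sup>2"
  shows "y i \<le> 1/4" "0 \<le> y i" "(\<Sum>i\<in>UNIV. y i) = 4 * (w - 16) / w\<^sup>2" "(\<Sum>i\<in>UNIV. (y i)\<^sup>2) \<le> 16 / w\<^sup>2"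
    "(\<Sum>i\<in>UNIV. y i) \<le> 4 / w"
proof -
  have w16: "16 \<le> w" using w by simp
  show y0: "0 \<le> y i" for i by (simp add: y_def)
  show s: "(\<Sum>i\<in>UNIV. y i) = 4 * (w - 16) / w\<^sup>2"
  proof -
    have "(\<Sum>i\<in>UNIV. y i) = (4 / w\<^sup>2) * sqn x"
      by (simp add: y_def sqn_def sum_distrib_left power_divide power_mult_distrib)
    then show ?thesis using w by simp
  qed
  show s4: "(\<Sum>i\<in>UNIV. y i) \<le> 4 / w"
    unfolding s using w16 by (simp add: field_simps power2_eq_square)
  have yi: "y i \<le> 4 / w" for i
    by (rule order_trans[OF _ s4]) (rule member_le_sum; simp add: y0)
  show "y i \<le> 1/4" for i
    by (rule order_trans[OF yi]) (use w16 in \<open>simp add: field_simps\<close>)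
  have "(\<Sum>i\<in>UNIV. (y i)\<^sup>2) \<le> (\<Sum>i\<in>UNIV. y i * (4 / w))"
    unfolding power2_eq_square by (intro sum_mono mult_left_mono yi y0)
  also have "\<dots> \<le> (4 / w) * (4 / w)"
    unfolding sum_distrib_right[symmetric] using w16 by (intro mult_right_mono s4) auto
  finally show "(\<Sum>i\<in>UNIV. (y i)\<^sup>2) \<le> 16 / w\<^sup>2"
    by (simp add: power2_eq_square)
qed

text \<open>The shift by \<open>15\<close> makes the functions below super- or subharmonic at every point, the origin included.\<close>

lemma inverse_sqrt_laplacian:
  assumes d: "CARD('d) = 3"
  shows "nbr_avg (\<lambda>x. 1 / sqrt (sqn x + 15)) x \<le> 1 / sqrt (sqn x + 15) - 4 / (w\<^sup>2 * sqrt w)"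
    and "1 / sqrt (sqn x + 15) - 9 / (w\<^sup>2 * sqrt w) \<le> nbr_avg (\<lambda>x. 1 / sqrt (sqn x + 15)) x"
proof -
  define y where "y = (\<lambda>i. (2 * real_of_int (x $ i) / w)\<^sup>2)"
  have yd: "y i = (2 * real_of_int (x $ i) / w)\<^sup>2" for i by (simp add: y_def)
  note yb = ratio_bounds[of y, OF yd]
  have w16: "16 \<le> w" using w by simp
  have trm: "1 / sqrt (sqn x + 1 + 2 * real_of_int (x $ i) + 15) + 1 / sqrt (sqn x + 1 - 2 * real_of_int (x $ i) + 15)
     = (1 / sqrt w) * (1 / sqrt (1 + 2 * real_of_int (x $ i) / w) + 1 / sqrt (1 - 2 * real_of_int (x $ i) / w))" for i
  proof -
    have wz: "w * (2 * real_of_int (x $ i) / w) = 2 * real_of_int (x $ i)" using w16 by simp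
    have 1: "sqn x + 1 + 2 * real_of_int (x $ i) + 15 = w * (1 + 2 * real_of_int (x $ i) / w)"
      "sqn x + 1 - 2 * real_of_int (x $ i) + 15 = w * (1 - 2 * real_of_int (x $ i) / w)"
      using w unfolding distrib_left right_diff_distrib wz by simp_all
    show ?thesis unfolding 1 real_sqrt_mult by (simp add: algebra_simps)
  qed
  have avg: "nbr_avg (\<lambda>x. 1 / sqrt (sqn x + 15)) x = (1 / sqrt w) * ((\<Sum>i\<in>UNIV.
      1 / sqrt (1 + 2 * real_of_int (x $ i) / w) + 1 / sqrt (1 - 2 * real_of_int (x $ i) / w)) / 6)"
    using nbr_avg_radial[of "\<lambda>u. 1 / sqrt (u + 15)" x] unfolding trm
    by (simp add: d sum_distrib_left)
  have u: "1 / sqrt (sqn x + 15) = (1 / sqrt w) * (1 / sqrt (1 - 1 / w))"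
  proof -
    have "w * (1 - 1 / w) = w - 1" using w16 by (simp add: field_simps)
    then have "sqn x + 15 = w * (1 - 1 / w)" using w by simp
    then show ?thesis by (simp only: real_sqrt_mult) simp
  qed
  have v: "0 \<le> 1 / w" "1 / w \<le> 1/16" using w16 by (auto simp: field_simps)
  have v1: "1 + (1 / w) / 2 \<le> 1 / sqrt (1 - 1 / w)"
  proof -
    have "1 - 1 / w \<le> (1 - (1/w)/2)\<^sup>2" by (simp add: power2_eq_square algebra_simps)
    then have "sqrt (1 - 1 / w) \<le> 1 - (1/w)/2" using v by (intro real_le_lsqrt) auto
    then have "(1 + (1 / w) / 2) * sqrt (1 - 1 / w) \<le> (1 + (1 / w) / 2) * (1 - (1/w)/2)"
      by (rule mult_left_mono) (use v in auto)
    also have "\<dots> \<le> 1" by (simp add: algebra_simps)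
    finally have "(1 + (1 / w) / 2) * sqrt (1 - 1 / w) \<le> 1" .
    then show ?thesis using v by (subst pos_le_divide_eq) auto
  qed
  have v2: "1 / sqrt (1 - 1 / w) \<le> 1 + (1 / w) / 2 + (1 / w)\<^sup>2"
  proof -
    define t where "t = 1 / w"
    have t: "0 \<le> t" "t \<le> 1/16" using v by (auto simp: t_def)
    have "t ^ 3 \<le> (1/16) ^ 3" using t by (intro power_mono) auto
    then have "0 \<le> t\<^sup>2 * (5/4 - 5/4*t - t^3)"
      using t by (intro mult_nonneg_nonneg) (auto simp: power3_eq_cube)
    moreover have "(1 - t) * (1 + t/2 + t\<^sup>2)\<^sup>2 = 1 + t\<^sup>2 * (5/4 - 5/4*t - t^3)"
      by (simp add: power2_eq_square power3_eq_cube field_simps)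
    ultimately have "1 \<le> (1 - t) * (1 + t/2 + t\<^sup>2)\<^sup>2" by simp
    then have "1 \<le> sqrt ((1 - t) * (1 + t/2 + t\<^sup>2)\<^sup>2)" by simp
    also have "\<dots> = sqrt (1 - t) * (1 + t/2 + t\<^sup>2)" using t by (simp add: real_sqrt_mult)
    finally show ?thesis using t unfolding t_def[symmetric]
      by (subst pos_divide_le_eq) (auto simp: mult.commute)
  qed
  have "(\<Sum>i\<in>UNIV. 1 / sqrt (1 + 2 * real_of_int (x $ i) / w) + 1 / sqrt (1 - 2 * real_of_int (x $ i) / w))
     \<le> (\<Sum>i\<in>(UNIV::'d set). 2 + 3/4 * y i + 3/2 * (y i)\<^sup>2)"
    by (intro sum_mono inverse_sqrt_pair(1) yb) (simp add: y_def)
  also have "\<dots> = 6 + 3/4 * (\<Sum>i\<in>UNIV. y i) + 3/2 * (\<Sum>i\<in>UNIV. (y i)\<^sup>2)"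
    by (simp add: sum.distrib sum_distrib_left d)
  also have "\<dots> \<le> 6 + 3/4 * (4 * (w - 16) / w\<^sup>2) + 3/2 * (16 / w\<^sup>2)"
    using yb(3,4) by simp
  \<comment> \<open>The \<open>-16\<close> in the sum of the \<open>y i\<close> contributes -8/w^2,
    twice the error 4/w^2 coming from their squares. This surplus is what the shift by 15
    buys.\<close>
  also have "\<dots> = 6 * (1 + (1/w)/2 - 4 / w\<^sup>2)"
    using w16 by (simp add: field_simps power2_eq_square)
  finally have "nbr_avg (\<lambda>x. 1 / sqrt (sqn x + 15)) x \<le> (1 / sqrt w) * (1 + (1/w)/2 - 4 / w\<^sup>2)"
    unfolding avg using w16 by (intro mult_left_mono) auto
  also have "\<dots> \<le> (1 / sqrt w) * (1 / sqrt (1 - 1 / w) - 4 / w\<^sup>2)"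
    using w16 v1 by (intro mult_left_mono) auto
  finally show "nbr_avg (\<lambda>x. 1 / sqrt (sqn x + 15)) x \<le> 1 / sqrt (sqn x + 15) - 4 / (w\<^sup>2 * sqrt w)"
    unfolding u by (simp add: algebra_simps)
  have "6 * (1 + (1/w)/2 - 8 / w\<^sup>2) = 6 + 3/4 * (\<Sum>i\<in>UNIV. y i)"
    unfolding yb(3) using w16 by (simp add: field_simps power2_eq_square)
  also have "\<dots> = (\<Sum>i\<in>(UNIV::'d set). 2 + 3/4 * y i)"
    by (simp add: sum.distrib sum_distrib_left d)
  also have "\<dots> \<le> (\<Sum>i\<in>UNIV. 1 / sqrt (1 + 2 * real_of_int (x $ i) / w) + 1 / sqrt (1 - 2 * real_of_int (x $ i) / w))"
    by (intro sum_mono inverse_sqrt_pair(2) yb) (simp add: y_def)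
  finally have "(1 / sqrt w) * (1 + (1/w)/2 - 8 / w\<^sup>2) \<le> nbr_avg (\<lambda>x. 1 / sqrt (sqn x + 15)) x"
    unfolding avg using w16 by (intro mult_left_mono) auto
  moreover have "(1 / sqrt w) * (1 / sqrt (1 - 1 / w) - 9 / w\<^sup>2) \<le> (1 / sqrt w) * (1 + (1/w)/2 - 8 / w\<^sup>2)"
    using w16 v2 by (intro mult_left_mono) (auto simp: power_divide)
  ultimately show "1 / sqrt (sqn x + 15) - 9 / (w\<^sup>2 * sqrt w) \<le> nbr_avg (\<lambda>x. 1 / sqrt (sqn x + 15)) x"
    unfolding u by (simp add: algebra_simps)
qed

text \<open>Each pair is bounded through the rational function
  \<open>(1 / w) * (2 / (1 - y i))\<close>, so no roots occur. The deficit is 9 = 8 + 1: the last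
  unit comes from expanding \<open>1 / (w - 1)\<close> to third order in 1/w.\<close>

lemma inverse_laplacian:
  assumes d: "CARD('d) = 4"
  shows "nbr_avg (\<lambda>x. 1 / (sqn x + 15)) x \<le> 1 / (sqn x + 15) - 9 / w ^ 3"
proof -
  define y where "y = (\<lambda>i. (2 * real_of_int (x $ i) / w)\<^sup>2)"
  have yd: "y i = (2 * real_of_int (x $ i) / w)\<^sup>2" for i by (simp add: y_def)
  note yb = ratio_bounds[of y, OF yd]
  have w16: "16 \<le> w" using w by simp
  have trm: "1 / (sqn x + 1 + 2 * real_of_int (x $ i) + 15) + 1 / (sqn x + 1 - 2 * real_of_int (x $ i) + 15)
     \<le> (1 / w) * (2 + 2 * y i + 4 * (y i)\<^sup>2)" for i
  proof -
    define t where "t = real_of_int (x $ i)"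
    have yi: "y i = 4 * t\<^sup>2 / w\<^sup>2" by (simp add: y_def t_def power_divide power_mult_distrib)
    have yw: "w\<^sup>2 * y i = 4 * t\<^sup>2" using w16 unfolding yi by simp
    have "4 * t\<^sup>2 \<le> w\<^sup>2 / 4" unfolding yw[symmetric] using mult_left_mono[OF yb(1)[of i], of "w\<^sup>2"] by simp
    then have "(2 * t)\<^sup>2 < w\<^sup>2" using w16 by (simp add: power_mult_distrib) (smt (verit) zero_less_power)
    then have "\<bar>2 * t\<bar>\<^sup>2 < w\<^sup>2" by simp
    then have tw: "\<bar>2 * t\<bar> < w" by (rule power2_less_imp_less) (use w16 in auto)
    have "1 / (sqn x + 1 + 2 * t + 15) + 1 / (sqn x + 1 - 2 * t + 15) = 1 / (w + 2 * t) + 1 / (w - 2 * t)"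
      by (simp add: w algebra_simps)
    also have "\<dots> = 2 * w / (w\<^sup>2 - 4 * t\<^sup>2)"
    proof -
      have "1 / (w + 2 * t) + 1 / (w - 2 * t) = 2 * w / ((w + 2 * t) * (w - 2 * t))"
      proof -
        have "w + 2 * t \<noteq> 0" "w - 2 * t \<noteq> 0" using tw by linarith+
        then show ?thesis by (simp add: divide_simps)
      qed
      also have "(w + 2 * t) * (w - 2 * t) = w\<^sup>2 - 4 * t\<^sup>2" by (simp add: algebra_simps power2_eq_square)
      finally show ?thesis .
    qed
    also have "\<dots> = (1 / w) * (2 / (1 - y i))"
      unfolding yw[symmetric] using w16 yb(1)[of i] by (simp add: field_simps power2_eq_square)
    also have "\<dots> \<le> (1 / w) * (2 + 2 * y i + 4 * (y i)\<^sup>2)"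
    proof (rule mult_left_mono)
      have "0 \<le> (y i)\<^sup>2 * (1 - 2 * y i)" using yb(1)[of i] by (intro mult_nonneg_nonneg) auto
      then show "2 / (1 - y i) \<le> 2 + 2 * y i + 4 * (y i)\<^sup>2"
        using yb(1)[of i] by (subst pos_divide_le_eq) (auto simp: power2_eq_square algebra_simps)
    qed (use w16 in auto)
    finally show ?thesis by (simp add: t_def)
  qed
  have "(\<Sum>i\<in>UNIV. 1 / (sqn x + 1 + 2 * real_of_int (x $ i) + 15) + 1 / (sqn x + 1 - 2 * real_of_int (x $ i) + 15))
      \<le> (\<Sum>i\<in>UNIV. (1 / w) * (2 + 2 * y i + 4 * (y i)\<^sup>2))"
    by (rule sum_mono) (rule trm)
  then have "nbr_avg (\<lambda>x. 1 / (sqn x + 15)) x \<le> (\<Sum>i\<in>UNIV. (1 / w) * (2 + 2 * y i + 4 * (y i)\<^sup>2)) / 8"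
    unfolding nbr_avg_radial[of "\<lambda>u. 1 / (u + 15)" x] d by simp
  also have "\<dots> = (1 / w) * (1 + (\<Sum>i\<in>UNIV. y i) / 4 + (\<Sum>i\<in>UNIV. (y i)\<^sup>2) / 2)"
    using w16 unfolding sum_distrib_left[symmetric]
    by (simp add: sum.distrib sum_distrib_left[symmetric] d) (simp add: field_simps)
  also have "\<dots> \<le> (1 / w) * (1 + (4 * (w - 16) / w\<^sup>2) / 4 + (16 / w\<^sup>2) / 2)"
    using yb(3,4) w16 by (intro mult_left_mono) auto
  also have "\<dots> = (1 / w) * (1 + 1 / w - 8 / w\<^sup>2)"
    using w16 by (simp add: field_simps power2_eq_square)
  also have "\<dots> \<le> 1 / (w - 1) - 9 / w ^ 3"
    using w16 by (simp add: field_simps power2_eq_square power3_eq_cube)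
  finally show ?thesis using w by (simp add: add.commute)
qed

text \<open>In the continuum |x| has Laplacian 2/|x| in dimension three, that is 1/(3|x|) after
  division by 2d. The constant 1/12 leaves room for the crude \<open>sqrt_pair\<close> and for the
  shift.\<close>

lemma sqrt_laplacian:
  assumes d: "CARD('d) = 3"
  shows "sqrt (sqn x + 15) + 1 / (12 * sqrt (sqn x + 15)) \<le> nbr_avg (\<lambda>x. sqrt (sqn x + 15)) x"
proof -
  define y where "y = (\<lambda>i. (2 * real_of_int (x $ i) / w)\<^sup>2)"
  have yd: "y i = (2 * real_of_int (x $ i) / w)\<^sup>2" for i by (simp add: y_def)
  note yb = ratio_bounds[of y, OF yd]
  have w16: "16 \<le> w" using w by simp
  have trm: "sqrt (sqn x + 1 + 2 * real_of_int (x $ i) + 15) + sqrt (sqn x + 1 - 2 * real_of_int (x $ i) + 15)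
     = sqrt w * (sqrt (1 + 2 * real_of_int (x $ i) / w) + sqrt (1 - 2 * real_of_int (x $ i) / w))" for i
  proof -
    have wz: "w * (2 * real_of_int (x $ i) / w) = 2 * real_of_int (x $ i)" using w16 by simp
    have 1: "sqn x + 1 + 2 * real_of_int (x $ i) + 15 = w * (1 + 2 * real_of_int (x $ i) / w)"
      "sqn x + 1 - 2 * real_of_int (x $ i) + 15 = w * (1 - 2 * real_of_int (x $ i) / w)"
      using w unfolding distrib_left right_diff_distrib wz by simp_all
    show ?thesis unfolding 1 real_sqrt_mult by (simp add: algebra_simps)
  qed
  have avg: "nbr_avg (\<lambda>x. sqrt (sqn x + 15)) x = sqrt w * ((\<Sum>i\<in>UNIV.
      sqrt (1 + 2 * real_of_int (x $ i) / w) + sqrt (1 - 2 * real_of_int (x $ i) / w)) / 6)"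
    using nbr_avg_radial[of "\<lambda>u. sqrt (u + 15)" x] unfolding trm
    by (simp add: d sum_distrib_left)
  have "6 * (1 - 1 / (3 * w)) \<le> 6 - (\<Sum>i\<in>UNIV. y i) / 2"
    using yb(5) by simp
  also have "\<dots> = (\<Sum>i\<in>(UNIV::'d set). 2 - y i / 2)"
    by (simp add: sum_subtractf sum_divide_distrib d)
  also have "\<dots> \<le> (\<Sum>i\<in>UNIV. sqrt (1 + 2 * real_of_int (x $ i) / w) + sqrt (1 - 2 * real_of_int (x $ i) / w))"
    by (intro sum_mono sqrt_pair yb) (simp add: y_def)
  finally have *: "sqrt w * (1 - 1 / (3 * w)) \<le> nbr_avg (\<lambda>x. sqrt (sqn x + 15)) x"
    unfolding avg using w16 by (intro mult_left_mono) auto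
  have u: "sqn x + 15 = w - 1" using w by simp
  have "sqrt (w - 1) + 1 / (12 * sqrt (w - 1)) \<le> sqrt w * (1 - 1 / (3 * w))"
  proof -
    have p: "0 < sqrt (w - 1)" "0 < sqrt w" using w16 by auto
    have a: "sqrt (w - 1) \<le> sqrt w * (1 - 1 / (2 * w))"
    proof (rule real_le_lsqrt)
      have "w * (1 - 1 / (2*w))\<^sup>2 = w - 1 + 1 / (4 * w)" using w16 by (simp add: field_simps power2_eq_square)
      then show "w - 1 \<le> (sqrt w * (1 - 1 / (2 * w)))\<^sup>2"
        using w16 by (simp add: power_mult_distrib)
      show "0 \<le> sqrt w * (1 - 1 / (2 * w))" using w16 by (intro mult_nonneg_nonneg) auto
    qed
    have b: "1 / (12 * sqrt (w - 1)) \<le> sqrt w * (1 / (6 * w))"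
    proof -
      have "sqrt w \<le> 2 * sqrt (w - 1)"
        using w16 by (intro real_le_lsqrt) (auto simp: power_mult_distrib)
      then have "1 / (12 * sqrt (w - 1)) \<le> 1 / (6 * sqrt w)"
        using p by (intro divide_left_mono) auto
      also have "\<dots> = sqrt w * (1 / (6 * w))"
        using w16 by (simp add: field_simps)
      finally show ?thesis .
    qed
    have "sqrt w * (1 - 1 / (3 * w)) = sqrt w * (1 - 1 / (2 * w)) + sqrt w * (1 / (6 * w))"
      using w16 by (simp add: field_simps)
    with a b show ?thesis by simp
  qed
  with * show ?thesis unfolding u by linarith
qed

text \<open>In dimension four the Laplacian of the logarithm of |x|^2 is 4/|x|^2, matching the decay
  of \<open>green\<close>. A pair of logarithms is the logarithm of the product
  \<open>1 - y i\<close>, up to \<open>2 * ln w\<close>.\<close>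

lemma ln_laplacian:
  assumes d: "CARD('d) = 4"
  shows "ln (sqn x + 15) + 1 / (8 * (sqn x + 15)) \<le> nbr_avg (\<lambda>x. ln (sqn x + 15)) x"
proof -
  define y where "y = (\<lambda>i. (2 * real_of_int (x $ i) / w)\<^sup>2)"
  have yd: "y i = (2 * real_of_int (x $ i) / w)\<^sup>2" for i by (simp add: y_def)
  note yb = ratio_bounds[of y, OF yd]
  have w16: "16 \<le> w" using w by simp
  have trm: "2 * ln w - 3/2 * y i \<le> ln (sqn x + 1 + 2 * real_of_int (x $ i) + 15) + ln (sqn x + 1 - 2 * real_of_int (x $ i) + 15)" for i
  proof -
    define z where "z = 2 * real_of_int (x $ i) / w"
    have wz: "w * (2 * real_of_int (x $ i) / w) = 2 * real_of_int (x $ i)" using w16 by simp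
    have 1: "sqn x + 1 + 2 * real_of_int (x $ i) + 15 = w * (1 + z)"
      "sqn x + 1 - 2 * real_of_int (x $ i) + 15 = w * (1 - z)"
      using w wz unfolding distrib_left right_diff_distrib by (simp_all add: z_def)
    have yz: "y i = z\<^sup>2" by (simp add: y_def z_def)
    have "\<bar>z\<bar>\<^sup>2 \<le> (1/2)\<^sup>2" using yb(1)[of i] unfolding yz by (simp add: power2_eq_square)
    then have "\<bar>z\<bar> \<le> 1/2" by (rule power2_le_imp_le) simp
    then have z: "0 < 1 + z" "0 < 1 - z" by auto
    have "- y i - 2 * (y i)\<^sup>2 \<le> ln (1 - y i)"
      using yb(1,2)[of i] by (intro ln_one_minus_pos_lower_bound) auto
    moreover have "2 * (y i)\<^sup>2 \<le> 1/2 * y i"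
      using yb(1,2)[of i] mult_right_mono[of "y i" "1/4" "y i"] by (simp add: power2_eq_square)
    ultimately have "- 3/2 * y i \<le> ln (1 - y i)" by simp
    also have "1 - y i = (1 + z) * (1 - z)" by (simp add: yz power2_eq_square algebra_simps)
    also have "ln \<dots> = ln (1 + z) + ln (1 - z)" using z by (simp add: ln_mult)
    finally show ?thesis
      unfolding 1 using z w16 by (simp add: ln_mult)
  qed
  have "8 * ln w - 3/2 * (4 / w) \<le> 8 * ln w - 3/2 * (\<Sum>i\<in>UNIV. y i)"
    using yb(5) by simp
  also have "\<dots> = (\<Sum>i\<in>(UNIV::'d set). 2 * ln w - 3/2 * y i)"
    by (simp add: sum_subtractf sum_distrib_left d)
  also have "\<dots> \<le> (\<Sum>i\<in>UNIV. ln (sqn x + 1 + 2 * real_of_int (x $ i) + 15) + ln (sqn x + 1 - 2 * real_of_int (x $ i) + 15))"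
    by (intro sum_mono trm)
  finally have *: "ln w - 3 / (4 * w) \<le> nbr_avg (\<lambda>x. ln (sqn x + 15)) x"
    using nbr_avg_radial[of "\<lambda>u. ln (u + 15)" x] by (simp add: d)
  have u: "sqn x + 15 = w - 1" using w by simp
  have "ln ((w - 1) / w) \<le> (w - 1) / w - 1"
    using w16 by (intro ln_le_minus_one) auto
  then have "ln (w - 1) \<le> ln w - 1 / w"
    using w16 by (simp add: ln_div field_simps)
  moreover have "1 / (8 * (w - 1)) \<le> 1 / w - 3 / (4 * w)"
    using w16 by (simp add: field_simps)
  ultimately show ?thesis using * unfolding u by linarith
qed

end

section \<open>Explicit Green function bounds and their sums along the walk\<close>

lemma transient_3:
  assumes "CARD('d::finite) = 3"
  shows "transient TYPE('d)" "green (x :: int ^ 'd) \<le> 256 / sqrt (sqn x + 15)"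
proof -
  let ?f = "\<lambda>x :: int ^ 'd. 1 / sqrt (sqn x + 15)"
  have "nbr_avg ?f x \<le> ?f x - 1/256 * indicator {0} x" for x
  proof -
    \<comment> \<open>At the origin \<open>w = 16\<close>, and 4 / (16^2 * 4) = 1/256; elsewhere the
      left side is 0.\<close>
    have "1/256 * indicator {0} x \<le> 4 / ((sqn x + 16)\<^sup>2 * sqrt (sqn x + 16))"
      by (auto simp: indicator_def real_sqrt_eq_iff power2_eq_square)
    then show ?thesis using inverse_sqrt_laplacian(1)[OF refl assms, of x] by linarith
  qed
  note * = superharmonic_green_bound[of ?f "1/256", OF this]
  show "transient TYPE('d)" by unfold_locales (rule *; simp)
  show "green (x :: int ^ 'd) \<le> 256 / sqrt (sqn x + 15)" using *(2)[of x] by simp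
qed

lemma transient_4:
  assumes "CARD('d::finite) = 4"
  shows "transient TYPE('d)" "green (x :: int ^ 'd) \<le> 512 / (sqn x + 15)"
proof -
  let ?f = "\<lambda>x :: int ^ 'd. 1 / (sqn x + 15)"
  have "nbr_avg ?f x \<le> ?f x - 1/512 * indicator {0} x" for x
  proof -
    \<comment> \<open>At the origin 9/16^3 exceeds 8/16^3 = 1/512.\<close>
    have "1/512 * indicator {0} x \<le> 9 / (sqn x + 16) ^ 3"
      by (auto simp: indicator_def power3_eq_cube)
    then show ?thesis using inverse_laplacian[OF refl assms, of x] by linarith
  qed
  note * = superharmonic_green_bound[of ?f "1/512", OF this]
  show "transient TYPE('d)" by unfold_locales (rule *; simp)
  show "green (x :: int ^ 'd) \<le> 512 / (sqn x + 15)" using *(2)[of x] by simp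
qed

lemma sum_walk_le_subharmonic:
  assumes "\<And>x. \<psi> x + r x \<le> nbr_avg \<psi> x"
  shows "(\<Sum>k<n. (nbr_avg ^^ k) r x) \<le> (nbr_avg ^^ n) \<psi> x - \<psi> x"
proof -
  have m: "nbr_avg (\<lambda>x. - \<psi> x) = (\<lambda>x. - nbr_avg \<psi> x)"
    using nbr_avg_scale[of "-1" \<psi>] by simp
  have "(\<Sum>k<n. (nbr_avg ^^ k) r x) \<le> (\<Sum>k<n. (nbr_avg ^^ k) (\<lambda>x. - \<psi> x - nbr_avg (\<lambda>x. - \<psi> x) x) x)"
    by (intro sum_mono nbr_avg_pow_mono) (use assms in \<open>simp add: m algebra_simps\<close>)
  also have "\<dots> = - \<psi> x - (nbr_avg ^^ n) (\<lambda>x. - \<psi> x) x"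
    using nbr_avg_telescope[of n "\<lambda>x. - \<psi> x" x] by simp
  also have "(nbr_avg ^^ n) (\<lambda>x. - \<psi> x) x = - (nbr_avg ^^ n) \<psi> x"
    using nbr_avg_pow_scale[of n "-1" \<psi>] by simp
  finally show ?thesis by simp
qed

text \<open>
  The Green function is dominated by the Laplacian of \<open>sqrt (sqn x + 15)\<close> (of \<open>ln (sqn x + 15)\<close> in
  dimension four), so its sum along the walk telescopes and no lattice sum has to be estimated.
\<close>

lemma sum_walk_green_3:
  assumes d: "CARD('d::finite) = 3" and n: "1 \<le> n"
  shows "(\<Sum>k<n. (nbr_avg ^^ k) green (0 :: int ^ 'd)) \<le> 12288 * sqrt (real n)"
proof -
  let ?\<psi> = "\<lambda>x :: int ^ 'd. sqrt (sqn x + 15)"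
  define s where "s = sqrt (real n + 15)"
  have s: "0 < s" "s\<^sup>2 = real n + 15" by (auto simp: s_def)
  \<comment> \<open>The tangent line at \<open>sqn x + 15 = s\<^sup>2\<close> to a concave function
    of \<open>sqn\<close>. As \<open>sqn\<close> has mean \<open>n\<close> after \<open>n\<close>
    steps, the choice \<open>s\<^sup>2 = n + 15\<close> makes the averaged line equal to
    \<open>s\<close>.\<close>
  have "?\<psi> x \<le> 1 / (2 * s) * sqn x + (15 / (2 * s) + s / 2)" for x :: "int ^ 'd"
  proof -
    have "0 \<le> (?\<psi> x - s)\<^sup>2" by simp
    then have "2 * s * ?\<psi> x \<le> (sqn x + 15) + s\<^sup>2"
      by (simp add: power2_diff algebra_simps)
    then show ?thesis using s(1) by (simp add: field_simps power2_eq_square)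
  qed
  then have "(nbr_avg ^^ n) ?\<psi> 0 \<le> (nbr_avg ^^ n) (\<lambda>x. 1 / (2 * s) * sqn x + (15 / (2 * s) + s / 2)) (0 :: int ^ 'd)"
    by (rule nbr_avg_pow_mono)
  also have "\<dots> = 1 / (2 * s) * real n + (15 / (2 * s) + s / 2)"
    unfolding nbr_avg_pow_add nbr_avg_pow_scale by (simp add: nbr_avg_pow_sqn)
  also have "\<dots> = s"
    using s by (simp add: field_simps power2_eq_square)
  also have "\<dots> \<le> 4 * sqrt (real n)"
    unfolding s_def using n by (intro real_le_lsqrt) (auto simp: power_mult_distrib)
  finally have 1: "(nbr_avg ^^ n) ?\<psi> 0 \<le> 4 * sqrt (real n)" .
  have "(\<Sum>k<n. (nbr_avg ^^ k) green (0 :: int ^ 'd)) \<le> (\<Sum>k<n. (nbr_avg ^^ k) (\<lambda>x. 3072 * (1 / (12 * ?\<psi> x))) 0)"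
    by (intro sum_mono nbr_avg_pow_mono) (use transient_3(2)[OF d] in simp)
  also have "\<dots> = 3072 * (\<Sum>k<n. (nbr_avg ^^ k) (\<lambda>x. 1 / (12 * ?\<psi> x)) 0)"
    unfolding nbr_avg_pow_scale sum_distrib_left ..
  also have "\<dots> \<le> 3072 * ((nbr_avg ^^ n) ?\<psi> 0 - ?\<psi> 0)"
    by (intro mult_left_mono sum_walk_le_subharmonic sqrt_laplacian[OF refl d]) auto
  also have "\<dots> \<le> 3072 * (nbr_avg ^^ n) ?\<psi> 0" by simp
  finally show ?thesis using 1 by simp
qed

lemma sum_walk_green_4:
  assumes d: "CARD('d::finite) = 4"
  shows "(\<Sum>k<n. (nbr_avg ^^ k) green (0 :: int ^ 'd)) \<le> 4096 * ln (real n + 15)"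
proof -
  let ?\<psi> = "\<lambda>x :: int ^ 'd. ln (sqn x + 15)"
  define s where "s = real n + 15"
  have s: "0 < s" by (auto simp: s_def)
  \<comment> \<open>Again a tangent line at the mean value, so that the averaged bound collapses to
    \<open>ln s\<close>.\<close>
  have "?\<psi> x \<le> 1 / s * sqn x + (15 / s + ln s - 1)" for x :: "int ^ 'd"
  proof -
    have p: "0 < sqn x + 15" using sqn_nonneg[of x] by linarith
    have "ln ((sqn x + 15) / s) \<le> (sqn x + 15) / s - 1"
      using s p by (intro ln_le_minus_one) auto
    then show ?thesis using s p by (simp add: ln_div field_simps)
  qed
  then have "(nbr_avg ^^ n) ?\<psi> 0 \<le> (nbr_avg ^^ n) (\<lambda>x. 1 / s * sqn x + (15 / s + ln s - 1)) (0 :: int ^ 'd)"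
    by (rule nbr_avg_pow_mono)
  also have "\<dots> = 1 / s * real n + (15 / s + ln s - 1)"
    unfolding nbr_avg_pow_add nbr_avg_pow_scale by (simp add: nbr_avg_pow_sqn)
  also have "\<dots> = ln s"
  proof -
    have "1 / s * real n + 15 / s = (real n + 15) / s" by (simp add: add_divide_distrib)
    then show ?thesis using s by (simp add: s_def)
  qed
  finally have 1: "(nbr_avg ^^ n) ?\<psi> 0 \<le> ln s" .
  have gb: "green x \<le> 4096 * (1 / (8 * (sqn x + 15)))" for x :: "int ^ 'd"
  proof -
    have "4096 * (1 / (8 * v)) = 512 / v" for v :: real
      by simp
    from this[of "sqn x + 15"] have "4096 * (1 / (8 * (sqn x + 15))) = 512 / (sqn x + 15)" .
    then show ?thesis using transient_4(2)[OF d, of x] by simp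
  qed
  have gk: "(nbr_avg ^^ k) green (0 :: int ^ 'd) \<le> (nbr_avg ^^ k) (\<lambda>x :: int ^ 'd. 4096 * (1 / (8 * (sqn x + 15)))) 0" for k
    by (rule nbr_avg_pow_mono[OF gb])
  have "(\<Sum>k<n. (nbr_avg ^^ k) green (0 :: int ^ 'd)) \<le> (\<Sum>k<n. (nbr_avg ^^ k) (\<lambda>x :: int ^ 'd. 4096 * (1 / (8 * (sqn x + 15)))) 0)"
    by (rule sum_mono) (rule gk)
  also have "\<dots> = 4096 * (\<Sum>k<n. (nbr_avg ^^ k) (\<lambda>x :: int ^ 'd. 1 / (8 * (sqn x + 15))) 0)"
    unfolding nbr_avg_pow_scale sum_distrib_left ..
  also have "\<dots> \<le> 4096 * ((nbr_avg ^^ n) ?\<psi> 0 - ?\<psi> 0)"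
    by (intro mult_left_mono sum_walk_le_subharmonic ln_laplacian[OF refl d]) auto
  also have "\<dots> \<le> 4096 * (nbr_avg ^^ n) ?\<psi> 0" by simp
  finally show ?thesis using 1 by (simp add: s_def)
qed

subsection \<open>Maximum principle and gradient estimate\<close>

text \<open>Among the maximisers take one with largest \<open>i\<close>-th coordinate; the mean
  value inequality makes its right neighbour a maximiser too. The boundary condition is imposed only
  next to points where \<open>v\<close> is positive, because \<open>harmonic_gradient_0\<close>
  knows \<open>v\<close> across its mirror only in terms of \<open>v x\<close>.\<close>

lemma max_principle:
  fixes v :: "int ^ 'd \<Rightarrow> real"
  assumes D: "finite D"
    and sub: "\<And>x. x \<in> D \<Longrightarrow> v x \<le> nbr_avg v x"
    and bd: "\<And>x s. x \<in> D \<Longrightarrow> s \<in> unit_steps \<Longrightarrow> x + s \<notin> D \<Longrightarrow> 0 < v x \<Longrightarrow> v (x + s) \<le> 0"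
    and x: "x \<in> D"
  shows "v x \<le> 0"
proof (rule ccontr)
  assume "\<not> v x \<le> 0"
  define M where "M = Max (v ` D)"
  have le_M: "v y \<le> M" if "y \<in> D" for y
    using D that by (simp add: M_def)
  have M: "0 < M" using le_M[OF x] \<open>\<not> v x \<le> 0\<close> by simp
  define S where "S = {y \<in> D. v y = M}"
  have "M \<in> v ` D" unfolding M_def using D x by (intro Max_in) auto
  then have S: "S \<noteq> {}" "finite S" using D by (auto simp: S_def)
  fix i :: 'd
  define m where "m = Max ((\<lambda>y. y $ i) ` S)"
  have "m \<in> (\<lambda>y. y $ i) ` S" unfolding m_def using S by (intro Max_in) auto
  then obtain y where y: "y \<in> S" "y $ i = m" by auto
  then have yD: "y \<in> D" and vy: "v y = M" by (auto simp: S_def)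
  have nb: "v (y + s) \<le> M" if "s \<in> unit_steps" for s
    using le_M[of "y + s"] bd[OF yD that] vy M by (cases "y + s \<in> D") auto
  have e: "axis i 1 \<in> (unit_steps :: (int ^ 'd) set)" by (auto simp: unit_steps_def)
  have "v (y + axis i 1) = M"
  proof (rule ccontr)
    assume "v (y + axis i 1) \<noteq> M"
    then have "v (y + axis i 1) < M" using nb[OF e] by simp
    then have "(\<Sum>s\<in>unit_steps. v (y + s)) < (\<Sum>s\<in>(unit_steps :: (int ^ 'd) set). M)"
      by (intro sum_strict_mono_ex1) (use nb e in auto)
    then have "nbr_avg v y < M"
      using card_unit_steps_pos[where 'd='d] by (simp add: nbr_avg_def field_simps)
    then show False using sub[OF yD] vy by simp
  qed
  moreover from this have "y + axis i 1 \<in> D"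
    using bd[OF yD e] vy M by (cases "y + axis i 1 \<in> D") auto
  ultimately have "y + axis i 1 \<in> S" by (simp add: S_def)
  then have "(y + axis i 1) $ i \<in> (\<lambda>y. y $ i) ` S" by (rule imageI)
  then have "(y + axis i 1) $ i \<le> m"
    unfolding m_def using S by (intro Max_ge) auto
  then show False using y(2) by (simp add: axis_def)
qed

text \<open>Reflection in the hyperplane where the \<open>i\<close>-th coordinate is 1/2. It
  exchanges 0 and \<open>axis i 1\<close>, so a function minus its reflection is a gradient at
  \<open>axis i 1\<close>.\<close>

definition mirror :: "'d \<Rightarrow> int ^ 'd \<Rightarrow> int ^ 'd" where
  "mirror i x = (\<chi> j. if j = i then 1 - x $ i else x $ j)"

lemma mirror_mirror [simp]: "mirror i (mirror i x) = x"
  by (simp add: mirror_def vec_eq_iff)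

lemma mirror_nth: "mirror i x $ j = (if j = i then 1 - x $ i else x $ j)"
  by (simp add: mirror_def)

lemma mirror_add_axis:
  "mirror i (x + axis j a) = mirror i x + axis j (if j = i then - a else a)"
  by (auto simp: mirror_def axis_def vec_eq_iff)

lemma nbr_avg_mirror: "nbr_avg (\<lambda>x. u (mirror i x)) x = nbr_avg u (mirror i x)" for x :: "int ^ 'd"
  unfolding nbr_avg_def2
  by (intro arg_cong2[where f="(/)"] sum.cong refl) (auto simp: mirror_add_axis)

lemma sqn_mirror: "sqn (mirror i x) = sqn x + 1 - 2 * real_of_int (x $ i)" for x :: "int ^ 'd"
proof -
  have "(real_of_int (mirror i x $ j))\<^sup>2 = (real_of_int (x $ j))\<^sup>2 + (if j = i then 1 - 2 * real_of_int (x $ i) else 0)" for j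
    by (simp add: mirror_def power2_diff)
  then show ?thesis unfolding sqn_def by (simp add: sum.distrib)
qed

lemma nbr_avg_component: "nbr_avg (\<lambda>x. real_of_int (x $ i)) x = real_of_int (x $ i)" for x :: "int ^ 'd"
proof -
  have "(\<Sum>j\<in>UNIV. real_of_int ((x + axis j 1) $ i) + real_of_int ((x + axis j (-1)) $ i)) = (\<Sum>j\<in>(UNIV :: 'd set). 2 * real_of_int (x $ i))"
    by (intro sum.cong) (auto simp: axis_def)
  then show ?thesis by (simp add: nbr_avg_def2)
qed

lemma nbr_avg_component_sq:
  "nbr_avg (\<lambda>x. (real_of_int (x $ i))\<^sup>2) x = (real_of_int (x $ i))\<^sup>2 + 1 / real CARD('d)" for x :: "int ^ 'd"
proof -
  have "(\<Sum>j\<in>UNIV. (real_of_int ((x + axis j 1) $ i))\<^sup>2 + (real_of_int ((x + axis j (-1)) $ i))\<^sup>2)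
     = (\<Sum>j\<in>(UNIV :: 'd set). 2 * (real_of_int (x $ i))\<^sup>2 + (if j = i then 2 else 0))"
    by (intro sum.cong) (auto simp: axis_def power2_eq_square algebra_simps)
  then show ?thesis by (simp add: nbr_avg_def2 sum.distrib field_simps)
qed

text \<open>
  The function \<open>u\<close> minus its mirror image is harmonic and odd, hence controlled in the half ball by the
  maximum principle; the barrier \<open>w\<close> is the harmonic polynomial that is quadratic in \<open>x\<close>, plus a
  linear term in \<open>x $ i\<close> large enough to dominate on the sphere.
\<close>

lemma harmonic_gradient_0:
  fixes u :: "int ^ 'd \<Rightarrow> real"
  assumes R: "1 \<le> R" and d: "2 \<le> CARD('d)"
    and harm: "\<And>x. norm (rv x) \<le> R + 1 \<Longrightarrow> nbr_avg u x = u x"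
    and bound: "\<And>x. norm (rv x) \<le> R + 1 \<Longrightarrow> \<bar>u x\<bar> \<le> B"
  shows "u (axis i 1) - u 0 \<le> 3 * real CARD('d) * B / R"
proof -
  let ?d = "real CARD('d)"
  have B: "0 \<le> B" using bound[of 0] R by simp
  \<comment> \<open>One averaging adds 1 to \<open>sqn\<close> and 1/d to a squared coordinate, so
    the quadratic part is harmonic. The affine coefficients are chosen to make the bracket at least
    \<open>R\<^sup>2\<close> on the outer boundary and \<open>w\<close> plus its reflection
    nonnegative next to the mirror.\<close>
  define w where "w = (\<lambda>x :: int ^ 'd. (2 * B / R\<^sup>2) * (sqn x + ((- ?d) * (real_of_int (x $ i))\<^sup>2
      + ((?d - 1 + ?d * (R + 2)) * real_of_int (x $ i) + (- ?d * (R + 2) / 2)))))"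
  define v where "v = (\<lambda>x. u x - u (mirror i x) - w x)"
  define D where "D = {x :: int ^ 'd. 1 \<le> x $ i \<and> norm (rv x) \<le> R}"
  have w_harm: "nbr_avg w x = w x" for x
  proof -
    have "(- ?d) * ((real_of_int (x $ i))\<^sup>2 + 1 / ?d) = (- ?d) * (real_of_int (x $ i))\<^sup>2 - 1"
      by (simp add: distrib_left)
    then show ?thesis
      unfolding w_def nbr_avg_scale nbr_avg_add nbr_avg_sqn nbr_avg_component nbr_avg_component_sq nbr_avg_const
      by (simp only:) (simp add: algebra_simps)
  qed
  have norm_mirror: "norm (rv (mirror i x)) \<le> norm (rv x)" if "1 \<le> x $ i" for x
    using that by (simp add: norm_rv sqn_mirror)
  have step: "norm (rv (x + s)) \<le> norm (rv x) + 1" if "s \<in> unit_steps" for x s :: "int ^ 'd"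
    using norm_triangle_ineq[of "rv x" "rv s"] norm_rv_unit_step[OF that] by (simp add: rv_add)
  have "v (axis i 1) \<le> 0"
  proof (rule max_principle)
    show "finite D" unfolding D_def
      by (rule finite_subset[OF _ finite_norm_rv_le[of R]]) auto
    have "axis i 1 \<in> (unit_steps :: (int ^ 'd) set)" by (auto simp: unit_steps_def)
    from norm_rv_unit_step[OF this] show "axis i 1 \<in> D" using R
      by (simp add: D_def)
  next
    fix x assume "x \<in> D"
    then have x: "1 \<le> x $ i" "norm (rv x) \<le> R" by (auto simp: D_def)
    have "nbr_avg v x = nbr_avg u x - nbr_avg u (mirror i x) - w x"
      unfolding v_def by (simp add: nbr_avg_diff nbr_avg_mirror w_harm)
    also have "\<dots> = v x"
      using x norm_mirror[OF x(1)] by (simp add: harm v_def)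
    finally show "v x \<le> nbr_avg v x" by simp
  next
    fix x s :: "int ^ 'd" assume "x \<in> D" and s: "s \<in> unit_steps" and nD: "x + s \<notin> D" and pos: "0 < v x"
    then have x: "1 \<le> x $ i" "norm (rv x) \<le> R" by (auto simp: D_def)
    show "v (x + s) \<le> 0"
    proof (cases "1 \<le> (x + s) $ i")
      case True
      define y where "y = x + s"
      have y: "1 \<le> y $ i" "R < norm (rv y)" "norm (rv y) \<le> R + 1"
        using True nD step[OF s, of x] x(2) by (auto simp: D_def y_def)
      have "\<bar>u y\<bar> \<le> B" "\<bar>u (mirror i y)\<bar> \<le> B"
        using y norm_mirror[OF y(1)] by (auto intro!: bound)
      moreover have "2 * B \<le> w y"
      proof -
        define t where "t = real_of_int (y $ i)"
        have t: "1 \<le> t" "t \<le> R + 1"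
          using y component_le_norm_cart[of "rv y" i] by (auto simp: t_def rv_def)
        have "R\<^sup>2 \<le> sqn y" using y(2) R norm_rv_sq[of y] by (metis less_eq_real_def order_trans power_mono zero_le_one)
        moreover have "0 \<le> (- ?d) * t\<^sup>2 + ((?d - 1 + ?d * (R + 2)) * t + (- ?d * (R + 2) / 2))"
        proof -
          \<comment> \<open>Since \<open>t\<close> ranges over the interval from 1 to R + 1, the
            parabola is rewritten with these two roots.\<close>
          have "(- ?d) * t\<^sup>2 + ((?d - 1 + ?d * (R + 2)) * t + (- ?d * (R + 2) / 2))
            = ?d * ((t - 1) * (R + 1 - t)) + ?d * R / 2 + (?d - 1) * t"
            by (simp add: field_simps power2_eq_square)
          moreover have "0 \<le> ?d * ((t - 1) * (R + 1 - t))" "0 \<le> ?d * R / 2" "0 \<le> (?d - 1) * t"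
            using t R d by auto
          ultimately show ?thesis by linarith
        qed
        ultimately have "R\<^sup>2 \<le> sqn y + ((- ?d) * t\<^sup>2 + ((?d - 1 + ?d * (R + 2)) * t + (- ?d * (R + 2) / 2)))"
          by simp
        then have "(2 * B / R\<^sup>2) * R\<^sup>2 \<le> w y"
          unfolding w_def t_def using B by (intro mult_left_mono) auto
        then show ?thesis using R by simp
      qed
      ultimately show ?thesis by (simp add: v_def y_def[symmetric])
    next
      \<comment> \<open>No lattice point lies on the mirror: a step across it lands on the
        reflection of \<open>x\<close>, where \<open>v\<close> equals \<open>- v x\<close> minus a
        nonnegative quantity.\<close>
      case False
      have "s $ i \<ge> -1" using s by (auto simp: unit_steps_def axis_def)
      with False x(1) have si: "s $ i = -1" "x $ i = 1" by auto
      then have "s = axis i (-1)" using s by (auto simp: unit_steps_def axis_def split: if_splits)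
      then have xs: "x + s = mirror i x" using si by (auto simp: mirror_def axis_def vec_eq_iff)
      have "w (mirror i x) + w x = (2 * B / R\<^sup>2) * (2 * (sqn x - 1))"
      proof -
        have "(sqn (mirror i x) + ((- ?d) * (real_of_int (mirror i x $ i))\<^sup>2
            + ((?d - 1 + ?d * (R + 2)) * real_of_int (mirror i x $ i) + (- ?d * (R + 2) / 2))))
          + (sqn x + ((- ?d) * (real_of_int (x $ i))\<^sup>2
            + ((?d - 1 + ?d * (R + 2)) * real_of_int (x $ i) + (- ?d * (R + 2) / 2)))) = 2 * (sqn x - 1)"
          using si by (simp add: sqn_mirror mirror_nth)
        then show ?thesis unfolding w_def by (metis distrib_left)
      qed
      moreover have "1 \<le> sqn x" using component_le_sqn[of x i] si by simp
      ultimately have "0 \<le> w (mirror i x) + w x" using B by simp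
      then show ?thesis using pos unfolding xs v_def by simp
    qed
  qed
  moreover have "mirror i (axis i 1) = (0 :: int ^ 'd)"
    by (simp add: mirror_def axis_def vec_eq_iff)
  ultimately have "u (axis i 1) - u 0 \<le> w (axis i 1)" by (simp add: v_def)
  also have "w (axis i 1) = B * ?d * (R + 2) / R\<^sup>2"
  proof -
    have "sqn (axis i 1 :: int ^ 'd) = 1" using sqn_add_axis[of "0 :: int ^ 'd" i 1] by simp
    then show ?thesis using R by (simp add: w_def axis_def field_simps)
  qed
  also have "\<dots> \<le> B * ?d * (3 * R) / R\<^sup>2"
    using R B by (intro divide_right_mono mult_left_mono) auto
  also have "\<dots> = 3 * ?d * B / R"
    using R by (simp add: power2_eq_square field_simps)
  finally show ?thesis .
qed

text \<open>Both signs come from applying the one-sided estimate to \<open>u\<close> and to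
  \<open>- u\<close>. A backward step is a forward step from the neighbour \<open>z + s\<close>,
  which is why the hypotheses reach out to \<open>R + 2\<close>.\<close>

lemma harmonic_gradient:
  fixes u :: "int ^ 'd \<Rightarrow> real"
  assumes R: "1 \<le> R" and d: "2 \<le> CARD('d)" and s: "s \<in> unit_steps"
    and harm: "\<And>x. norm (rv (x - z)) \<le> R + 2 \<Longrightarrow> nbr_avg u x = u x"
    and bound: "\<And>x. norm (rv (x - z)) \<le> R + 2 \<Longrightarrow> \<bar>u x\<bar> \<le> B"
  shows "\<bar>u (z + s) - u z\<bar> \<le> 3 * real CARD('d) * B / R"
proof -
  have main: "\<bar>u (y + axis i 1) - u y\<bar> \<le> 3 * real CARD('d) * B / R"
    if y: "norm (rv (y - z)) \<le> 1" for y i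
  proof -
    have nb: "norm (rv (x + y - z)) \<le> R + 2" if "norm (rv x) \<le> R + 1" for x
    proof -
      have "rv (x + y - z) = rv x + rv (y - z)" by (simp add: rv_add rv_diff)
      then show ?thesis using norm_triangle_ineq[of "rv x" "rv (y - z)"] that y by simp
    qed
    have tr: "nbr_avg (\<lambda>x. f (x + y)) x = nbr_avg f (x + y)" for f :: "int ^ 'd \<Rightarrow> real" and x
      using nbr_avg_translate[of f "- y"] by (simp add: fun_eq_iff)
    have "u (axis i 1 + y) - u (0 + y) \<le> 3 * real CARD('d) * B / R"
      by (rule harmonic_gradient_0[OF R d, where u="\<lambda>x. u (x + y)"]) (auto simp: tr harm nb bound)
    moreover have "(- u (axis i 1 + y)) - (- u (0 + y)) \<le> 3 * real CARD('d) * B / R"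
    proof (rule harmonic_gradient_0[OF R d, where u="\<lambda>x. - u (x + y)"])
      fix x :: "int ^ 'd" assume x: "norm (rv x) \<le> R + 1"
      have "nbr_avg (\<lambda>x. - u (x + y)) x = - nbr_avg (\<lambda>x. u (x + y)) x"
        using nbr_avg_scale[of "-1" "\<lambda>x. u (x + y)"] by (simp add: fun_eq_iff)
      then show "nbr_avg (\<lambda>x. - u (x + y)) x = - u (x + y)"
        using nb[OF x] by (simp add: tr harm)
    qed (auto simp: bound nb)
    ultimately show ?thesis by (simp add: add.commute abs_le_iff)
  qed
  from s obtain i where "s = axis i 1 \<or> s = axis i (-1)" by (auto simp: unit_steps_def)
  then show ?thesis
  proof
    assume "s = axis i 1"
    then show ?thesis using main[of z i] by simp
  next
    assume s': "s = axis i (-1)"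
    have e: "z + s + axis i 1 = z" unfolding s' by (simp add: axis_def vec_eq_iff)
    have "norm (rv (z + s - z)) \<le> 1" using norm_rv_unit_step[OF s] by simp
    from main[OF this, of i] show ?thesis unfolding e by (simp add: abs_minus_commute)
  qed
qed


subsection \<open>Asymptotics of the Green function in dimension three\<close>

text \<open>The exponent 2/3 is one third of the exponent 2 in \<open>abs_summable_sqn\<close>: the
  sum over three coordinates is dominated by a product of three such series, each converging because
  4/3 > 1.\<close>

lemma abs_summable_int:
  "Infinite_Set_Sum.abs_summable_on (\<lambda>n::int. (1 + (real_of_int n)\<^sup>2) powr (- (2/3))) (UNIV)"
proof -
  have nat: "Infinite_Set_Sum.abs_summable_on (\<lambda>n::nat. (1 + (real n)\<^sup>2) powr (- (2/3))) (UNIV)"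
  proof -
    have "summable (\<lambda>n::nat. (1 + (real n)\<^sup>2) powr (- (2/3)))"
    proof (rule summable_comparison_test_ev)
      show "summable (\<lambda>n::nat. real n powr (- (4/3)))"
        by (simp add: summable_real_powr_iff)
      show "\<forall>\<^sub>F n in sequentially. norm ((1 + (real n)\<^sup>2) powr (- (2/3))) \<le> real n powr (- (4/3))"
      proof (rule eventually_mono[OF eventually_gt_at_top[of 0]])
        fix n :: nat assume n: "0 < n"
        have "real n powr (- (4/3)) = ((real n)\<^sup>2) powr (- (2/3))"
          using n by (simp add: powr_powr flip: powr_numeral)
        moreover have "(1 + (real n)\<^sup>2) powr (- (2/3)) \<le> ((real n)\<^sup>2) powr (- (2/3))"
          using n by (intro powr_mono2') auto
        ultimately show "norm ((1 + (real n)\<^sup>2) powr (- (2/3))) \<le> real n powr (- (4/3))" by simp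
      qed
    qed
    then show ?thesis by (subst Infinite_Set_Sum.abs_summable_on_nat_iff') simp
  qed
  have u: "(UNIV :: int set) = range int \<union> range (\<lambda>n. - int n)"
    by (auto simp: image_iff) (metis int_cases2)
  have "Infinite_Set_Sum.abs_summable_on (\<lambda>n::int. (1 + (real_of_int n)\<^sup>2) powr (- (2/3))) (range int)"
    by (subst Infinite_Set_Sum.abs_summable_on_reindex_iff[symmetric]) (use nat in \<open>auto simp: inj_on_def\<close>)
  moreover have "Infinite_Set_Sum.abs_summable_on (\<lambda>n::int. (1 + (real_of_int n)\<^sup>2) powr (- (2/3))) (range (\<lambda>n. - int n))"
    by (subst Infinite_Set_Sum.abs_summable_on_reindex_iff[symmetric]) (use nat in \<open>auto simp: inj_on_def\<close>)
  ultimately show ?thesis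
    unfolding u by (rule Infinite_Set_Sum.abs_summable_on_union)
qed

lemma abs_summable_sqn:
  assumes d: "CARD('d::finite) = 3"
  shows "Infinite_Set_Sum.abs_summable_on (\<lambda>y :: int ^ 'd. 1 / (sqn y + 16)\<^sup>2) (UNIV)"
proof -
  let ?h = "\<lambda>n::int. (1 + (real_of_int n)\<^sup>2) powr (- (2/3))"
  have "Infinite_Set_Sum.abs_summable_on (\<lambda>g. \<Prod>i\<in>(UNIV::'d set). ?h (g i)) ((\<Pi>\<^sub>E i\<in>UNIV. UNIV))"
    by (rule Infinite_Set_Sum.abs_summable_on_prod_PiE) (auto intro: abs_summable_int)
  then have "Infinite_Set_Sum.abs_summable_on (\<lambda>g. \<Prod>i\<in>(UNIV::'d set). ?h (g i)) (range vec_nth)"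
    by (rule Infinite_Set_Sum.abs_summable_on_subset) auto
  then have prod: "Infinite_Set_Sum.abs_summable_on (\<lambda>y :: int ^ 'd. \<Prod>i\<in>UNIV. ?h (y $ i)) (UNIV)"
    by (subst (asm) Infinite_Set_Sum.abs_summable_on_reindex_iff[symmetric]) (auto simp: inj_on_def vec_nth_inject)
  show ?thesis
  proof (rule Infinite_Set_Sum.abs_summable_on_comparison_test[OF prod])
    fix y :: "int ^ 'd"
    have le: "1 + (real_of_int (y $ i))\<^sup>2 \<le> sqn y + 16" for i
      using component_le_sqn[of y i] by simp
    have pos: "0 < sqn y + 16" using sqn_nonneg[of y] by linarith
    have "1 / (sqn y + 16)\<^sup>2 = ((sqn y + 16) powr (- (2/3))) ^ 3"
    proof -
      have "((sqn y + 16) powr (- (2/3))) ^ 3 = (sqn y + 16) powr (- 2)"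
        using pos by (simp add: powr_powr flip: powr_realpow)
      also have "\<dots> = 1 / (sqn y + 16)\<^sup>2"
        using pos by (simp add: powr_minus powr_numeral field_simps)
      finally show ?thesis by simp
    qed
    also have "\<dots> = (\<Prod>i\<in>(UNIV::'d set). (sqn y + 16) powr (- (2/3)))"
      by (simp add: d)
    also have "\<dots> \<le> (\<Prod>i\<in>UNIV. ?h (y $ i))"
      by (intro prod_mono) (use le in \<open>auto intro!: powr_mono2' simp: add_pos_nonneg\<close>)
    finally show "norm (1 / (sqn y + 16)\<^sup>2) \<le> norm (\<Prod>i\<in>UNIV. ?h (y $ i))"
      by (simp add: abs_of_nonneg prod_nonneg)
  qed
qed

text \<open>Induction on the l1-distance from the origin, moving one nonzero coordinate towards 0.
  It turns one-step gradient bounds into bounds for arbitrary fixed shifts.\<close>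

lemma lattice_induct [case_names zero step]:
  fixes y :: "int ^ 'd"
  assumes "P 0" and step: "\<And>y s. P y \<Longrightarrow> s \<in> unit_steps \<Longrightarrow> P (y + s)"
  shows "P y"
proof (induction "nat (\<Sum>i\<in>UNIV. \<bar>y $ i\<bar>)" arbitrary: y rule: less_induct)
  case less
  show ?case
  proof (cases "y = 0")
    case False
    then obtain i where i: "y $ i \<noteq> 0" by (auto simp: vec_eq_iff)
    define s where "s = axis i (sgn (y $ i))"
    have s: "s \<in> unit_steps" using i by (auto simp: s_def unit_steps_def sgn_if)
    have eq: "(\<Sum>j\<in>UNIV. \<bar>y $ j\<bar>) = (\<Sum>j\<in>UNIV. \<bar>(y - s) $ j\<bar> + (if j = i then 1 else 0))"
      using i by (intro sum.cong) (auto simp: s_def axis_def sgn_if)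
    have "nat (\<Sum>j\<in>UNIV. \<bar>(y - s) $ j\<bar>) < nat (\<Sum>j\<in>UNIV. \<bar>y $ j\<bar>)"
      unfolding eq by (simp add: sum.distrib sum_nonneg)
    from step[OF less[OF this] s] show ?thesis by simp
  qed (simp add: assms)
qed

locale three_dim =
  fixes D :: "(int ^ 'd::finite) itself"
  assumes card3: "CARD('d) = 3"
begin

sublocale transient "TYPE(int ^ 'd)"
  using transient_3(1)[OF card3] .

definition f3 :: "int ^ 'd \<Rightarrow> real" where
  "f3 x = 1 / sqrt (sqn x + 15)"

text \<open>The charge whose Green potential is \<open>f3\<close>. It decays like |x|^-5, so even
  its first moment is summable in dimension three.\<close>

definition rho :: "int ^ 'd \<Rightarrow> real" where
  "rho x = f3 x - nbr_avg f3 x"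

lemma f3_bounds: "0 \<le> f3 x" "f3 x \<le> 1" "norm (rv x) * f3 x \<le> 1"
proof -
  obtain q where q: "q = sqrt (sqn x + 15)" by blast
  have p: "1 \<le> q" "norm (rv x) \<le> q" by (simp_all add: norm_rv q)
  have f: "f3 x = 1 / q" by (simp add: f3_def q)
  show "0 \<le> f3 x" "f3 x \<le> 1" "norm (rv x) * f3 x \<le> 1" using p by (simp_all add: f)
qed

lemma rho_bounds:
  "4 / ((sqn x + 16)\<^sup>2 * sqrt (sqn x + 16)) \<le> rho x"
  "rho x \<le> 9 / ((sqn x + 16)\<^sup>2 * sqrt (sqn x + 16))"
  using inverse_sqrt_laplacian[OF refl card3, of x] by (auto simp: rho_def f3_def[abs_def])

lemma rho_nonneg: "0 \<le> rho x"
proof -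
  have "0 \<le> sqn x" by simp
  then have "0 \<le> 4 / ((sqn x + 16)\<^sup>2 * sqrt (sqn x + 16))" by simp
  then show ?thesis using rho_bounds(1)[of x] by linarith
qed

text \<open>The factor \<open>1 + norm (rv x)\<close> is the growth of the integrand in
  \<open>green_tendsto\<close>; this supplies its integrable majorant.\<close>

lemma rho_weighted: "(1 + norm (rv x)) * rho x \<le> 18 / (sqn x + 16)\<^sup>2"
proof -
  obtain q where q: "q = sqrt (sqn x + 16)" by blast
  have p: "1 \<le> q" "norm (rv x) \<le> q" by (simp_all add: norm_rv q)
  then have "(1 + norm (rv x)) * rho x \<le> (2 * q) * (9 / ((sqn x + 16)\<^sup>2 * q))"
    using rho_bounds(2)[of x, folded q] rho_nonneg[of x] by (intro mult_mono) auto
  also have "\<dots> = 18 / (sqn x + 16)\<^sup>2" using p by simp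
  finally show ?thesis .
qed

text \<open>Lattice sums are written as integrals against counting measure, to have dominated
  convergence at hand.\<close>

lemma integrable_sqn: "integrable (count_space UNIV) (\<lambda>y :: int ^ 'd. C / (sqn y + 16)\<^sup>2)"
  using integrable_mult_right[OF abs_summable_sqn[OF card3, unfolded Infinite_Set_Sum.abs_summable_on_def], of C]
  by simp

lemma rho_le: "rho x \<le> 18 / (sqn x + 16)\<^sup>2"
proof -
  have "rho x \<le> (1 + norm (rv x)) * rho x"
    using rho_nonneg[of x] by (simp add: distrib_right)
  then show ?thesis using rho_weighted[of x] by simp
qed

lemma integrable_mult_rho:
  assumes "\<And>y. \<bar>h y\<bar> \<le> B"
  shows "integrable (count_space UNIV) (\<lambda>y. h y * rho y)"
proof (rule Bochner_Integration.integrable_bound[OF integrable_sqn[of "B * 18"]])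
  have "norm (h y * rho y) \<le> norm (B * 18 / (sqn y + 16)\<^sup>2)" for y
  proof -
    have "0 \<le> B" by (rule order_trans[OF abs_ge_zero assms[of 0]])
    moreover have "\<bar>h y\<bar> * rho y \<le> B * (18 / (sqn y + 16)\<^sup>2)"
      using assms[of y] by (intro mult_mono rho_le rho_nonneg) auto
    ultimately show ?thesis using rho_nonneg[of y] by (simp add: abs_mult)
  qed
  then show "AE y in count_space UNIV. norm (h y * rho y) \<le> norm (B * 18 / (sqn y + 16)\<^sup>2)" by simp
qed simp

lemma green_le: "green x \<le> 256 * f3 x" "green x \<le> 256" "norm (rv x) * green x \<le> 256" for x :: "int ^ 'd"
proof -
  show 1: "green x \<le> 256 * f3 x" using transient_3(2)[OF card3, of x] by (simp add: f3_def)
  show "green x \<le> 256" using 1 f3_bounds[of x] by linarith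
  have "norm (rv x) * green x \<le> norm (rv x) * (256 * f3 x)" by (intro mult_left_mono 1) auto
  then show "norm (rv x) * green x \<le> 256" using f3_bounds(3)[of x] by linarith
qed

lemma nbr_avg_pow_rho: "(nbr_avg ^^ k) rho x = (\<integral>y. hk k (x - y) * rho y \<partial>count_space UNIV)"
proof (induction k arbitrary: x)
  case 0
  have "(\<integral>y. hk 0 (x - y) * rho y \<partial>count_space UNIV) = (\<integral>y. indicator {x} y * rho y \<partial>count_space UNIV)"
    by (intro Bochner_Integration.integral_cong) (auto simp: hk_def indicator_def)
  also have "\<dots> = (\<Sum>y | y \<in> UNIV \<and> indicator {x} y * rho y \<noteq> 0. indicator {x} y * rho y)"
    by (rule lebesgue_integral_count_space_finite_support) (auto simp: indicator_def intro: finite_subset[of _ "{x}"])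
  also have "\<dots> = (\<Sum>y\<in>{x}. indicator {x} y * rho y)"
    by (rule sum.mono_neutral_left) (auto simp: indicator_def)
  finally show ?case by simp
next
  case (Suc k)
  have int: "integrable (count_space UNIV) (\<lambda>y. hk k (x + s - y) * rho y)" for s
    by (rule integrable_mult_rho[of _ 1]) (simp add: hk_le_1)
  have "(nbr_avg ^^ Suc k) rho x = nbr_avg (\<lambda>x. \<integral>y. hk k (x - y) * rho y \<partial>count_space UNIV) x"
    using Suc by (simp add: fun_eq_iff[symmetric]) (metis)
  also have "\<dots> = (\<integral>y. (\<Sum>s\<in>unit_steps. hk k (x + s - y) * rho y) / real (card (unit_steps :: (int ^ 'd) set)) \<partial>count_space UNIV)"
    unfolding nbr_avg_def using int by (simp add: Bochner_Integration.integral_sum)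
  also have "\<dots> = (\<integral>y. hk (Suc k) (x - y) * rho y \<partial>count_space UNIV)"
  proof (rule Bochner_Integration.integral_cong)
    fix y
    have "hk (Suc k) (x - y) = nbr_avg (hk k) (x - y)" by (simp add: hk_def)
    moreover have "(\<Sum>s\<in>unit_steps. hk k (x + s - y) * rho y) = (\<Sum>s\<in>unit_steps. hk k (x - y + s)) * rho y"
      unfolding sum_distrib_right by (intro sum.cong) (auto simp: algebra_simps)
    ultimately show "(\<Sum>s\<in>unit_steps. hk k (x + s - y) * rho y) / real (card (unit_steps :: (int ^ 'd) set)) = hk (Suc k) (x - y) * rho y"
      by (simp add: nbr_avg_def)
  qed simp
  finally show ?case .
qed

lemma hk_tendsto: "(\<lambda>n. hk n (x :: int ^ 'd)) \<longlonglongrightarrow> 0"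
  using summable_hk[of x] by (rule summable_LIMSEQ_zero)

text \<open>\<open>f3\<close> exceeds a given positive level only on a finite set, and by transience
  the probability of being in a finite set at time \<open>n\<close> tends to 0.\<close>

lemma nbr_avg_pow_f3_tendsto: "(\<lambda>n. (nbr_avg ^^ n) f3 x) \<longlonglongrightarrow> 0"
proof (rule LIMSEQ_I)
  fix \<epsilon> :: real assume \<epsilon>: "0 < \<epsilon>"
  define K where "K = {z :: int ^ 'd. norm (rv z) \<le> 2 / \<epsilon>}"
  have K: "finite K" unfolding K_def by (rule finite_norm_rv_le)
  have f3K: "f3 z \<le> \<epsilon> / 2 + indicator K z" for z
  proof (cases "z \<in> K")
    case True
    then show ?thesis using f3_bounds(2)[of z] \<epsilon> by simp
  next
    case False
    then have *: "2 / \<epsilon> < norm (rv z)" by (simp add: K_def)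
    have "(2 / \<epsilon>) * f3 z \<le> norm (rv z) * f3 z"
      using * f3_bounds(1)[of z] by (intro mult_right_mono) auto
    also have "\<dots> \<le> 1" by (rule f3_bounds)
    finally show ?thesis using \<epsilon> False by (simp add: field_simps)
  qed
  have le: "(nbr_avg ^^ n) f3 x \<le> \<epsilon> / 2 + (\<Sum>z\<in>K. hk n (x - z))" for n
  proof -
    have "(nbr_avg ^^ n) f3 x \<le> (nbr_avg ^^ n) (\<lambda>z. \<epsilon> / 2 + indicator K z) x"
      by (rule nbr_avg_pow_mono) (rule f3K)
    then show ?thesis
      by (simp add: nbr_avg_pow_add nbr_avg_pow_indicator[OF K])
  qed
  have "(\<lambda>n. \<Sum>z\<in>K. hk n (x - z)) \<longlonglongrightarrow> (\<Sum>z\<in>K. 0)"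
    by (intro tendsto_sum hk_tendsto)
  then have "\<forall>\<^sub>F n in sequentially. (\<Sum>z\<in>K. hk n (x - z)) < \<epsilon> / 2"
    using \<epsilon> by (intro order_tendstoD) auto
  then obtain N where N: "\<And>n. n \<ge> N \<Longrightarrow> (\<Sum>z\<in>K. hk n (x - z)) < \<epsilon> / 2"
    by (auto simp: eventually_sequentially)
  show "\<exists>no. \<forall>n\<ge>no. norm ((nbr_avg ^^ n) f3 x - 0) < \<epsilon>"
  proof (intro exI allI impI)
    fix n assume "n \<ge> N"
    then show "norm ((nbr_avg ^^ n) f3 x - 0) < \<epsilon>"
      using le[of n] N[of n] nbr_avg_pow_nonneg[of f3 n x] f3_bounds(1) by simp
  qed
qed

text \<open>Telescoping \<open>f3\<close> along the walk leaves a vanishing remainder; the partial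
  sums of the heat kernel are bounded by 256 and \<open>rho\<close> is summable, so the limit passes
  inside.\<close>

lemma f3_eq_green_rho: "f3 x = (\<integral>y. green (x - y) * rho y \<partial>count_space UNIV)"
proof -
  have "(\<lambda>n. \<integral>y. (\<Sum>k<n. hk k (x - y)) * rho y \<partial>count_space UNIV)
      \<longlonglongrightarrow> (\<integral>y. green (x - y) * rho y \<partial>count_space UNIV)"
  proof (rule integral_dominated_convergence)
    show "integrable (count_space UNIV) (\<lambda>y :: int ^ 'd. 256 * rho y)"
      by (rule integrable_mult_rho[of _ 256]) simp
    show "AE y in count_space UNIV. (\<lambda>n. (\<Sum>k<n. hk k (x - y)) * rho y) \<longlonglongrightarrow> green (x - y) * rho y"
      unfolding green_def by (auto intro!: tendsto_intros summable_LIMSEQ summable_hk)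
    have "norm ((\<Sum>k<n. hk k (x - y)) * rho y) \<le> 256 * rho y" for n y
    proof -
      have "(\<Sum>k<n. hk k (x - y)) \<le> 256"
        using sum_hk_le_green[of "x - y" n] green_le(2)[of "x - y"] by linarith
      then show ?thesis
        using rho_nonneg[of y] by (simp add: abs_mult sum_nonneg abs_of_nonneg mult_right_mono)
    qed
    then show "AE y in count_space UNIV. norm ((\<Sum>k<n. hk k (x - y)) * rho y) \<le> 256 * rho y" for n by simp
  qed auto
  moreover have "(\<integral>y. (\<Sum>k<n. hk k (x - y)) * rho y \<partial>count_space UNIV) = f3 x - (nbr_avg ^^ n) f3 x" for n
  proof -
    have int: "integrable (count_space UNIV) (\<lambda>y. hk k (x - y) * rho y)" for k
      by (rule integrable_mult_rho[of _ 1]) (simp add: hk_le_1)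
    have "(\<integral>y. (\<Sum>k<n. hk k (x - y)) * rho y \<partial>count_space UNIV) = (\<Sum>k<n. (nbr_avg ^^ k) rho x)"
      unfolding nbr_avg_pow_rho sum_distrib_right by (rule Bochner_Integration.integral_sum) (rule int)
    also have "\<dots> = f3 x - (nbr_avg ^^ n) f3 x"
      using nbr_avg_telescope[of n f3 x] unfolding rho_def[abs_def, symmetric] by simp
    finally show ?thesis .
  qed
  ultimately have "(\<lambda>n. f3 x - (nbr_avg ^^ n) f3 x) \<longlonglongrightarrow> (\<integral>y. green (x - y) * rho y \<partial>count_space UNIV)"
    by simp
  moreover have "(\<lambda>n. f3 x - (nbr_avg ^^ n) f3 x) \<longlonglongrightarrow> f3 x - 0"
    by (intro tendsto_intros nbr_avg_pow_f3_tendsto)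
  ultimately show ?thesis by (simp add: LIMSEQ_unique)
qed

text \<open>With r the norm of \<open>x\<close>, \<open>green\<close> is harmonic and at most 512/r
  in the ball of radius r/2 about \<open>x\<close>. The gradient bound with radius r/2 - 2, which is
  at least r/4 once r \<ge> 8, gives 9 * 512 * 4 = 18432.\<close>

lemma green_gradient:
  fixes x :: "int ^ 'd"
  assumes x: "8 \<le> norm (rv x)" and s: "s \<in> unit_steps"
  shows "\<bar>green (x + s) - green x\<bar> \<le> 18432 / (norm (rv x))\<^sup>2"
proof -
  define r where "r = norm (rv x)"
  have r: "8 \<le> r" using x by (simp add: r_def)
  have far: "r / 2 \<le> norm (rv z)" if "norm (rv (z - x)) \<le> r / 2 - 2 + 2" for z
  proof -
    have "rv x = rv z - rv (z - x)" by (simp add: rv_diff)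
    then have "r \<le> norm (rv z) + norm (rv (z - x))"
      unfolding r_def by (metis norm_triangle_ineq4)
    with that show ?thesis by simp
  qed
  have "\<bar>green (x + s) - green x\<bar> \<le> 3 * real CARD('d) * (512 / r) / (r / 2 - 2)"
  proof (rule harmonic_gradient[OF _ _ s])
    fix z assume z: "norm (rv (z - x)) \<le> r / 2 - 2 + 2"
    have nz: "norm (rv z) > 0" using far[OF z] r by linarith
    then have "z \<noteq> 0" by auto
    then show "nbr_avg green z = green z" by (simp add: nbr_avg_green)
    have "(r / 2) * green z \<le> norm (rv z) * green z"
      using far[OF z] by (intro mult_right_mono green_nonneg)
    then have "(r / 2) * green z \<le> 256" using green_le(3)[of z] by linarith
    then show "\<bar>green z\<bar> \<le> 512 / r" using r green_nonneg[of z] by (simp add: field_simps)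
  qed (use r card3 in auto)
  also have "\<dots> \<le> 3 * real CARD('d) * (512 / r) / (r / 4)"
    using r by (intro divide_left_mono mult_nonneg_nonneg mult_pos_pos) auto
  also have "\<dots> = 18432 / r\<^sup>2"
    by (simp add: card3 power2_eq_square)
  finally show ?thesis by (simp add: r_def)
qed

text \<open>A fixed shift is a fixed number of unit steps, each changing \<open>green\<close> by
  order 1/r^2; the factor r does not prevent convergence to 0.\<close>

lemma green_shift_tendsto:
  fixes X :: "nat \<Rightarrow> int ^ 'd"
  assumes X: "filterlim (\<lambda>n. norm (rv (X n))) at_top sequentially"
  shows "(\<lambda>n. norm (rv (X n)) * (green (X n - y) - green (X n))) \<longlonglongrightarrow> 0"
proof (induction y rule: lattice_induct)
  case (step y s)
  define d where "d = (\<lambda>n. norm (rv (X n)) * (green (X n - y + - s) - green (X n - y)))"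
  have s': "- s \<in> unit_steps" using step(2) by (rule uminus_unit_step)
  have "d \<longlonglongrightarrow> 0"
  proof (rule Lim_null_comparison)
    show "\<forall>\<^sub>F n in sequentially. norm (d n) \<le> 73728 / norm (rv (X n))"
      using X[unfolded filterlim_at_top, rule_format, of "16 + 2 * norm (rv y)"]
    proof eventually_elim
      case (elim n)
      define a where "a = norm (rv (X n))"
      have a: "16 + 2 * norm (rv y) \<le> a" using elim by (simp add: a_def)
      have "a / 2 \<le> norm (rv (X n - y))"
        using norm_triangle_ineq2[of "rv (X n)" "rv y"] a by (simp add: rv_diff a_def)
      moreover have "16 \<le> a" using a norm_ge_zero[of "rv y"] by linarith
      ultimately have b: "8 \<le> norm (rv (X n - y))" "(a / 2)\<^sup>2 \<le> (norm (rv (X n - y)))\<^sup>2" "0 < a"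
        by (auto intro!: power_mono)
      have "norm (d n) = a * \<bar>green (X n - y + - s) - green (X n - y)\<bar>"
        by (simp add: d_def a_def abs_mult)
      also have "\<dots> \<le> a * (18432 / (norm (rv (X n - y)))\<^sup>2)"
        using b by (intro mult_left_mono green_gradient s') auto
      also have "\<dots> \<le> a * (18432 / (a / 2)\<^sup>2)"
        using b by (intro mult_left_mono divide_left_mono mult_pos_pos zero_less_power) auto
      also have "\<dots> = 73728 / a" using b by (simp add: power2_eq_square)
      finally show ?case by (simp add: a_def)
    qed
    show "(\<lambda>n. 73728 / norm (rv (X n))) \<longlonglongrightarrow> 0"
      by (rule tendsto_divide_0[OF tendsto_const]) (rule filterlim_at_top_imp_at_infinity[OF X])
  qed
  from tendsto_add[OF this step(1)] show ?case
    by (simp add: d_def algebra_simps)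
qed simp

lemma rho_mass_pos: "0 < (\<integral>y. rho y \<partial>count_space UNIV)"
proof -
  have "f3 0 = (\<integral>y. green (0 - y) * rho y \<partial>count_space UNIV)" by (rule f3_eq_green_rho)
  also have "\<dots> \<le> (\<integral>y. 256 * rho y \<partial>count_space UNIV)"
  proof (rule integral_mono)
    show "integrable (count_space UNIV) (\<lambda>y. green (0 - y) * rho y)"
      by (rule integrable_mult_rho[of _ 256]) (simp add: abs_of_nonneg green_nonneg green_le)
    show "integrable (count_space UNIV) (\<lambda>y :: int ^ 'd. 256 * rho y)"
      by (rule integrable_mult_rho[of _ 256]) simp
  qed (intro mult_right_mono green_le rho_nonneg)
  finally have "f3 0 \<le> 256 * (\<integral>y. rho y \<partial>count_space UNIV)" by simp
  moreover have "0 < f3 0" by (simp add: f3_def)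
  ultimately show ?thesis by linarith
qed

text \<open>In the identity \<open>f3_eq_green_rho\<close>, multiplied by the norm, each
  \<open>green (X n - y)\<close> may be replaced by \<open>green (X n)\<close> at no cost in the
  limit. As the norm times \<open>f3\<close> tends to 1, the inverse of the total charge
  appears.\<close>

lemma green_tendsto:
  fixes X :: "nat \<Rightarrow> int ^ 'd"
  assumes X: "filterlim (\<lambda>n. norm (rv (X n))) at_top sequentially"
  shows "(\<lambda>n. norm (rv (X n)) * green (X n)) \<longlonglongrightarrow> 1 / (\<integral>y. rho y \<partial>count_space UNIV)"
proof -
  define \<kappa> where "\<kappa> = (\<integral>y. rho y \<partial>count_space UNIV)"
  have \<kappa>: "0 < \<kappa>" unfolding \<kappa>_def by (rule rho_mass_pos)
  let ?N = "\<lambda>n. norm (rv (X n))"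
  have int: "integrable (count_space UNIV) (\<lambda>y. green (x - y) * rho y)" for x
    by (rule integrable_mult_rho[of _ 256]) (simp add: abs_of_nonneg green_nonneg green_le)
  have int1: "integrable (count_space UNIV) rho"
    using integrable_mult_rho[of "\<lambda>_. 1" 1] by simp
  have "(\<lambda>n. \<integral>y. (?N n * (green (X n - y) - green (X n))) * rho y \<partial>count_space UNIV)
      \<longlonglongrightarrow> (\<integral>y. 0 * rho y \<partial>count_space UNIV)"
  proof (rule integral_dominated_convergence)
    show "integrable (count_space UNIV) (\<lambda>y :: int ^ 'd. 9216 / (sqn y + 16)\<^sup>2)" by (rule integrable_sqn)
    show "AE y in count_space UNIV. (\<lambda>n. (?N n * (green (X n - y) - green (X n))) * rho y) \<longlonglongrightarrow> 0 * rho y"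
      by (intro AE_I2 tendsto_mult green_shift_tendsto[OF X] tendsto_const)
    have "norm ((?N n * (green (X n - y) - green (X n))) * rho y) \<le> 9216 / (sqn y + 16)\<^sup>2" for n y
    proof -
      \<comment> \<open>Splitting the norm at \<open>y\<close> leaves growth that is linear in
        \<open>y\<close> and uniform in \<open>n\<close>, which the first moment of
        \<open>rho\<close> absorbs.\<close>
      have "?N n \<le> norm (rv (X n - y)) + norm (rv y)"
        using norm_triangle_ineq[of "rv (X n - y)" "rv y"] by (simp add: rv_diff)
      then have "?N n * green (X n - y) \<le> (norm (rv (X n - y)) + norm (rv y)) * green (X n - y)"
        by (rule mult_right_mono) (rule green_nonneg)
      also have "\<dots> \<le> 256 + norm (rv y) * 256"
        unfolding distrib_right by (intro add_mono mult_left_mono green_le) auto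
      finally have 1: "?N n * green (X n - y) \<le> 256 + norm (rv y) * 256" .
      have 2: "?N n * green (X n) \<le> 256" by (rule green_le)
      have 3: "0 \<le> ?N n * green (X n - y)" "0 \<le> ?N n * green (X n)" by (auto simp: green_nonneg)
      have "\<bar>?N n * (green (X n - y) - green (X n))\<bar> \<le> 512 * (1 + norm (rv y))"
      proof -
        have "\<bar>a - b\<bar> \<le> 512 * (1 + t)"
          if "a \<le> 256 + t * 256" "b \<le> 256" "0 \<le> a" "0 \<le> b" "0 \<le> t" for a b t :: real
          using that by (simp add: abs_le_iff)
        from this[OF 1 2 3 norm_ge_zero] show ?thesis unfolding right_diff_distrib .
      qed
      then have "norm ((?N n * (green (X n - y) - green (X n))) * rho y) \<le> 512 * (1 + norm (rv y)) * rho y"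
        using rho_nonneg[of y] unfolding real_norm_def[symmetric] by (subst norm_mult) (simp add: mult_right_mono abs_of_nonneg)
      also have "\<dots> \<le> 512 * (18 / (sqn y + 16)\<^sup>2)"
        unfolding mult.assoc by (intro mult_left_mono rho_weighted) simp
      finally show ?thesis by simp
    qed
    then show "AE y in count_space UNIV. norm ((?N n * (green (X n - y) - green (X n))) * rho y) \<le> 9216 / (sqn y + 16)\<^sup>2" for n
      by simp
  qed auto
  moreover have "(\<integral>y. (?N n * (green (X n - y) - green (X n))) * rho y \<partial>count_space UNIV)
      = ?N n * f3 (X n) - \<kappa> * (?N n * green (X n))" for n
  proof -
    have "(\<integral>y. (?N n * (green (X n - y) - green (X n))) * rho y \<partial>count_space UNIV)
       = (\<integral>y. ?N n * (green (X n - y) * rho y) - ?N n * green (X n) * rho y \<partial>count_space UNIV)"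
      by (intro Bochner_Integration.integral_cong) (auto simp: algebra_simps)
    also have "\<dots> = (\<integral>y. ?N n * (green (X n - y) * rho y) \<partial>count_space UNIV) - (\<integral>y. ?N n * green (X n) * rho y \<partial>count_space UNIV)"
      by (rule Bochner_Integration.integral_diff) (intro integrable_mult_right int int1)+
    also have "\<dots> = ?N n * f3 (X n) - \<kappa> * (?N n * green (X n))"
      by (simp add: f3_eq_green_rho[of "X n"] \<kappa>_def)
    finally show ?thesis .
  qed
  ultimately have a: "(\<lambda>n. ?N n * f3 (X n) - \<kappa> * (?N n * green (X n))) \<longlonglongrightarrow> 0" by simp
  have b: "(\<lambda>n. ?N n * f3 (X n)) \<longlonglongrightarrow> 1"
  proof -
    have lim: "((\<lambda>t::real. t * (1 / sqrt (t\<^sup>2 + 15))) \<longlongrightarrow> 1) at_top"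
      by real_asymp
    have "?N n * f3 (X n) = ?N n * (1 / sqrt ((?N n)\<^sup>2 + 15))" for n
      by (simp add: f3_def norm_rv_sq)
    then show ?thesis using filterlim_compose[OF lim X] by simp
  qed
  have "(\<lambda>n. (?N n * f3 (X n) - (?N n * f3 (X n) - \<kappa> * (?N n * green (X n)))) / \<kappa>) \<longlonglongrightarrow> (1 - 0) / \<kappa>"
    using \<kappa> by (intro tendsto_intros a b) auto
  then show ?thesis using \<kappa> by (simp add: \<kappa>_def[symmetric])
qed

text \<open>Uniformity over directions follows by contradiction from sequences, the form in which
  dominated convergence was applied.\<close>

lemma green_asymptotics:
  obtains c where "0 < c"
    and "\<And>\<epsilon>. 0 < \<epsilon> \<Longrightarrow> \<exists>R. \<forall>x :: int ^ 'd. R \<le> norm (rv x) \<longrightarrow> \<bar>norm (rv x) * green x - c\<bar> < \<epsilon>"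
proof
  let ?c = "1 / (\<integral>y. rho y \<partial>count_space UNIV)"
  show "0 < ?c" using rho_mass_pos by simp
  fix \<epsilon> :: real assume \<epsilon>: "0 < \<epsilon>"
  show "\<exists>R. \<forall>x :: int ^ 'd. R \<le> norm (rv x) \<longrightarrow> \<bar>norm (rv x) * green x - ?c\<bar> < \<epsilon>"
  proof (rule ccontr)
    assume "\<not> ?thesis"
    then have "\<forall>n::nat. \<exists>x :: int ^ 'd. real n \<le> norm (rv x) \<and> \<epsilon> \<le> \<bar>norm (rv x) * green x - ?c\<bar>"
      by (auto simp: not_less)
    then obtain X :: "nat \<Rightarrow> int ^ 'd" where X: "\<And>n. real n \<le> norm (rv (X n))"
        "\<And>n. \<epsilon> \<le> \<bar>norm (rv (X n)) * green (X n) - ?c\<bar>"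
      by metis
    have "filterlim (\<lambda>n. norm (rv (X n))) at_top sequentially"
      by (rule filterlim_at_top_mono[OF filterlim_real_sequentially]) (simp add: X)
    from green_tendsto[OF this] have "\<forall>\<^sub>F n in sequentially. dist (norm (rv (X n)) * green (X n)) ?c < \<epsilon>"
      using \<epsilon> by (rule tendstoD)
    then obtain n where "dist (norm (rv (X n)) * green (X n)) ?c < \<epsilon>"
      by (auto simp: eventually_sequentially)
    then show False using X(2)[of n] by (simp add: dist_real_def)
  qed
qed

end

subsection \<open>Lower bound: confinement to a translated rectangle\<close>

lemma pred_path [measurable]:
  "Measurable.pred (\<Pi>\<^sub>M k\<in>UNIV. count_space UNIV) (\<lambda>\<omega> :: nat \<Rightarrow> 'a. P (\<omega> n))"
  by (rule measurable_compose[OF measurable_component_singleton]) auto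

lemma less_exit_time: "enat k < exit_time A \<omega> \<longleftrightarrow> (\<forall>j\<le>k. \<omega> j \<in> A)"
proof
  assume *: "enat k < exit_time A \<omega>"
  show "\<forall>j\<le>k. \<omega> j \<in> A"
  proof (intro allI impI, rule ccontr)
    fix j assume "j \<le> k" "\<omega> j \<notin> A"
    then have "exit_time A \<omega> \<le> enat j" unfolding exit_time_def by (intro Inf_lower) auto
    then have "exit_time A \<omega> \<le> enat k" using \<open>j \<le> k\<close> by (meson enat_ord_simps(1) order_trans)
    with * show False by simp
  qed
next
  assume *: "\<forall>j\<le>k. \<omega> j \<in> A"
  have "enat (Suc k) \<le> exit_time A \<omega>"
    unfolding exit_time_def
  proof (rule Inf_greatest)
    fix e assume "e \<in> {enat k | k. \<omega> k \<notin> A}"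
    then obtain j where "e = enat j" "\<omega> j \<notin> A" by auto
    with * show "enat (Suc k) \<le> e" by (simp add: not_le[symmetric] Suc_le_eq) (metis not_le)
  qed
  then show "enat k < exit_time A \<omega>"
    by (meson enat_ord_simps(2) lessI less_le_trans)
qed

lemma visited_eq: "visited A \<omega> = {\<omega> k | k. \<forall>j\<le>k. \<omega> j \<in> A}"
  by (simp add: visited_def less_exit_time)

lemma visited_subset: "visited A \<omega> \<subseteq> A"
  by (auto simp: visited_eq)

text \<open>For finite \<open>A\<close> the visited set has finitely many possible values, each
  described by countably many coordinate events, so every predicate of it is measurable, in
  particular one involving \<open>cap\<close>.\<close>

lemma pred_visited:
  assumes "finite A"
  shows "Measurable.pred (\<Pi>\<^sub>M k\<in>UNIV. count_space UNIV) (\<lambda>\<omega> :: nat \<Rightarrow> 'a. P (visited A \<omega>))"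
proof -
  have eq: "P (visited A \<omega>) \<longleftrightarrow> (\<exists>F\<in>{F \<in> Pow A. P F}. \<forall>x\<in>A. x \<in> F \<longleftrightarrow> (\<exists>k. \<omega> k = x \<and> (\<forall>j\<in>{..k}. \<omega> j \<in> A)))" for \<omega>
  proof
    assume P: "P (visited A \<omega>)"
    show "\<exists>F\<in>{F \<in> Pow A. P F}. \<forall>x\<in>A. x \<in> F \<longleftrightarrow> (\<exists>k. \<omega> k = x \<and> (\<forall>j\<in>{..k}. \<omega> j \<in> A))"
    proof (rule bexI[of _ "visited A \<omega>"])
      show "visited A \<omega> \<in> {F \<in> Pow A. P F}" using P visited_subset[of A \<omega>] by simp
      have "x \<in> visited A \<omega> \<longleftrightarrow> (\<exists>k. \<omega> k = x \<and> (\<forall>j\<in>{..k}. \<omega> j \<in> A))" for x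
        unfolding visited_eq mem_Collect_eq by (metis atMost_iff)
      then show "\<forall>x\<in>A. x \<in> visited A \<omega> \<longleftrightarrow> (\<exists>k. \<omega> k = x \<and> (\<forall>j\<in>{..k}. \<omega> j \<in> A))" by blast
    qed
  next
    assume "\<exists>F\<in>{F \<in> Pow A. P F}. \<forall>x\<in>A. x \<in> F \<longleftrightarrow> (\<exists>k. \<omega> k = x \<and> (\<forall>j\<in>{..k}. \<omega> j \<in> A))"
    then obtain F where F0: "F \<in> {F \<in> Pow A. P F}" "\<forall>x\<in>A. x \<in> F \<longleftrightarrow> (\<exists>k. \<omega> k = x \<and> (\<forall>j\<in>{..k}. \<omega> j \<in> A))"
      by (rule bexE)
    have F: "F \<subseteq> A" "P F" using F0(1) by simp_all
    note F3 = F0(2)[rule_format]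
    have "visited A \<omega> = F"
    proof (rule set_eqI)
      fix x show "x \<in> visited A \<omega> \<longleftrightarrow> x \<in> F"
      proof
        assume "x \<in> visited A \<omega>"
        then obtain k where "\<omega> k = x" "\<forall>j\<le>k. \<omega> j \<in> A" unfolding visited_eq by blast
        then show "x \<in> F" using F3[of x] by auto
      next
        assume "x \<in> F"
        then obtain k where "\<omega> k = x" "\<forall>j\<in>{..k}. \<omega> j \<in> A" using F(1) F3[of x] by blast
        then show "x \<in> visited A \<omega>" unfolding visited_eq by auto
      qed
    qed
    then show "P (visited A \<omega>)" using F(2) by simp
  qed
  show ?thesis
    unfolding eq
    by (intro pred_intros_finite pred_intros_countable pred_intros_logic pred_path) (use assms in auto)
qed

text \<open>Only the times before \<open>k\<close> are constrained, and \<open>k\<close> need not be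
  the first visit to \<open>T\<close>. With \<open>T\<close> the complement of the ball, the range
  before exit is then contained in \<open>Q\<close>.\<close>

definition reach :: "(int ^ 'd) set \<Rightarrow> (int ^ 'd) set \<Rightarrow> int ^ 'd \<Rightarrow> real" where
  "reach T Q x = \<P>(\<xi> in steps_M. \<exists>k. x + part \<xi> k \<in> T \<and> (\<forall>j<k. x + part \<xi> j \<in> Q))"

lemma reach_nonneg [simp]: "0 \<le> reach T Q x" by (simp add: reach_def)

lemma reach_in: "x \<in> T \<Longrightarrow> reach T Q x = 1"
proof -
  interpret st: prob_space "steps_M :: (nat \<Rightarrow> int ^ 'd) measure"
    by (rule prob_space_steps_M)
  assume x: "x \<in> T"
  then have "x + part \<xi> 0 \<in> T \<and> (\<forall>j<0. x + part \<xi> j \<in> Q)" for \<xi> by simp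
  then have "{\<xi>. \<exists>k. x + part \<xi> k \<in> T \<and> (\<forall>j<k. x + part \<xi> j \<in> Q)} = UNIV" by blast
  then show "reach T Q x = 1" using st.prob_space by (simp add: reach_def)
qed

text \<open>Prefixing a step from a point of \<open>Q\<close> turns a successful path into a
  successful path; only success at time 0 is lost. Superharmonicity suffices for the comparison
  below.\<close>

lemma nbr_avg_reach:
  assumes "x \<in> Q"
  shows "nbr_avg (reach T Q) x \<le> reach T Q x"
proof -
  interpret st: prob_space "steps_M :: (nat \<Rightarrow> int ^ 'd) measure"
    by (rule prob_space_steps_M)
  have "nbr_avg (reach T Q) x = \<P>(\<xi> in steps_M. \<exists>k. x + part \<xi> (Suc k) \<in> T \<and> (\<forall>j<k. x + part \<xi> (Suc j) \<in> Q))"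
    by (subst prob_first_step) (auto simp: part_case_nat nbr_avg_def reach_def add.assoc)
  also have "\<dots> \<le> reach T Q x"
    unfolding reach_def
  proof (rule st.finite_measure_mono)
    have "(\<forall>j<Suc k. x + part \<xi> j \<in> Q)" if "\<forall>j<k. x + part \<xi> (Suc j) \<in> Q" for k \<xi>
      using that assms by (auto simp: less_Suc_eq_0_disj)
    then show "{\<xi> \<in> space steps_M. \<exists>k. x + part \<xi> (Suc k) \<in> T \<and> (\<forall>j<k. x + part \<xi> (Suc j) \<in> Q)}
       \<subseteq> {\<xi> \<in> space steps_M. \<exists>k. x + part \<xi> k \<in> T \<and> (\<forall>j<k. x + part \<xi> j \<in> Q)}" by auto
  qed measurable
  finally show ?thesis .
qed

text \<open>Separation of variables: each factor is an eigenfunction of the one-dimensional average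
  with eigenvalue \<open>lam i\<close>, and the eigenvalues have mean 1.\<close>

lemma nbr_avg_product:
  fixes \<phi> :: "'d::finite \<Rightarrow> int \<Rightarrow> real"
  assumes \<phi>: "\<And>i t. \<phi> i (t + 1) + \<phi> i (t - 1) = 2 * lam i * \<phi> i t"
    and lam: "(\<Sum>i\<in>UNIV. lam i) = real CARD('d)"
  shows "nbr_avg (\<lambda>x :: int ^ 'd. \<Prod>i\<in>UNIV. \<phi> i (x $ i)) x = (\<Prod>i\<in>UNIV. \<phi> i (x $ i))"
proof -
  have st: "(\<Prod>j\<in>UNIV. \<phi> j ((x + axis i a) $ j)) = \<phi> i (x $ i + a) * (\<Prod>j\<in>UNIV - {i}. \<phi> j (x $ j))" for i a
    by (subst prod.remove[of _ i]) (auto simp: axis_def intro!: prod.cong)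
  have "(\<Prod>j\<in>UNIV. \<phi> j ((x + axis i 1) $ j)) + (\<Prod>j\<in>UNIV. \<phi> j ((x + axis i (-1)) $ j))
    = 2 * lam i * (\<Prod>j\<in>UNIV. \<phi> j (x $ j))" for i
  proof -
    have "(\<Prod>j\<in>UNIV. \<phi> j ((x + axis i 1) $ j)) + (\<Prod>j\<in>UNIV. \<phi> j ((x + axis i (-1)) $ j))
      = (\<phi> i (x $ i + 1) + \<phi> i (x $ i - 1)) * (\<Prod>j\<in>UNIV - {i}. \<phi> j (x $ j))"
      unfolding st by (simp add: algebra_simps)
    also have "\<dots> = 2 * lam i * (\<phi> i (x $ i) * (\<Prod>j\<in>UNIV - {i}. \<phi> j (x $ j)))"
      unfolding \<phi> by simp
    also have "\<phi> i (x $ i) * (\<Prod>j\<in>UNIV - {i}. \<phi> j (x $ j)) = (\<Prod>j\<in>UNIV. \<phi> j (x $ j))"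
      by (subst (2) prod.remove[of _ i]) auto
    finally show ?thesis .
  qed
  then show ?thesis
    unfolding nbr_avg_def2 by (simp add: sum_distrib_left[symmetric] sum_distrib_right[symmetric] lam)
qed

text \<open>The product vanishes on all faces except the front face in direction \<open>e\<close>,
  where it is at most 1 and \<open>u\<close> is at least \<open>K\<close>. The maximum principle is
  run inside \<open>B\<close> only; off \<open>B\<close> the bound \<open>K \<le> u x\<close>
  already suffices.\<close>

lemma superharmonic_box_bound:
  fixes \<phi> :: "'d::finite \<Rightarrow> int \<Rightarrow> real" and l m :: "'d \<Rightarrow> int"
  assumes \<phi>: "\<And>i t. \<phi> i (t + 1) + \<phi> i (t - 1) = 2 * lam i * \<phi> i t"
    and lam: "(\<Sum>i\<in>UNIV. lam i) = real CARD('d)"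
    and b: "\<And>i t. l i - 1 \<le> t \<Longrightarrow> t \<le> m i + 1 \<Longrightarrow> 0 \<le> \<phi> i t \<and> \<phi> i t \<le> 1"
    and zl: "\<And>i. \<phi> i (l i - 1) = 0" and zm: "\<And>i. i \<noteq> e \<Longrightarrow> \<phi> i (m i + 1) = 0"
    and K: "0 \<le> K" and u0: "\<And>x :: int ^ 'd. 0 \<le> u x"
    and sup: "\<And>x. (\<And>i. l i \<le> x $ i \<and> x $ i \<le> m i) \<Longrightarrow> x \<in> B \<Longrightarrow> nbr_avg u x \<le> u x"
    and uB: "\<And>x. x \<notin> B \<Longrightarrow> K \<le> u x"
    and front: "\<And>x. x $ e = m e + 1 \<Longrightarrow> (\<And>i. i \<noteq> e \<Longrightarrow> l i \<le> x $ i \<and> x $ i \<le> m i) \<Longrightarrow> K \<le> u x"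
    and x: "\<And>i. l i \<le> x $ i \<and> x $ i \<le> m i"
  shows "K * (\<Prod>i\<in>UNIV. \<phi> i (x $ i)) \<le> u x"
proof -
  define h where "h = (\<lambda>x :: int ^ 'd. \<Prod>i\<in>UNIV. \<phi> i (x $ i))"
  define D where "D = {x. (\<forall>i. l i \<le> x $ i \<and> x $ i \<le> m i) \<and> x \<in> B}"
  define v where "v = (\<lambda>x. K * h x - u x)"
  have h1: "h y \<le> 1" if "\<And>i. l i - 1 \<le> y $ i \<and> y $ i \<le> m i + 1" for y
    unfolding h_def by (rule prod_le_1) (use that b in auto)
  have vB: "v y \<le> 0" if "\<And>i. l i - 1 \<le> y $ i \<and> y $ i \<le> m i + 1" "K \<le> u y" for y
    using mult_left_mono[OF h1[OF that(1)] K] that(2) by (simp add: v_def)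
  have "v x \<le> 0"
  proof (cases "x \<in> B")
    case True
    show ?thesis
    proof (rule max_principle)
      have "finite {x :: int ^ 'd. \<forall>i. x $ i \<in> {l i..m i}}"
        by (rule finite_subset[of _ "vec_lambda ` (\<Pi>\<^sub>E i\<in>UNIV. {l i..m i})"])
          (auto simp: image_iff PiE_iff intro!: bexI[of _ "vec_nth _"] finite_PiE)
      then show "finite D" by (rule finite_subset[rotated]) (auto simp: D_def)
      show "x \<in> D" using x True by (simp add: D_def)
    next
      fix y assume "y \<in> D"
      then have "nbr_avg u y \<le> u y" by (intro sup) (auto simp: D_def)
      moreover have "nbr_avg v y = K * h y - nbr_avg u y"
        unfolding v_def nbr_avg_diff nbr_avg_scale h_def by (simp add: nbr_avg_product[OF \<phi> lam])
      ultimately show "v y \<le> nbr_avg v y" by (simp add: v_def)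
    next
      fix y s :: "int ^ 'd" assume y: "y \<in> D" and s: "s \<in> unit_steps" and nD: "y + s \<notin> D"
      obtain i a where s_eq: "s = axis i a" "a = 1 \<or> a = -1" using s by (auto simp: unit_steps_def)
      have co: "(y + s) $ j = (if j = i then y $ i + a else y $ j)" for j by (simp add: s_eq axis_def)
      have yb: "l j \<le> y $ j" "y $ j \<le> m j" for j using y by (auto simp: D_def)
      have cl: "l j - 1 \<le> (y + s) $ j \<and> (y + s) $ j \<le> m j + 1" for j
        using yb[of j] s_eq(2) unfolding co by auto
      show "v (y + s) \<le> 0"
      proof (cases "y + s \<in> B")
        case False
        then show ?thesis using cl uB by (intro vB) auto
      next
        case True
        then have "\<not> (\<forall>j. l j \<le> (y + s) $ j \<and> (y + s) $ j \<le> m j)" using nD by (simp add: D_def)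
        then have "y $ i + a = l i - 1 \<or> y $ i + a = m i + 1"
          using yb cl[of i] unfolding co by (auto split: if_splits)
        then show ?thesis
        proof (cases "\<phi> i ((y + s) $ i) = 0")
          case True
          then have "h (y + s) = 0" unfolding h_def by (intro prod_zero) auto
          then show ?thesis using u0 by (simp add: v_def)
        next
          case False
          then have "\<phi> i (y $ i + a) \<noteq> 0" using co[of i] by simp
          with \<open>y $ i + a = l i - 1 \<or> y $ i + a = m i + 1\<close> zl[of i] zm[of i] have "i = e" "y $ i + a = m i + 1"
            by (cases "i = e"; auto)+
          then have "K \<le> u (y + s)" using yb by (intro front; unfold co) auto
          then show ?thesis using cl by (intro vB) auto
        qed
      qed
    qed
  next
    case False
    have "l i - 1 \<le> x $ i \<and> x $ i \<le> m i + 1" for i using x[of i] by auto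
    then show ?thesis using uB[OF False] by (rule vB)
  qed
  then show ?thesis by (simp add: v_def h_def)
qed

text \<open>From \<open>t \<le> sinh t\<close> and \<open>sinh t \<le> t * exp t\<close>. The factor
  \<open>s / S\<close> keeps the linear dependence on the starting depth, and the exponential is the
  price of the crossing.\<close>

lemma sinh_ratio_ge:
  fixes a s S :: real
  assumes a: "0 < a" and s: "0 \<le> s" and S: "0 < S"
  shows "(s / S) * exp (- (a * S)) \<le> sinh (a * s) / sinh (a * S)"
proof -
  have ge: "t \<le> sinh t" if "0 \<le> t" for t :: real
  proof -
    have "(\<lambda>t. sinh t - t) 0 \<le> (\<lambda>t. sinh t - t) t"
      by (rule DERIV_nonneg_imp_nondecreasing[OF that])
        (auto intro!: derivative_eq_intros exI simp: cosh_real_ge_1)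
    then show ?thesis by simp
  qed
  have le: "sinh t \<le> t * exp t" for t :: real
  proof -
    have "1 - 2 * t \<le> exp (- 2 * t)" using exp_ge_add_one_self[of "- 2 * t"] by simp
    then have "exp t * (1 - 2 * t) \<le> exp t * exp (- 2 * t)" by (intro mult_left_mono) auto
    also have "exp t * exp (- 2 * t) = exp (- t)" by (simp add: exp_add[symmetric])
    finally show ?thesis by (simp add: sinh_field_def algebra_simps)
  qed
  have p: "0 < sinh (a * S)" using a S by simp
  have "(s / S) * exp (- (a * S)) * sinh (a * S) \<le> (s / S) * exp (- (a * S)) * (a * S * exp (a * S))"
    using s S le[of "a * S"] by (intro mult_left_mono) auto
  also have "\<dots> = a * s" using S by (simp add: exp_minus field_simps)
  also have "\<dots> \<le> sinh (a * s)" using a s by (intro ge) auto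
  finally show ?thesis using p by (simp add: field_simps)
qed

lemma sin_shift_sum: "sin (b * (t + 1)) + sin (b * (t - 1)) = 2 * cos b * sin (b * t)" for b t :: real
  by (simp add: distrib_left right_diff_distrib sin_add sin_diff)

lemma sinh_shift_sum: "sinh (b * (t + 1)) + sinh (b * (t - 1)) = 2 * cosh b * sinh (b * t)" for b t :: real
  by (simp add: distrib_left right_diff_distrib sinh_add sinh_diff)

text \<open>One sinh in the crossing direction and a half-wave of a sine in each other one. The
  sines vanish just outside the box, at \<open>l i - 1\<close> and \<open>m i + 1\<close>, whence
  the widths \<open>m i - l i + 2\<close>.\<close>

lemma box_crossing:
  fixes l m :: "'d::finite \<Rightarrow> int" and e :: 'd
  assumes lm: "\<And>i. l i \<le> m i" and d: "2 \<le> CARD('d)"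
    and K: "0 \<le> K" and u0: "\<And>x :: int ^ 'd. 0 \<le> u x"
    and sup: "\<And>x. (\<And>i. l i \<le> x $ i \<and> x $ i \<le> m i) \<Longrightarrow> x \<in> B \<Longrightarrow> nbr_avg u x \<le> u x"
    and uB: "\<And>x. x \<notin> B \<Longrightarrow> K \<le> u x"
    and front: "\<And>x. x $ e = m e + 1 \<Longrightarrow> (\<And>i. i \<noteq> e \<Longrightarrow> l i \<le> x $ i \<and> x $ i \<le> m i) \<Longrightarrow> K \<le> u x"
    and x: "\<And>i. l i \<le> x $ i \<and> x $ i \<le> m i"
    and \<beta>: "\<And>i. i \<noteq> e \<Longrightarrow> pi / real_of_int (m i - l i + 2) \<le> \<beta>"
    and \<sigma>: "\<And>i. i \<noteq> e \<Longrightarrow> 0 \<le> \<sigma> i \<and> \<sigma> i \<le> sin (pi * real_of_int (x $ i - l i + 1) / real_of_int (m i - l i + 2))"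
  shows "K * ((real_of_int (x $ e - l e + 1) / real_of_int (m e - l e + 2)) * exp (- (real CARD('d) * \<beta> * real_of_int (m e - l e + 2)))
      * (\<Prod>i\<in>UNIV - {e}. \<sigma> i)) \<le> u x"
proof -
  define w where "w = (\<lambda>i. real_of_int (m i - l i + 2))"
  have w2: "2 \<le> w i" for i using lm[of i] by (simp add: w_def)
  define b where "b = (\<lambda>i. pi / w i)"
  have b: "0 < b i" "b i \<le> pi / 2" "b i * w i = pi" for i
    using w2[of i] by (auto simp: b_def field_simps)
  \<comment> \<open>The eigenvalues have to add up to the dimension, which forces
    \<open>cosh a = c\<close>; a second coordinate makes \<open>c > 1\<close> and hence
    \<open>a > 0\<close>.\<close>
  define c where "c = 1 + (\<Sum>i\<in>UNIV - {e}. 1 - cos (b i))"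
  have ne: "UNIV - {e} \<noteq> {}"
  proof
    assume "UNIV - {e} = {}"
    then have "(UNIV :: 'd set) = {e}" by auto
    then have "CARD('d) = card {e}" by simp
    with d show False by simp
  qed
  have "0 < 1 - cos (b i)" for i
  proof -
    have "cos (b i) < cos 0" using b(1,2)[of i] by (intro cos_monotone_0_pi) auto
    then show ?thesis by simp
  qed
  then have c: "1 < c" using ne unfolding c_def by (simp add: sum_pos)
  define a where "a = arcosh c"
  have "cosh a = c" using c by (simp add: a_def)
  moreover have "0 \<le> a" using c by (simp add: a_def arcosh_nonneg_real)
  moreover have "a \<noteq> 0" using c \<open>cosh a = c\<close> by auto
  ultimately have a: "0 < a" "cosh a = c" by auto
  have \<beta>0: "0 \<le> \<beta>"
  proof -
    obtain i where "i \<noteq> e" using ne by auto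
    then show ?thesis using \<beta>[of i] b(1)[of i] by (simp add: b_def w_def)
  qed
  have a_le: "a \<le> real CARD('d) * \<beta>"
  proof -
    have cosh_ge: "1 + a\<^sup>2 / 2 \<le> cosh a"
    proof -
      have "cosh a = 1 + 2 * (sinh (a / 2))\<^sup>2" using cosh_double[of "a / 2"] cosh_square_eq[of "a/2"] by simp
      moreover have "(a / 2)\<^sup>2 \<le> (sinh (a / 2))\<^sup>2"
      proof (rule power_mono)
        have "(\<lambda>t::real. sinh t - t) 0 \<le> (\<lambda>t. sinh t - t) (a / 2)"
          by (rule DERIV_nonneg_imp_nondecreasing)
            (use a in \<open>auto intro!: derivative_eq_intros exI simp: cosh_real_ge_1\<close>)
        then show "a / 2 \<le> sinh (a / 2)" by simp
      qed (use a in auto)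
      ultimately show ?thesis by (simp add: power_divide)
    qed
    have "1 - cos (b i) \<le> \<beta>\<^sup>2 / 2" if "i \<noteq> e" for i
    proof -
      have "1 - cos (b i) = 2 * (sin (b i / 2))\<^sup>2" using cos_double_sin[of "b i / 2"] by simp
      also have "(sin (b i / 2))\<^sup>2 \<le> (b i / 2)\<^sup>2"
        using abs_sin_x_le_abs_x[of "b i / 2"] by (simp add: abs_le_square_iff[symmetric])
      finally have "1 - cos (b i) \<le> (b i)\<^sup>2 / 2" by (simp add: power_divide)
      also have "\<dots> \<le> \<beta>\<^sup>2 / 2" using b(1)[of i] \<beta>[OF that]
        by (intro divide_right_mono power_mono) (auto simp: b_def w_def)
      finally show ?thesis .
    qed
    then have "c \<le> 1 + (\<Sum>i\<in>UNIV - {e}. \<beta>\<^sup>2 / 2)"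
      unfolding c_def by (intro add_mono sum_mono) auto
    also have "\<dots> \<le> 1 + real CARD('d) * (\<beta>\<^sup>2 / 2)"
      by (simp add: card_Diff_singleton) (intro divide_right_mono mult_right_mono; simp)
    \<comment> \<open>A factor of the dimension is given away to complete the square of
      \<open>real CARD('d) * \<beta>\<close>.\<close>
    also have "\<dots> \<le> 1 + real CARD('d) * (real CARD('d) * (\<beta>\<^sup>2 / 2))"
    proof -
      have "1 * (\<beta>\<^sup>2 / 2) \<le> real CARD('d) * (\<beta>\<^sup>2 / 2)" using d by (intro mult_right_mono) auto
      then show ?thesis by (intro add_left_mono mult_left_mono) auto
    qed
    finally have "a\<^sup>2 \<le> (real CARD('d) * \<beta>)\<^sup>2"
      using cosh_ge a by (simp add: power_mult_distrib power2_eq_square algebra_simps)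
    then show ?thesis by (rule power2_le_imp_le) (use \<beta>0 in auto)
  qed
  define \<phi> where "\<phi> = (\<lambda>i t. if i = e then sinh (a * real_of_int (t - l e + 1)) / sinh (a * w e)
      else sin (b i * real_of_int (t - l i + 1)))"
  define lam where "lam = (\<lambda>i. if i = e then cosh a else cos (b i))"
  have sinh_pos: "0 < sinh (a * w e)" using a w2[of e] by simp
  have "K * (\<Prod>i\<in>UNIV. \<phi> i (x $ i)) \<le> u x"
  proof (rule superharmonic_box_bound[where \<phi>=\<phi> and lam=lam and l=l and m=m and e=e and B=B, OF _ _ _ _ _ K u0 sup uB front x])
    show "\<phi> i (t + 1) + \<phi> i (t - 1) = 2 * lam i * \<phi> i t" for i t
    proof (cases "i = e")
      case True
      have "sinh (a * (real_of_int (t - l e + 1) + 1)) + sinh (a * (real_of_int (t - l e + 1) - 1)) = 2 * cosh a * sinh (a * real_of_int (t - l e + 1))"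
        by (rule sinh_shift_sum)
      then show ?thesis using True by (simp add: \<phi>_def lam_def add_divide_distrib[symmetric] algebra_simps)
    next
      case False
      have "sin (b i * (real_of_int (t - l i + 1) + 1)) + sin (b i * (real_of_int (t - l i + 1) - 1)) = 2 * cos (b i) * sin (b i * real_of_int (t - l i + 1))"
        by (rule sin_shift_sum)
      then show ?thesis using False by (simp add: \<phi>_def lam_def algebra_simps)
    qed
    have "(\<Sum>i\<in>UNIV. lam i) = cosh a + (\<Sum>i\<in>UNIV - {e}. cos (b i))"
      by (subst sum.remove[of _ e]) (auto simp: lam_def intro!: sum.cong)
    also have "\<dots> = real CARD('d)"
      using d by (simp add: a c_def sum_subtractf card_Diff_singleton of_nat_diff)
    finally show "(\<Sum>i\<in>UNIV. lam i) = real CARD('d)" .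
    show "\<phi> i (l i - 1) = 0" for i by (simp add: \<phi>_def)
    show "\<phi> i (m i + 1) = 0" if "i \<noteq> e" for i
    proof -
      have "b i * real_of_int (m i + 1 - l i + 1) = pi" using b(3)[of i] by (simp add: w_def algebra_simps)
      then show ?thesis using that by (simp add: \<phi>_def)
    qed
    fix i t assume t: "l i - 1 \<le> t" "t \<le> m i + 1"
    show "0 \<le> \<phi> i t \<and> \<phi> i t \<le> 1"
    proof (cases "i = e")
      case True
      have "0 \<le> a * real_of_int (t - l e + 1)" "a * real_of_int (t - l e + 1) \<le> a * w e"
        using t a True by (auto simp: w_def)
      then show ?thesis using True sinh_pos by (simp add: \<phi>_def)
    next
      case False
      have "real_of_int (t - l i + 1) \<le> w i" using t by (simp add: w_def)
      then have "b i * real_of_int (t - l i + 1) \<le> pi"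
        using mult_left_mono[of _ "w i" "b i"] b(1,3)[of i] by (metis less_eq_real_def)
      moreover have "0 \<le> b i * real_of_int (t - l i + 1)" using t b(1)[of i] by auto
      ultimately show ?thesis using False by (simp add: \<phi>_def sin_ge_zero)
    qed
  qed
  moreover have "(real_of_int (x $ e - l e + 1) / real_of_int (m e - l e + 2)) * exp (- (real CARD('d) * \<beta> * real_of_int (m e - l e + 2)))
      * (\<Prod>i\<in>UNIV - {e}. \<sigma> i) \<le> (\<Prod>i\<in>UNIV. \<phi> i (x $ i))"
  proof -
    have s0: "0 \<le> real_of_int (x $ e - l e + 1)" using x[of e] by simp
    have "(real_of_int (x $ e - l e + 1) / w e) * exp (- (real CARD('d) * \<beta> * w e)) \<le> (real_of_int (x $ e - l e + 1) / w e) * exp (- (a * w e))"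
      using s0 w2[of e] a_le by (intro mult_left_mono) (auto intro!: mult_right_mono)
    also have "\<dots> \<le> \<phi> e (x $ e)"
      unfolding \<phi>_def using sinh_ratio_ge[OF a(1) s0, of "w e"] w2[of e] by simp
    finally have 1: "(real_of_int (x $ e - l e + 1) / w e) * exp (- (real CARD('d) * \<beta> * w e)) \<le> \<phi> e (x $ e)" .
    have 2: "(\<Prod>i\<in>UNIV - {e}. \<sigma> i) \<le> (\<Prod>i\<in>UNIV - {e}. \<phi> i (x $ i))"
      by (rule prod_mono) (use \<sigma> in \<open>auto simp: \<phi>_def b_def w_def\<close>)
    have "(\<Prod>i\<in>UNIV. \<phi> i (x $ i)) = \<phi> e (x $ e) * (\<Prod>i\<in>UNIV - {e}. \<phi> i (x $ i))"
      by (subst prod.remove[of _ e]) auto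
    moreover have "0 \<le> (\<Prod>i\<in>UNIV - {e}. \<sigma> i)" by (rule prod_nonneg) (use \<sigma> in auto)
    moreover have "0 \<le> \<phi> e (x $ e)" using s0 a sinh_pos by (auto simp: \<phi>_def)
    ultimately show ?thesis using mult_mono[OF 1 2] by (simp add: w_def)
  qed
  ultimately show ?thesis
    using K by (meson mult_left_mono order_trans)
qed

lemma sin_quarter_ge: "1/4 \<le> t \<Longrightarrow> t \<le> 3/4 \<Longrightarrow> 1/2 \<le> sin (pi * t)" for t :: real
proof -
  assume t: "1/4 \<le> t" "t \<le> 3/4"
  have h: "1/2 \<le> sin (pi * s)" if "1/4 \<le> s" "s \<le> 1/2" for s
  proof -
    have "sin (pi / 4) \<le> sin (pi * s)"
      using that by (intro sin_monotone_2pi_le) auto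
    moreover have "1/2 \<le> sin (pi / 4)"
      by (simp add: sin_45 real_le_rsqrt)
    ultimately show ?thesis by linarith
  qed
  show ?thesis
  proof (cases "t \<le> 1/2")
    case True
    then show ?thesis using h t by simp
  next
    case False
    have "sin (pi * t) = sin (pi * (1 - t))"
      by (simp add: right_diff_distrib sin_diff)
    then show ?thesis using h[of "1 - t"] False t by simp
  qed
qed

text \<open>Serves the coordinate in which the walk starts close to a face, where the sine is only
  linear in the depth.\<close>

lemma sin_half_le: "0 \<le> t \<Longrightarrow> t \<le> 1/2 \<Longrightarrow> t \<le> sin (pi * t)" for t :: real
proof -
  assume t: "0 \<le> t" "t \<le> 1/2"
  show ?thesis
  proof (cases "1/4 \<le> t")
    case True
    then show ?thesis using sin_quarter_ge[of t] t by simp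
  next
    case False
    have "(\<lambda>t. sin (pi * t) - t) 0 \<le> (\<lambda>t. sin (pi * t) - t) t"
    proof (rule DERIV_nonneg_imp_nondecreasing[OF t(1)])
      fix s assume s: "0 \<le> s" "s \<le> t"
      have "cos (pi / 4) \<le> cos (pi * s)"
        using s False by (intro cos_monotone_0_pi_le) auto
      moreover have "1/2 \<le> cos (pi / 4)" by (simp add: cos_45 real_le_rsqrt)
      ultimately have "pi * (1/2) \<le> pi * cos (pi * s)" by (intro mult_left_mono) auto
      moreover have "1 \<le> pi * (1/2)" using pi_ge_two by simp
      ultimately have "1 \<le> pi * cos (pi * s)" by (rule order_trans[rotated])
      then have "0 \<le> cos (pi * s) * pi - 1" by (simp add: mult.commute)
      moreover have "((\<lambda>t. sin (pi * t) - t) has_real_derivative (cos (pi * s) * pi - 1)) (at s)"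
        by (auto intro!: derivative_eq_intros)
      ultimately show "\<exists>y. ((\<lambda>t. sin (pi * t) - t) has_real_derivative y) (at s) \<and> 0 \<le> y" by blast
    qed
    then show ?thesis by simp
  qed
qed

text \<open>
  \<open>Q\<close> is a translate of the rectangle containing \<open>0\<close> at depth \<open>r\<close>. Since \<open>r\<close> is at most
  \<open>p\<^sup>2 / (8 N)\<close>, a path that leaves \<open>Q\<close> through its front face with \<open>k\<close>-th coordinate at least \<open>p/2\<close>
  is outside the ball. So the walk first moves to height \<open>p\<close> in direction \<open>k\<close> (stage S) and then
  crosses \<open>Q\<close> in direction \<open>1\<close> around this height (stage T).
\<close>

lemma reach_rectangle:
  fixes N p :: nat and k :: "'d::{finite, one}"
  assumes p: "1 \<le> p" "p \<le> N" and k: "k \<noteq> 1" and d: "2 \<le> CARD('d)"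
  defines "r \<equiv> int (p\<^sup>2 div (8 * N))" and "w \<equiv> int (p div 2)"
  defines "Q \<equiv> {x :: (int, 'd) vec. \<forall>i. (if i = 1 then - r else if i = k then w - int p else - int p) \<le> x $ i \<and>
      x $ i \<le> (if i = 1 then int N - r else if i = k then w + int p else int p)}"
  shows "(1/2) ^ CARD('d) / 18432 * exp (- (12 * real CARD('d))) * (real p / real N) ^ 3 * exp (- (12 * real CARD('d) * real N / real p))
    \<le> reach (- lattice_ball N) Q 0"
proof -
  let ?d = "real CARD('d)"
  let ?B = "lattice_ball N :: ((int, 'd) vec) set"
  let ?u = "reach (- ?B) Q"
  have N1: "1 \<le> N" using p by simp
  have r0: "0 \<le> r" by (simp add: r_def)
  have w0: "0 \<le> w" by (simp add: w_def)
  have w2: "2 * w \<le> int p" "int p - 1 \<le> 2 * w" unfolding w_def by presburger+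
  have rN: "8 * (r * int N) \<le> (int p)\<^sup>2"
  proof -
    have "(p\<^sup>2 div (8 * N)) * (8 * N) \<le> p\<^sup>2" by simp
    then have "int ((p\<^sup>2 div (8 * N)) * (8 * N)) \<le> int (p\<^sup>2)" by (simp only: of_nat_le_iff)
    then show ?thesis by (simp add: r_def algebra_simps)
  qed
  \<comment> \<open>The depth counted from just outside the face, r + 1, is of order p^2/N even when
    the division gives r = 0.\<close>
  have r1: "real p * real p \<le> 8 * real N * (real_of_int r + 1)"
  proof -
    have "p\<^sup>2 < (p\<^sup>2 div (8 * N) + 1) * (8 * N)"
      using dividend_less_div_times[of "8 * N" "p\<^sup>2"] N1 by simp
    then have "real (p\<^sup>2) < real ((p\<^sup>2 div (8 * N) + 1) * (8 * N))" by (simp only: of_nat_less_iff)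
    then show ?thesis by (simp add: r_def power2_eq_square algebra_simps)
  qed
  have rp: "8 * r \<le> int p"
  proof -
    have "8 * (r * int p) \<le> 8 * (r * int N)" using r0 p by (simp add: mult_left_mono)
    also have "\<dots> \<le> int p * int p" using rN by (simp add: power2_eq_square)
    finally have "(8 * r) * int p \<le> int p * int p" by simp
    then show ?thesis using p by (simp add: mult_le_cancel_right)
  qed
  \<comment> \<open>Half of the depth is held back: stage S keeps the first coordinate at least -r',
    so stage T starts at distance at least (r + 1)/2 from the back of its box.\<close>
  define r' where "r' = r div 2"
  have r': "0 \<le> r'" "2 * r' \<le> r" "r - 1 \<le> 2 * r'" using r0 unfolding r'_def by presburger+
  \<comment> \<open>Pythagoras: (N - r + 1)^2 + (p/2)^2 exceeds N^2 because 8 r N \<le> p^2.\<close>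
  have notB: "x \<notin> ?B" if "x $ 1 = int N - r + 1" "int p - w \<le> x $ k" for x
  proof
    assume "x \<in> ?B"
    then have "norm (rv x) \<le> real N" by (simp add: lattice_ball_eq)
    then have "sqn x \<le> (real N)\<^sup>2" unfolding norm_rv_sq[symmetric] by (rule power_mono) simp
    moreover have "(\<Sum>i\<in>{1, k}. (real_of_int (x $ i))\<^sup>2) \<le> sqn x"
      unfolding sqn_def by (rule sum_mono2) auto
    ultimately have "real_of_int ((x $ 1)\<^sup>2 + (x $ k)\<^sup>2) \<le> real_of_int ((int N)\<^sup>2)" using k by simp
    then have *: "(x $ 1)\<^sup>2 + (x $ k)\<^sup>2 \<le> (int N)\<^sup>2" by (simp only: of_int_le_iff)
    have "(int p - w)\<^sup>2 \<le> (x $ k)\<^sup>2" using that(2) w2 w0 p by (intro power_mono) auto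
    moreover have "(int p)\<^sup>2 \<le> 4 * (int p - w)\<^sup>2"
    proof -
      have "(int p)\<^sup>2 \<le> (2 * (int p - w))\<^sup>2" using w2 by (intro power_mono) auto
      also have "\<dots> = 4 * (int p - w)\<^sup>2" unfolding power_mult_distrib by simp
      finally show ?thesis .
    qed
    ultimately have a: "(int p)\<^sup>2 \<le> 4 * (x $ k)\<^sup>2" by linarith
    have b: "(x $ 1)\<^sup>2 = (int N)\<^sup>2 - 2 * (r - 1) * int N + (r - 1)\<^sup>2"
      unfolding that(1) by (simp add: power2_eq_square algebra_simps)
    show False
    proof (cases "r = 0")
      case True
      then show False using * b zero_le_power2[of "x $ k"] p by simp
    next
      case False
      have "4 * (2 * (r - 1) * int N) < (int p)\<^sup>2"
        using rN N1 by (simp add: algebra_simps)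
      then show False using * a b zero_le_power2[of "r - 1"] by linarith
    qed
  qed
  have sup: "nbr_avg ?u x \<le> ?u x" if "x \<in> Q" for x
    using that by (rule nbr_avg_reach)
  have out: "1 \<le> ?u x" if "x \<notin> ?B" for x
    using reach_in[of x "- ?B" Q] that by simp
  \<comment> \<open>The narrowest transverse side is that of direction 1 in stage S, p - r + r' + 2;
    it is at least 7p/8 since 8 r \<le> p.\<close>
  have b4: "pi / v \<le> 4 / real p" if "7 * real p \<le> 8 * v" for v
  proof -
    have "0 < v" "0 < real p" using that p by auto
    moreover have "pi * real p \<le> 4 * v"
    proof -
      have "pi * real p \<le> 3.2 * real p" using pi_approx p by (intro mult_right_mono) auto
      then show ?thesis using that by linarith
    qed
    ultimately show ?thesis by (simp add: field_simps)
  qed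
  define KT where "KT = (real_of_int (r + 1) / (2 * real (N + 2))) * exp (- (?d * (4 / real p) * real (N + 2))) * (1/2) ^ (CARD('d) - 1)"
  have KT0: "0 \<le> KT" using r0 by (simp add: KT_def)
  have stageT: "KT \<le> ?u y" if y: "- r' \<le> y $ 1" "y $ 1 \<le> int p - r" "y $ k = int p" "\<And>i. i \<noteq> 1 \<Longrightarrow> i \<noteq> k \<Longrightarrow> - w \<le> y $ i \<and> y $ i \<le> w" for y
  proof -
    define l where "l = (\<lambda>i::'d. if i = 1 then - r else if i = k then int p - w else - int p)"
    define m where "m = (\<lambda>i::'d. if i = 1 then int N - r else if i = k then int p + w else int p)"
    have "1 * ((real_of_int (y $ 1 - l 1 + 1) / real_of_int (m 1 - l 1 + 2)) * exp (- (?d * (4 / real p) * real_of_int (m 1 - l 1 + 2)))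
      * (\<Prod>i\<in>UNIV - {1::'d}. (1/2 :: real))) \<le> ?u y"
    proof (rule box_crossing[OF _ d, where B="?B"])
      show "l i \<le> m i" for i using r0 w0 p by (auto simp: l_def m_def)
      show "nbr_avg ?u x \<le> ?u x" if "\<And>i. l i \<le> x $ i \<and> x $ i \<le> m i" for x
      proof (rule sup)
        show "x \<in> Q" unfolding Q_def
        proof safe
          fix i
          have "l i \<le> x $ i" "x $ i \<le> m i" using that by auto
          then show "(if i = 1 then - r else if i = k then w - int p else - int p) \<le> x $ i"
            "x $ i \<le> (if i = 1 then int N - r else if i = k then w + int p else int p)"
            using w2 w0 by (auto simp: l_def m_def split: if_splits)
        qed
      qed
      show "1 \<le> ?u x" if "x $ 1 = m 1 + 1" "\<And>i. i \<noteq> 1 \<Longrightarrow> l i \<le> x $ i \<and> x $ i \<le> m i" for x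
        using that(1) that(2)[of k] k by (intro out notB) (auto simp: l_def m_def)
      show "l i \<le> y $ i \<and> y $ i \<le> m i" for i
        using y(1,2,3) y(4)[of i] r' w2 w0 p by (cases "i = 1"; cases "i = k") (auto simp: l_def m_def)
      fix i :: 'd assume i: "i \<noteq> 1"
      show "pi / real_of_int (m i - l i + 2) \<le> 4 / real p"
        using i w2 p by (intro b4) (auto simp: l_def m_def)
      show "(0::real) \<le> 1/2 \<and> 1/2 \<le> sin (pi * real_of_int (y $ i - l i + 1) / real_of_int (m i - l i + 2))"
      proof -
        \<comment> \<open>Stage T starts in the middle half of every transverse side, so each sine
          is at least 1/2.\<close>
        have "1/4 \<le> real_of_int (y $ i - l i + 1) / real_of_int (m i - l i + 2)"
          "real_of_int (y $ i - l i + 1) / real_of_int (m i - l i + 2) \<le> 3/4"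
          using i y(3) y(4)[of i] w0 w2 p by (auto simp: l_def m_def field_simps)
        from sin_quarter_ge[OF this] show ?thesis by simp
      qed
    qed (use out in auto)
    moreover have "KT \<le> (real_of_int (y $ 1 - l 1 + 1) / real_of_int (m 1 - l 1 + 2)) * exp (- (?d * (4 / real p) * real_of_int (m 1 - l 1 + 2)))
      * (\<Prod>i\<in>UNIV - {1::'d}. (1/2 :: real))"
    proof -
      have e: "real_of_int (m 1 - l 1 + 2) = real (N + 2)" by (simp add: m_def l_def)
      have "r + 1 \<le> 2 * (y $ 1 - l 1 + 1)" using y(1) r' by (simp add: l_def)
      then have "real_of_int (r + 1) \<le> real_of_int (2 * (y $ 1 - l 1 + 1))" by (simp only: of_int_le_iff)
      then have "real_of_int (r + 1) / (2 * real (N + 2)) \<le> real_of_int (2 * (y $ 1 - l 1 + 1)) / (2 * real (N + 2))"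
        by (intro divide_right_mono) auto
      also have "\<dots> = real_of_int (y $ 1 - l 1 + 1) / real (N + 2)"
        by (simp only: of_int_mult of_int_numeral mult_divide_mult_cancel_left_if) simp
      finally have "real_of_int (r + 1) / (2 * real (N + 2)) \<le> real_of_int (y $ 1 - l 1 + 1) / real (N + 2)" .
      moreover have "(\<Prod>i\<in>UNIV - {1::'d}. (1/2 :: real)) = (1/2) ^ (CARD('d) - 1)"
        by (simp add: card_Diff_singleton)
      ultimately show ?thesis unfolding KT_def e
        by (simp only:) (intro mult_right_mono; simp)
    qed
    ultimately show ?thesis by simp
  qed
  define l where "l = (\<lambda>i::'d. if i = 1 then - r' else if i = k then w - int p else - w)"
  \<comment> \<open>In direction \<open>k\<close> the box stops at p - 1, so that its front face is
    exactly the height p from which stage T starts.\<close>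
  define m where "m = (\<lambda>i::'d. if i = 1 then int p - r else if i = k then int p - 1 else w)"
  define s1 where "s1 = real_of_int (r' + 1) / real_of_int (int p - r + r' + 2)"
  have s1: "0 \<le> s1" "s1 \<le> 1/2" using r' r0 rp p by (auto simp: s1_def field_simps)
  have "KT * ((real_of_int ((0::(int, 'd) vec) $ k - l k + 1) / real_of_int (m k - l k + 2)) * exp (- (?d * (4 / real p) * real_of_int (m k - l k + 2)))
      * (\<Prod>i\<in>UNIV - {k}. if i = 1 then s1 else 1)) \<le> ?u 0"
  proof (rule box_crossing[OF _ d, where B="?B"])
    show "l i \<le> m i" for i using r0 r' w0 w2 rp p by (auto simp: l_def m_def)
    show "nbr_avg ?u x \<le> ?u x" if "\<And>i. l i \<le> x $ i \<and> x $ i \<le> m i" for x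
    proof (rule sup)
      show "x \<in> Q" unfolding Q_def
      proof safe
        fix i
        have "l i \<le> x $ i" "x $ i \<le> m i" using that by auto
        then show "(if i = 1 then - r else if i = k then w - int p else - int p) \<le> x $ i"
          "x $ i \<le> (if i = 1 then int N - r else if i = k then w + int p else int p)"
          using w2 w0 r' p by (auto simp: l_def m_def split: if_splits)
      qed
    qed
    show "KT \<le> ?u x" if "x \<notin> ?B" for x
    proof -
      have "KT \<le> 1"
      proof -
        define y where "y = (\<chi> i. if i = k then int p else 0)"
        have "KT \<le> ?u (y :: (int, 'd) vec)" by (rule stageT) (use k r' r0 rp w0 in \<open>auto simp: y_def\<close>)
        also have "\<dots> \<le> 1" unfolding reach_def by (rule prob_space.prob_le_1[OF prob_space_steps_M])
        finally show ?thesis .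
      qed
      then show ?thesis using out[OF that] by linarith
    qed
    show "KT \<le> ?u x" if "x $ k = m k + 1" "\<And>i. i \<noteq> k \<Longrightarrow> l i \<le> x $ i \<and> x $ i \<le> m i" for x
    proof (rule stageT)
      show "- r' \<le> x $ 1" "x $ 1 \<le> int p - r" using that(2)[of 1] k by (auto simp: l_def m_def)
      show "x $ k = int p" using that(1) k by (simp add: m_def)
      show "- w \<le> x $ i \<and> x $ i \<le> w" if "i \<noteq> 1" "i \<noteq> k" for i
        using \<open>\<And>i. i \<noteq> k \<Longrightarrow> l i \<le> x $ i \<and> x $ i \<le> m i\<close>[of i] that by (simp add: l_def m_def)
    qed
    show "l i \<le> (0::(int, 'd) vec) $ i \<and> (0::(int, 'd) vec) $ i \<le> m i" for i
      using r0 r' w0 w2 rp p by (auto simp: l_def m_def)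
    fix i :: 'd assume i: "i \<noteq> k"
    show "pi / real_of_int (m i - l i + 2) \<le> 4 / real p"
      using i w2 p rp r' by (intro b4) (auto simp: l_def m_def)
    show "0 \<le> (if i = 1 then s1 else 1) \<and> (if i = 1 then s1 else 1) \<le> sin (pi * real_of_int ((0::(int, 'd) vec) $ i - l i + 1) / real_of_int (m i - l i + 2))"
    proof (cases "i = 1")
      case True
      have "sin (pi * s1) = sin (pi * real_of_int ((0::(int, 'd) vec) $ i - l i + 1) / real_of_int (m i - l i + 2))"
        by (simp add: True s1_def l_def m_def)
      then show ?thesis using True s1 sin_half_le[OF s1] by simp
    next
      case False
      have "pi * real_of_int ((0::(int, 'd) vec) $ i - l i + 1) / real_of_int (m i - l i + 2) = pi / 2"
        using False i w0 by (simp add: l_def m_def field_simps)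
      then have "sin (pi * real_of_int ((0::(int, 'd) vec) $ i - l i + 1) / real_of_int (m i - l i + 2)) = 1"
        by (simp only: sin_pi_half)
      with False show ?thesis by (simp only:) simp
    qed
  qed (use KT0 in auto)
  moreover have "(1/2) ^ CARD('d) / 18432 * exp (- (12 * ?d)) * (real p / real N) ^ 3 * exp (- (12 * ?d * real N / real p))
    \<le> KT * ((real_of_int ((0::(int, 'd) vec) $ k - l k + 1) / real_of_int (m k - l k + 2)) * exp (- (?d * (4 / real p) * real_of_int (m k - l k + 2)))
      * (\<Prod>i\<in>UNIV - {k}. if i = 1 then s1 else 1))"
  proof -
    have pr: "(\<Prod>i\<in>UNIV - {k}. if i = 1 then s1 else 1) = s1"
      using k by (subst prod.remove[of _ 1]) auto
    define q where "q = real p / real N"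
    have q: "0 < q" using p by (simp add: q_def)
    have A: "q\<^sup>2 / 48 \<le> real_of_int (r + 1) / (2 * real (N + 2))"
    proof -
      have "q\<^sup>2 / 48 = (real p * real p) / (8 * real N) / (6 * real N)" by (simp add: q_def power2_eq_square)
      also have "\<dots> \<le> real_of_int (r + 1) / (6 * real N)"
        using r1 N1 by (intro divide_right_mono) (auto simp: field_simps)
      also have "\<dots> \<le> real_of_int (r + 1) / (2 * real (N + 2))"
        using N1 r0 by (intro divide_left_mono) auto
      finally show ?thesis .
    qed
    have Bq: "q / 96 \<le> s1"
    proof -
      have "(real p * real p) / (8 * real N) \<le> real_of_int (r + 1)"
        using r1 N1 by (auto simp: field_simps)
      moreover have "real_of_int (r + 1) \<le> real_of_int (2 * (r' + 1))"
        using r' unfolding of_int_le_iff by presburger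
      then have "real_of_int (r + 1) \<le> 2 * real_of_int (r' + 1)" by simp
      ultimately have "(real p * real p) / (8 * real N) \<le> 2 * real_of_int (r' + 1)" by linarith
      then have "(real p * real p) / (16 * real N) \<le> real_of_int (r' + 1)" by (simp add: field_simps)
      then have "(real p * real p) / (16 * real N) / (3 * real p) \<le> real_of_int (r' + 1) / (3 * real p)"
        by (intro divide_right_mono) auto
      also have "\<dots> \<le> s1" unfolding s1_def
        using r' r0 rp p by (intro divide_left_mono mult_pos_pos) auto
      finally have "q / 48 \<le> s1" using p by (simp add: q_def field_simps)
      then show ?thesis using q by simp
    qed
    have C: "1/4 \<le> real_of_int ((0::(int, 'd) vec) $ k - l k + 1) / real_of_int (m k - l k + 2)"
      using k w0 w2 p by (simp add: l_def m_def field_simps)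
    have E1: "exp (- (12 * ?d * real N / real p)) \<le> exp (- (?d * (4 / real p) * real (N + 2)))"
    proof -
      have "?d * (4 / real p) * real (N + 2) \<le> ?d * (4 / real p) * (3 * real N)"
        using N1 by (intro mult_left_mono) auto
      then show ?thesis by (simp add: field_simps)
    qed
    have E2: "exp (- (12 * ?d)) \<le> exp (- (?d * (4 / real p) * real_of_int (m k - l k + 2)))"
    proof -
      have "?d * (4 / real p) * real_of_int (m k - l k + 2) \<le> ?d * (4 / real p) * (3 * real p)"
        using k w0 p by (intro mult_left_mono) (auto simp: l_def m_def)
      then show ?thesis using p by simp
    qed
    have D: "(1/2::real) ^ CARD('d) \<le> (1/2) ^ (CARD('d) - 1)"
      by (rule power_decreasing) auto
    \<comment> \<open>18432 = 48 * 4 * 96, with the factors taken from \<open>A\<close>,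
      \<open>C\<close> and \<open>Bq\<close>.\<close>
    have "(1/2) ^ CARD('d) / 18432 * exp (- (12 * ?d)) * q ^ 3 * exp (- (12 * ?d * real N / real p))
      = ((q\<^sup>2 / 48) * exp (- (12 * ?d * real N / real p)) * (1/2) ^ CARD('d)) * ((1/4) * exp (- (12 * ?d)) * (q / 96))"
      by (simp add: power2_eq_square power3_eq_cube)
    also have "\<dots> \<le> KT * ((real_of_int ((0::(int, 'd) vec) $ k - l k + 1) / real_of_int (m k - l k + 2)) * exp (- (?d * (4 / real p) * real_of_int (m k - l k + 2))) * s1)"
      unfolding KT_def using q s1 r0 w0 w2 p k
      by (intro mult_mono A Bq C D E1 E2 mult_nonneg_nonneg divide_nonneg_nonneg) (auto simp: l_def m_def)
    finally show ?thesis unfolding pr q_def .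
  qed
  ultimately show ?thesis by linarith
qed

text \<open>A path confined to \<open>Q\<close> until it leaves the ball has its range in a
  translate of the rectangle, so monotonicity and translation invariance of \<open>cap\<close>
  apply. The factor (p/N)^3 is paid for by three more units of N/p in the exponent.\<close>

lemma cap_small_lower_bound:
  fixes N p :: nat
  assumes tr: "transient TYPE('d::{finite, one})" and oth: "\<exists>k :: 'd. k \<noteq> 1" and p: "1 \<le> p" "p \<le> N"
  shows "(1/2) ^ CARD('d) / 18432 * exp (- (12 * real CARD('d))) * exp (- ((12 * real CARD('d) + 3) * real N / real p))
    \<le> \<P>(\<omega> in srw (0 :: (int, 'd) vec). cap (visited (lattice_ball N) \<omega>) \<le> cap (rectangle N p :: ((int, 'd) vec) set))"
proof -
  interpret st: prob_space "steps_M :: (nat \<Rightarrow> (int, 'd) vec) measure"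
    by (rule prob_space_steps_M)
  let ?d = "real CARD('d)"
  obtain k :: 'd where k: "k \<noteq> 1" using oth by auto
  have d: "2 \<le> CARD('d)"
    using card_mono[of UNIV "{1, k}"] k by simp
  define r where "r = int (p\<^sup>2 div (8 * N))"
  define w where "w = int (p div 2)"
  define Q where "Q = {x :: (int, 'd) vec. \<forall>i. (if i = 1 then - r else if i = k then w - int p else - int p) \<le> x $ i \<and>
      x $ i \<le> (if i = 1 then int N - r else if i = k then w + int p else int p)}"
  define z :: "(int, 'd) vec" where "z = (\<chi> i. if i = 1 then - r else if i = k then w else 0)"
  have Q_eq: "Q = (\<lambda>x. x + z) ` rectangle N p"
  proof (rule set_eqI)
    fix x :: "(int, 'd) vec"
    have "x \<in> (\<lambda>x. x + z) ` rectangle N p \<longleftrightarrow> x - z \<in> rectangle N p"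
      by (auto simp: image_iff intro: bexI[of _ "x - z"])
    also have "\<dots> \<longleftrightarrow> x \<in> Q"
      unfolding Q_def rectangle_def z_def using k
      by (auto simp: split: if_splits)
    finally show "x \<in> Q \<longleftrightarrow> x \<in> (\<lambda>x. x + z) ` rectangle N p" by simp
  qed
  have finQ: "finite Q"
  proof -
    have "finite {x :: (int, 'd) vec. \<forall>i. x $ i \<in> {- r - int p - w..int N + w + int p}}"
      by (rule finite_subset[of _ "vec_lambda ` (UNIV \<rightarrow>\<^sub>E {- r - int p - w..int N + w + int p})"])
        (auto simp: image_iff PiE_iff intro!: bexI[of _ "vec_nth _"] finite_PiE)
    moreover have "Q \<subseteq> {x. \<forall>i. x $ i \<in> {- r - int p - w..int N + w + int p}}"
    proof safe
      fix x i assume "x \<in> Q"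
      then have "(if i = 1 then - r else if i = k then w - int p else - int p) \<le> x $ i"
        "x $ i \<le> (if i = 1 then int N - r else if i = k then w + int p else int p)"
        unfolding Q_def by auto
      moreover have "0 \<le> r" "0 \<le> w" by (auto simp: r_def w_def)
      ultimately show "x $ i \<in> {- r - int p - w..int N + w + int p}"
        by (auto split: if_splits)
    qed
    ultimately show ?thesis by (rule finite_subset[rotated])
  qed
  have "exp (- ((12 * ?d + 3) * real N / real p)) \<le> (real p / real N) ^ 3 * exp (- (12 * ?d * real N / real p))"
  proof -
    define q where "q = real N / real p"
    have q: "0 < q" using p by (simp add: q_def)
    have "q \<le> exp q" using exp_ge_add_one_self[of q] by linarith
    then have "exp (- q) \<le> 1 / q" using q by (simp add: exp_minus field_simps)
    then have "exp (- q) ^ 3 \<le> (1 / q) ^ 3" by (rule power_mono) simp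
    then have "exp (- (3 * q)) \<le> (1 / q) ^ 3" by (simp add: exp_of_nat_mult[symmetric])
    then have "exp (- (3 * q)) * exp (- (12 * ?d * q)) \<le> (1 / q) ^ 3 * exp (- (12 * ?d * q))"
      by (intro mult_right_mono) auto
    moreover have "exp (- ((12 * ?d + 3) * q)) = exp (- (3 * q)) * exp (- (12 * ?d * q))"
      by (simp add: exp_add[symmetric] algebra_simps)
    ultimately show ?thesis using p by (simp add: q_def)
  qed
  then have "(1/2) ^ CARD('d) / 18432 * exp (- (12 * ?d)) * exp (- ((12 * ?d + 3) * real N / real p))
     \<le> (1/2) ^ CARD('d) / 18432 * exp (- (12 * ?d)) * ((real p / real N) ^ 3 * exp (- (12 * ?d * real N / real p)))"
    by (intro mult_left_mono) auto
  also have "\<dots> \<le> reach (- lattice_ball N) Q 0"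
    using reach_rectangle[OF p k d] unfolding Q_def r_def w_def by (simp add: mult.assoc)
  also have "\<dots> \<le> \<P>(\<xi> in steps_M. cap (visited (lattice_ball N) (\<lambda>k. (0 :: (int, 'd) vec) + part \<xi> k)) \<le> cap (rectangle N p :: ((int, 'd) vec) set))"
    unfolding reach_def
  proof (rule st.finite_measure_mono)
    have "cap (visited (lattice_ball N) (\<lambda>k. (0 :: (int, 'd) vec) + part \<xi> k)) \<le> cap (rectangle N p :: ((int, 'd) vec) set)"
      if \<xi>: "0 + part \<xi> n \<in> - lattice_ball N" "\<forall>j<n. 0 + part \<xi> j \<in> Q" for \<xi> :: "nat \<Rightarrow> (int, 'd) vec" and n
    proof -
      have "visited (lattice_ball N) (\<lambda>k. 0 + part \<xi> k) \<subseteq> Q"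
        unfolding visited_eq using \<xi> by auto (metis not_le)
      then have "cap (visited (lattice_ball N) (\<lambda>k. (0 :: (int, 'd) vec) + part \<xi> k)) \<le> cap Q"
        by (rule transient.cap_mono[OF tr finQ])
      then show ?thesis unfolding Q_eq cap_translate .
    qed
    then show "{\<xi> \<in> space steps_M. \<exists>k. 0 + part \<xi> k \<in> - lattice_ball N \<and> (\<forall>j<k. 0 + part \<xi> j \<in> Q)}
      \<subseteq> {\<xi> \<in> space steps_M. cap (visited (lattice_ball N) (\<lambda>k. (0 :: (int, 'd) vec) + part \<xi> k)) \<le> cap (rectangle N p :: ((int, 'd) vec) set)}"
      by blast
    show "{\<xi> \<in> space steps_M. cap (visited (lattice_ball N) (\<lambda>k. (0 :: (int, 'd) vec) + part \<xi> k)) \<le> cap (rectangle N p :: ((int, 'd) vec) set)} \<in> sets steps_M"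
      using measurable_compose[OF measurable_walk[of 0] pred_visited[OF finite_lattice_ball, where P="\<lambda>A. cap A \<le> cap (rectangle N p :: ((int, 'd) vec) set)"]]
      by (simp add: pred_def)
  qed
  also have "\<dots> = \<P>(\<omega> in srw (0 :: (int, 'd) vec). cap (visited (lattice_ball N) \<omega>) \<le> cap (rectangle N p :: ((int, 'd) vec) set))"
    by (rule prob_srw[symmetric]) (rule pred_visited, rule finite_lattice_ball)
  finally show ?thesis .
qed

subsection \<open>Upper bound: pieces of the walk in disjoint shells\<close>

lemma AE_unit_steps: "AE \<xi> in (steps_M :: (nat \<Rightarrow> int ^ 'd) measure). \<forall>i. \<xi> i \<in> unit_steps"
proof -
  interpret st: prob_space "steps_M :: (nat \<Rightarrow> int ^ 'd) measure"
    by (rule prob_space_steps_M)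
  have "AE \<xi> in (steps_M :: (nat \<Rightarrow> int ^ 'd) measure). \<xi> i \<in> unit_steps" for i
    unfolding steps_M_def
    by (rule AE_PiM_component) (auto simp: AE_measure_pmf_iff intro: prob_space_measure_pmf)
  then show ?thesis by (simp add: AE_all_countable)
qed

lemma pred_norm_part [measurable]:
  "Measurable.pred steps_M (\<lambda>\<xi> :: nat \<Rightarrow> int ^ 'd. P (part \<xi> i) (part \<xi> j))"
proof -
  have "prefix_determined (i + j) (\<lambda>\<xi> :: nat \<Rightarrow> int ^ 'd. P (part \<xi> i) (part \<xi> j))"
    using prefix_determined_part[of i "i + j"] prefix_determined_part[of j "i + j"]
    unfolding prefix_determined_def by (metis le_add1 le_add2)
  then show ?thesis by (rule measurable_prefix_determined)
qed

text \<open>Doob's maximal inequality for the submartingale \<open>sqn\<close>, by induction on the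
  horizon with \<open>nbr_avg_sqn\<close>; for a start outside the ball the right side is at least
  1.\<close>

lemma exit_prob:
  fixes x :: "int ^ 'd"
  assumes L: "0 < L"
  shows "\<P>(\<xi> in steps_M. \<exists>i\<le>n. L < norm (rv (x + part \<xi> i))) \<le> (sqn x + real n) / L\<^sup>2"
proof (induction n arbitrary: x)
  interpret st: prob_space "steps_M :: (nat \<Rightarrow> int ^ 'd) measure"
    by (rule prob_space_steps_M)
  have out: "measure steps_M A \<le> (sqn x + real n) / L\<^sup>2" if "L < norm (rv x)" for A :: "(nat \<Rightarrow> int ^ 'd) set" and x :: "int ^ 'd" and n :: nat
  proof -
    have "L\<^sup>2 \<le> (norm (rv x))\<^sup>2" using that L by (intro power_mono) auto
    then have "1 \<le> (sqn x + real n) / L\<^sup>2" using L by (simp add: norm_rv_sq)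
    then show ?thesis using st.prob_le_1[of A] by linarith
  qed
  {
    case 0
    show ?case
    proof (cases "L < norm (rv x)")
      case False
      then show ?thesis by simp
    qed (rule out)
  next
    case (Suc n)
    show ?case
    proof (cases "L < norm (rv x)")
      case False
      have eq: "(\<exists>i\<le>Suc n. L < norm (rv (x + part \<xi> i))) \<longleftrightarrow> (\<exists>i\<le>n. L < norm (rv (x + part \<xi> (Suc i))))" for \<xi>
        using False by (metis Suc_le_mono add.right_neutral not0_implies_Suc part_0)
      have "\<P>(\<xi> in steps_M. \<exists>i\<le>Suc n. L < norm (rv (x + part \<xi> i)))
         = (\<Sum>s\<in>unit_steps. \<P>(\<xi> in steps_M. \<exists>i\<le>n. L < norm (rv ((x + s) + part \<xi> i)))) / real (card (unit_steps :: (int ^ 'd) set))"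
        unfolding eq by (subst prob_first_step) (auto simp: part_case_nat add.assoc)
      also have "\<dots> \<le> nbr_avg (\<lambda>x. (sqn x + real n) / L\<^sup>2) x"
        unfolding nbr_avg_def by (intro divide_right_mono sum_mono Suc.IH) auto
      also have "\<dots> = nbr_avg (\<lambda>x. (1 / L\<^sup>2) * (sqn x + real n)) x" by simp
      also have "\<dots> = (sqn x + real (Suc n)) / L\<^sup>2"
        unfolding nbr_avg_scale nbr_avg_add by (simp add: nbr_avg_sqn)
      finally show ?thesis .
    qed (rule out)
  }
qed

section \<open>Expected self-potential of a piece of the walk\<close>

context transient
begin

definition pot :: "nat \<Rightarrow> (nat \<Rightarrow> int ^ 'd) \<Rightarrow> nat \<Rightarrow> real" where
  "pot n \<zeta> i = (\<Sum>j<n. green (part \<zeta> i - part \<zeta> j))"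

lemma nn_integral_green_le:
  assumes "i \<le> j"
  shows "(\<integral>\<^sup>+\<zeta>. ennreal (green (part \<zeta> j - part \<zeta> i)) \<partial>(steps_M :: (nat \<Rightarrow> int ^ 'd) measure)) = ennreal ((nbr_avg ^^ (j - i)) green (0 :: int ^ 'd))"
proof -
  have "part \<zeta> j - part \<zeta> i = part (shift i \<zeta>) (j - i)" for \<zeta> :: "nat \<Rightarrow> int ^ 'd"
    using assms by (simp add: part_shift)
  then have "(\<integral>\<^sup>+\<zeta>. ennreal (green (part \<zeta> j - part \<zeta> i)) \<partial>(steps_M :: (nat \<Rightarrow> int ^ 'd) measure))
      = (\<integral>\<^sup>+\<zeta>. ennreal (green (part (shift i \<zeta>) (j - i))) \<partial>(steps_M :: (nat \<Rightarrow> int ^ 'd) measure))" by simp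
  also have "\<dots> = (\<integral>\<^sup>+\<zeta>. ennreal (green (part \<zeta> (j - i))) \<partial>distr steps_M (steps_M :: (nat \<Rightarrow> int ^ 'd) measure) (shift i))"
    by (rule nn_integral_distr[symmetric]) measurable
  also have "\<dots> = ennreal ((nbr_avg ^^ (j - i)) green (0 :: int ^ 'd))"
    using nn_integral_walk[of green "0 :: int ^ 'd" "j - i", OF green_nonneg] by (simp add: distr_shift)
  finally show ?thesis .
qed

text \<open>In law an increment depends only on the time gap, and around a given time each gap
  occurs at most twice; hence the factor 2.\<close>

lemma nn_integral_pot:
  "(\<integral>\<^sup>+\<zeta>. ennreal (\<Sum>i<n. pot n \<zeta> i) \<partial>steps_M) \<le> ennreal (real n * (2 * (\<Sum>k<n. (nbr_avg ^^ k) green (0 :: int ^ 'd))))"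
proof -
  define a where "a = (\<lambda>k. (nbr_avg ^^ k) green (0 :: int ^ 'd))"
  have a0: "0 \<le> a k" for k unfolding a_def by (rule nbr_avg_pow_nonneg) (rule green_nonneg)
  have [measurable]: "(\<lambda>\<zeta> :: nat \<Rightarrow> int ^ 'd. ennreal (green (part \<zeta> i - part \<zeta> j))) \<in> borel_measurable steps_M" for i j
  proof -
    have "prefix_determined (i + j) (\<lambda>\<zeta> :: nat \<Rightarrow> int ^ 'd. ennreal (green (part \<zeta> i - part \<zeta> j)))"
      using prefix_determined_part[of i "i + j"] prefix_determined_part[of j "i + j"]
      unfolding prefix_determined_def by (metis le_add1 le_add2)
    from measurable_compose[OF measurable_prefix_determined[OF this], of "\<lambda>x. x" borel] show ?thesis
      by simp
  qed
  have e: "(\<integral>\<^sup>+\<zeta>. ennreal (green (part \<zeta> i - part \<zeta> j)) \<partial>(steps_M :: (nat \<Rightarrow> int ^ 'd) measure)) = ennreal (a (if j \<le> i then i - j else j - i))" for i j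
    using nn_integral_green_le[of j i] nn_integral_green_le[of i j]
    by (auto simp: a_def green_commute[of "part _ i"])
  have s: "(\<Sum>j<n. a (if j \<le> i then i - j else j - i)) \<le> 2 * (\<Sum>k<n. a k)" if "i < n" for i
  proof -
    have "(\<Sum>j<n. a (if j \<le> i then i - j else j - i)) = (\<Sum>j\<le>i. a (i - j)) + (\<Sum>j\<in>{i<..<n}. a (j - i))"
    proof -
      have "{..<n} = {..i} \<union> {i<..<n}" using that by auto
      then show ?thesis by (simp add: sum.union_disjoint ivl_disj_int)
    qed
    also have "(\<Sum>j\<le>i. a (i - j)) = (\<Sum>k\<in>(\<lambda>j. i - j) ` {..i}. a k)"
      by (subst sum.reindex) (auto simp: inj_on_def)
    also have "\<dots> \<le> (\<Sum>k<n. a k)" using that by (intro sum_mono2 a0) auto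
    also have "(\<Sum>j\<in>{i<..<n}. a (j - i)) = (\<Sum>k\<in>(\<lambda>j. j - i) ` {i<..<n}. a k)"
      by (subst sum.reindex) (auto simp: inj_on_def)
    also have "\<dots> \<le> (\<Sum>k<n. a k)" by (intro sum_mono2 a0) auto
    finally show ?thesis by simp
  qed
  have "(\<integral>\<^sup>+\<zeta>. ennreal (\<Sum>i<n. pot n \<zeta> i) \<partial>steps_M) = (\<integral>\<^sup>+\<zeta>. (\<Sum>i<n. \<Sum>j<n. ennreal (green (part \<zeta> i - part \<zeta> j))) \<partial>(steps_M :: (nat \<Rightarrow> int ^ 'd) measure))"
    unfolding pot_def by (intro nn_integral_cong) (simp add: sum_ennreal[symmetric] green_nonneg sum_nonneg del: sum_ennreal)
  also have "\<dots> = (\<Sum>i<n. \<Sum>j<n. ennreal (a (if j \<le> i then i - j else j - i)))"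
    by (simp add: nn_integral_sum e)
  also have "\<dots> = ennreal (\<Sum>i<n. \<Sum>j<n. a (if j \<le> i then i - j else j - i))"
    by (simp add: sum_ennreal a0 sum_nonneg)
  also have "\<dots> \<le> ennreal (\<Sum>i<n. 2 * (\<Sum>k<n. a k))"
    by (intro ennreal_leI sum_mono s) auto
  finally show ?thesis by (simp add: a_def)
qed

end

text \<open>The overshoot bound \<open>R + 1\<close> is automatic for unit steps. Having it in the
  definition frees the pathwise lemmas from assumptions on the increments.\<close>

definition first_hit :: "real \<Rightarrow> nat \<Rightarrow> (nat \<Rightarrow> int ^ 'd) \<Rightarrow> bool" where
  "first_hit R k \<xi> \<longleftrightarrow> R \<le> norm (rv (part \<xi> k)) \<and> norm (rv (part \<xi> k)) \<le> R + 1 \<and> (\<forall>i<k. norm (rv (part \<xi> i)) < R)"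

lemma first_hit_unique: "first_hit R k \<xi> \<Longrightarrow> first_hit R l \<xi> \<Longrightarrow> k = l"
  unfolding first_hit_def by (metis linorder_neqE_nat not_le)

lemma part_cong: "(\<And>i. i < k \<Longrightarrow> \<xi> i = \<xi>' i) \<Longrightarrow> i \<le> k \<Longrightarrow> part \<xi> i = part \<xi>' i"
  by (auto simp: part_def intro!: sum.cong)

lemma first_hit_cong:
  assumes "\<And>i. i < k \<Longrightarrow> \<xi> i = \<xi>' i" "l \<le> k" "first_hit R l \<xi>"
  shows "first_hit R l \<xi>'"
proof -
  have "part \<xi> i = part \<xi>' i" if "i \<le> k" for i
    using part_cong[of k \<xi> \<xi>', OF assms(1) that] .
  then show ?thesis using assms(2,3) unfolding first_hit_def by auto
qed

text \<open>The probability of being in a fixed finite ball at time \<open>n\<close> tends to 0, so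
  almost surely the ball is left; the least exit time overshoots by at most one step.\<close>

lemma (in transient) AE_first_hit:
  assumes R: "0 < R"
  shows "AE \<xi> in (steps_M :: (nat \<Rightarrow> int ^ 'd) measure). \<exists>k. first_hit R k \<xi>"
proof -
  interpret st: prob_space "steps_M :: (nat \<Rightarrow> int ^ 'd) measure"
    by (rule prob_space_steps_M)
  define B where "B = {x :: int ^ 'd. norm (rv x) \<le> R}"
  have B: "finite B" unfolding B_def by (rule finite_norm_rv_le)
  let ?E = "{\<xi> :: nat \<Rightarrow> int ^ 'd. \<forall>k. part \<xi> k \<in> B}"
  have E: "?E \<in> sets steps_M" by (rule sets_Collect_steps) measurable
  have le: "measure steps_M ?E \<le> (\<Sum>z\<in>B. hk n (0 - z))" for n
  proof -
    have "measure steps_M ?E \<le> measure steps_M {\<xi>. 0 + part \<xi> n \<in> B}"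
      by (rule st.finite_measure_mono) (auto intro: sets_Collect_steps)
    also have "\<dots> = (\<Sum>z\<in>B. hk n (0 - z))"
      using prob_walk_in[of 0 n B] nbr_avg_pow_indicator[OF B, of n 0] by simp
    finally show ?thesis .
  qed
  have "(\<lambda>n. \<Sum>z\<in>B. hk n (0 - z)) \<longlonglongrightarrow> (\<Sum>z\<in>B. 0)"
    by (intro tendsto_sum summable_LIMSEQ_zero summable_hk)
  then have "measure steps_M ?E \<le> 0"
    by (intro LIMSEQ_le_const[of _ 0]) (use le in auto)
  then have "measure steps_M ?E = 0" by (simp add: antisym)
  then have "emeasure steps_M ?E = 0" by (simp add: st.emeasure_eq_measure)
  with E have "AE \<xi> in steps_M. \<xi> \<notin> ?E" by (intro AE_not_in) (simp add: null_sets_def)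
  with AE_unit_steps show ?thesis
  proof eventually_elim
    case (elim \<xi>)
    then have "\<exists>k. R \<le> norm (rv (part \<xi> k))" by (auto simp: B_def not_le intro: less_imp_le)
    define k where "k = (LEAST k. R \<le> norm (rv (part \<xi> k)))"
    have k: "R \<le> norm (rv (part \<xi> k))" unfolding k_def by (rule LeastI_ex) fact
    have lt: "norm (rv (part \<xi> i)) < R" if "i < k" for i
      using not_less_Least[of i "\<lambda>k. R \<le> norm (rv (part \<xi> k))"] that by (simp add: k_def)
    have "k \<noteq> 0" using k R by (intro notI) simp
    then obtain l where l: "k = Suc l" by (cases k) auto
    have "norm (rv (part \<xi> k)) \<le> norm (rv (part \<xi> l)) + norm (rv (\<xi> l))"
      unfolding l part_Suc rv_add by (rule norm_triangle_ineq)
    also have "\<dots> \<le> R + 1" using lt[of l] l norm_rv_unit_step[of "\<xi> l"] elim by simp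
    finally show ?case using k lt by (auto simp: first_hit_def)
  qed
qed

text \<open>Radii are multiples of \<open>4 * L\<close>; a piece has \<open>n\<close> steps and
  should stay within \<open>L\<close> of its start. \<open>K\<close> is the admissible potential at
  a time of the piece, and \<open>\<delta>\<close> the tolerated proportion both of heavy times in a
  piece and of bad shells.\<close>

locale shells = transient D for D :: "(int ^ 'd) itself" +
  fixes L K \<delta> :: real and n :: nat
  assumes L1: "1 \<le> L" and n1: "1 \<le> n" and K0: "0 < K" and \<delta>: "0 < \<delta>" "\<delta> < 1"
begin

definition light :: "(nat \<Rightarrow> int ^ 'd) \<Rightarrow> nat set" where
  "light \<zeta> = {i. i < n \<and> pot n \<zeta> i \<le> K}"

definition bad :: "(nat \<Rightarrow> int ^ 'd) \<Rightarrow> bool" where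
  "bad \<zeta> \<longleftrightarrow> (\<exists>i\<le>n. L < norm (rv (part \<zeta> i))) \<or> real (card (light \<zeta>)) < (1 - \<delta>) * real n"

definition bad_shell :: "nat \<Rightarrow> (nat \<Rightarrow> int ^ 'd) \<Rightarrow> bool" where
  "bad_shell j \<xi> \<longleftrightarrow> (\<exists>k. first_hit (4 * L * real j) k \<xi> \<and> bad (shift k \<xi>))"

lemma light_cong:
  assumes "\<And>i. i \<le> n \<Longrightarrow> part \<zeta> i = part \<zeta>' i"
  shows "light \<zeta> = light \<zeta>'"
proof -
  have "pot n \<zeta> i = pot n \<zeta>' i" if "i < n" for i
    unfolding pot_def using assms that by (intro sum.cong) auto
  then show ?thesis by (auto simp: light_def)
qed

lemma bad_cong:
  assumes "\<And>i. i \<le> n \<Longrightarrow> part \<zeta> i = part \<zeta>' i"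
  shows "bad \<zeta> = bad \<zeta>'"
  using light_cong[OF assms] assms by (auto simp: bad_def)

lemma prefix_determined_bad: "prefix_determined n bad"
  unfolding prefix_determined_def
proof (intro allI impI)
  fix \<xi> \<xi>' :: "nat \<Rightarrow> int ^ 'd" assume "\<forall>i<n. \<xi> i = \<xi>' i"
  then show "bad \<xi> = bad \<xi>'" by (intro bad_cong part_cong[of n]) auto
qed

lemma pred_bad [measurable]: "Measurable.pred steps_M bad"
  by (rule measurable_prefix_determined[OF prefix_determined_bad])

text \<open>Leaving the ball of radius \<open>L\<close> is \<open>exit_prob\<close>. Otherwise too
  few light times force a total potential of at least \<open>K * \<delta> * real n\<close>, and
  Markov's inequality applies.\<close>

lemma prob_bad:
  "\<P>(\<zeta> in steps_M. bad \<zeta>) \<le> real n / L\<^sup>2 + 2 * (\<Sum>k<n. (nbr_avg ^^ k) green (0 :: int ^ 'd)) / (K * \<delta>)"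
proof -
  interpret st: prob_space "steps_M :: (nat \<Rightarrow> int ^ 'd) measure"
    by (rule prob_space_steps_M)
  define \<Psi> where "\<Psi> = (\<Sum>k<n. (nbr_avg ^^ k) green (0 :: int ^ 'd))"
  have \<Psi>0: "0 \<le> \<Psi>" unfolding \<Psi>_def by (intro sum_nonneg nbr_avg_pow_nonneg green_nonneg)
  define F where "F = (\<lambda>\<zeta>. \<Sum>i<n. pot n \<zeta> i)"
  have pot0: "0 \<le> pot n \<zeta> i" for \<zeta> i unfolding pot_def by (intro sum_nonneg green_nonneg)
  have pF: "prefix_determined n F"
    unfolding prefix_determined_def F_def pot_def
    by (intro allI impI sum.cong refl arg_cong2[where f=minus] arg_cong[where f=green] part_cong[of n]) auto
  have [measurable]: "F \<in> borel_measurable steps_M"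
    using measurable_compose[OF measurable_prefix_determined[OF pF], of "\<lambda>x. x" borel] by simp
  let ?E1 = "{\<zeta> :: nat \<Rightarrow> int ^ 'd. \<exists>i\<le>n. L < norm (rv (0 + part \<zeta> i))}"
  let ?E2 = "{\<zeta>. K * \<delta> * real n \<le> F \<zeta>}"
  have heavy: "K * \<delta> * real n \<le> F \<zeta>" if "real (card (light \<zeta>)) < (1 - \<delta>) * real n" for \<zeta>
  proof -
    have lt: "light \<zeta> \<subseteq> {..<n}" by (auto simp: light_def)
    have "real (card ({..<n} - light \<zeta>)) = real n - real (card (light \<zeta>))"
      using lt card_mono[OF _ lt] by (simp add: card_Diff_subset finite_subset[OF lt] of_nat_diff)
    then have "\<delta> * real n \<le> real (card ({..<n} - light \<zeta>))"
      using that by (simp add: algebra_simps)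
    then have "K * (\<delta> * real n) \<le> K * real (card ({..<n} - light \<zeta>))"
      using K0 by (intro mult_left_mono) auto
    also have "\<dots> = (\<Sum>i\<in>{..<n} - light \<zeta>. K)" by simp
    also have "\<dots> \<le> (\<Sum>i\<in>{..<n} - light \<zeta>. pot n \<zeta> i)"
      by (intro sum_mono) (auto simp: light_def)
    also have "\<dots> \<le> F \<zeta>" unfolding F_def by (rule sum_mono2) (auto simp: pot0)
    finally show ?thesis by (simp add: mult.assoc)
  qed
  have p: "0 < K * \<delta> * real n" using K0 \<delta> n1 by simp
  have "emeasure steps_M ?E2 \<le> ennreal (2 * \<Psi> / (K * \<delta>))"
  proof -
    have "ennreal (K * \<delta> * real n) * emeasure steps_M ?E2 \<le> (\<integral>\<^sup>+\<zeta>. ennreal (F \<zeta>) \<partial>steps_M)"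
    proof -
      have "ennreal (K * \<delta> * real n) * emeasure steps_M ?E2 = (\<integral>\<^sup>+\<zeta>. ennreal (K * \<delta> * real n) * indicator ?E2 \<zeta> \<partial>steps_M)"
        by (subst nn_integral_cmult_indicator) (auto intro: sets_Collect_steps)
      also have "\<dots> \<le> (\<integral>\<^sup>+\<zeta>. ennreal (F \<zeta>) \<partial>steps_M)"
        by (intro nn_integral_mono) (auto simp: indicator_def intro: ennreal_leI)
      finally show ?thesis .
    qed
    also have "\<dots> \<le> ennreal (real n * (2 * \<Psi>))"
      using nn_integral_pot[of n] by (simp add: F_def \<Psi>_def)
    finally have "K * \<delta> * real n * measure steps_M ?E2 \<le> real n * (2 * \<Psi>)"
      using p \<Psi>0 by (simp add: st.emeasure_eq_measure ennreal_mult[symmetric])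
    then have "measure steps_M ?E2 \<le> 2 * \<Psi> / (K * \<delta>)"
      using n1 K0 \<delta> by (simp add: field_simps)
    then show ?thesis by (simp add: st.emeasure_eq_measure ennreal_leI)
  qed
  then have E2: "measure steps_M ?E2 \<le> 2 * \<Psi> / (K * \<delta>)"
    using \<Psi>0 K0 \<delta> by (simp add: st.emeasure_eq_measure)
  have E1: "measure steps_M ?E1 \<le> real n / L\<^sup>2"
    using exit_prob[of L n 0] L1 by simp
  have "measure steps_M {\<zeta>. bad \<zeta>} \<le> measure steps_M (?E1 \<union> ?E2)"
    by (rule st.finite_measure_mono) (auto simp: bad_def heavy intro!: sets_Collect_steps sets.Un)
  also have "\<dots> \<le> measure steps_M ?E1 + measure steps_M ?E2"
    by (rule measure_Un_le) (auto intro!: sets_Collect_steps)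
  finally show ?thesis using E1 E2 by (simp add: \<Psi>_def)
qed

text \<open>Radii differ by at least \<open>4 * L\<close> and a start overshoots by at most 1, so a
  piece displaced by at most \<open>L\<close> is still below the next radius, as
  \<open>1 + L < 4 * L\<close>.\<close>

lemma hit_order:
  assumes h: "first_hit (4 * L * real j) k \<xi>" and h': "first_hit (4 * L * real j') k' \<xi>" and j: "j < j'"
  shows "k < k'" and "\<And>i. k + i \<ge> k' \<Longrightarrow> (\<And>l. l \<le> i \<Longrightarrow> norm (rv (part \<xi> (k + l) - part \<xi> k)) \<le> L) \<Longrightarrow> False"
proof -
  have R: "4 * L * real j + 4 * L \<le> 4 * L * real j'"
  proof -
    have "4 * L * (real j + 1) \<le> 4 * L * real j'" using j L1 by (intro mult_left_mono) auto
    then show ?thesis by (simp add: algebra_simps)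
  qed
  have "\<not> k' < k" "k' \<noteq> k" using h h' R L1 unfolding first_hit_def by fastforce+
  then show kk: "k < k'" by simp
  fix i assume i: "k + i \<ge> k'" "\<And>l. l \<le> i \<Longrightarrow> norm (rv (part \<xi> (k + l) - part \<xi> k)) \<le> L"
  have "norm (rv (part \<xi> (k + (k' - k)) - part \<xi> k)) \<le> L" using i kk by (intro i(2)) auto
  then have "norm (rv (part \<xi> k') - rv (part \<xi> k)) \<le> L" using kk by (simp add: rv_diff)
  then have "norm (rv (part \<xi> k')) \<le> norm (rv (part \<xi> k)) + L"
    using norm_triangle_ineq2[of "rv (part \<xi> k')" "rv (part \<xi> k)"] by linarith
  then show False using h h' R L1 unfolding first_hit_def by linarith
qed

text \<open>
  Whether a piece is bad is decided before the walk reaches the next shell, because a piece that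
  has not been declared bad stays within distance \<open>L\<close> of its starting point.
\<close>

lemma bad_shell_cong:
  assumes eq: "\<And>i. i < k' \<Longrightarrow> \<xi> i = \<xi>' i" and h': "first_hit (4 * L * real j') k' \<xi>"
    and j: "j < j'" and b: "bad_shell j \<xi>"
  shows "bad_shell j \<xi>'"
proof -
  from b obtain k where h: "first_hit (4 * L * real j) k \<xi>" and bk: "bad (shift k \<xi>)"
    by (auto simp: bad_shell_def)
  note ho = hit_order[OF h h' j]
  have hk': "first_hit (4 * L * real j) k \<xi>'"
    by (rule first_hit_cong[OF eq _ h]) (use ho in auto)
  have agree: "part (shift k \<xi>) i = part (shift k \<xi>') i" if "k + i \<le> k'" for i
    using that part_cong[of k' \<xi> \<xi>', OF eq] by (simp add: part_shift)
  have "bad (shift k \<xi>')"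
  proof (cases "\<exists>i\<le>n. L < norm (rv (part (shift k \<xi>) i))")
    case True
    \<comment> \<open>At the first time of displacement beyond \<open>L\<close> the piece is
      declared bad. All earlier displacements are at most \<open>L\<close>, so this happens no later
      than \<open>k'\<close>, in the part shared by both paths.\<close>
    define i where "i = (LEAST i. i \<le> n \<and> L < norm (rv (part (shift k \<xi>) i)))"
    have i: "i \<le> n" "L < norm (rv (part (shift k \<xi>) i))"
      using LeastI_ex[OF True] by (auto simp: i_def)
    have lt: "norm (rv (part (shift k \<xi>) l)) \<le> L" if "l < i" for l
      using not_less_Least[of l "\<lambda>i. i \<le> n \<and> L < norm (rv (part (shift k \<xi>) i))"] that i(1) by (auto simp: i_def not_less)
    have "i \<noteq> 0" using i(2) L1 by (intro notI) simp
    have "k + i \<le> k'"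
    proof (rule ccontr)
      assume "\<not> k + i \<le> k'"
      then have "k + (i - 1) \<ge> k'" by simp
      then show False
      proof (rule ho(2))
        fix l assume "l \<le> i - 1"
        then show "norm (rv (part \<xi> (k + l) - part \<xi> k)) \<le> L"
          using lt[of l] \<open>i \<noteq> 0\<close> by (simp add: part_shift)
      qed
    qed
    then show ?thesis using i agree[of i] by (auto simp: bad_def)
  next
    case False
    have "k + n \<le> k'"
    proof (rule ccontr)
      assume "\<not> k + n \<le> k'"
      then have "k + n \<ge> k'" by simp
      then show False
        by (rule ho(2)) (use False in \<open>auto simp: part_shift not_less\<close>)
    qed
    then have "bad (shift k \<xi>) = bad (shift k \<xi>')" by (intro bad_cong agree) auto
    then show ?thesis using bk by simp
  qed
  with hk' show ?thesis by (auto simp: bad_shell_def)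
qed

lemma prefix_determined_shells:
  assumes "\<And>j. j \<in> J \<Longrightarrow> j < j'"
  shows "prefix_determined k' (\<lambda>\<xi>. first_hit (4 * L * real j') k' \<xi> \<and> (\<forall>j\<in>J. bad_shell j \<xi>))"
proof -
  have T: "first_hit (4 * L * real j') k' \<xi>' \<and> (\<forall>j\<in>J. bad_shell j \<xi>')"
    if "\<And>i. i < k' \<Longrightarrow> \<xi> i = \<xi>' i" "first_hit (4 * L * real j') k' \<xi> \<and> (\<forall>j\<in>J. bad_shell j \<xi>)" for \<xi> \<xi>'
    using first_hit_cong[of k' \<xi> \<xi>' k', OF that(1)] bad_shell_cong[of k' \<xi> \<xi>' j', OF that(1)] that(2) assms by blast
  show ?thesis
    unfolding prefix_determined_def
  proof (intro allI impI iffI)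
    fix \<xi> \<xi>' :: "nat \<Rightarrow> int ^ 'd" assume eq: "\<forall>i<k'. \<xi> i = \<xi>' i"
    show "first_hit (4 * L * real j') k' \<xi>' \<and> (\<forall>j\<in>J. bad_shell j \<xi>')"
      if "first_hit (4 * L * real j') k' \<xi> \<and> (\<forall>j\<in>J. bad_shell j \<xi>)"
      by (rule T[OF _ that]) (use eq in simp)
    show "first_hit (4 * L * real j') k' \<xi> \<and> (\<forall>j\<in>J. bad_shell j \<xi>)"
      if "first_hit (4 * L * real j') k' \<xi>' \<and> (\<forall>j\<in>J. bad_shell j \<xi>')"
      by (rule T[OF _ that]) (use eq in simp)
  qed
qed

lemma prefix_determined_first_hit: "prefix_determined k (first_hit R k)"
  unfolding prefix_determined_def using first_hit_cong by (metis order_refl)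

lemma pred_bad_shell [measurable]: "Measurable.pred steps_M (bad_shell j)"
proof -
  have [measurable]: "Measurable.pred steps_M (first_hit R k)" for R k
    by (rule measurable_prefix_determined[OF prefix_determined_first_hit])
  show ?thesis unfolding bad_shell_def by measurable
qed

text \<open>The outermost shell is peeled off: badness of the inner ones is settled when shell
  \<open>j'\<close> is hit, and the walk after that time is a fresh copy.\<close>

lemma prob_bad_shells:
  assumes "finite J" and \<epsilon>: "\<P>(\<zeta> in steps_M. bad \<zeta>) \<le> \<epsilon>"
  shows "\<P>(\<xi> in steps_M. \<forall>j\<in>J. bad_shell j \<xi>) \<le> \<epsilon> ^ card J"
  using assms(1)
proof (induction J rule: finite_linorder_max_induct)
  case empty
  show ?case using prob_space.prob_le_1[OF prob_space_steps_M] by simp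
next
  case (insert j' J)
  interpret st: prob_space "steps_M :: (nat \<Rightarrow> int ^ 'd) measure"
    by (rule prob_space_steps_M)
  have \<epsilon>0: "0 \<le> \<epsilon>" using \<epsilon> measure_nonneg order_trans by blast
  let ?A = "\<lambda>k \<xi>. first_hit (4 * L * real j') k \<xi> \<and> (\<forall>j\<in>J. bad_shell j \<xi>)"
  have "(\<forall>j\<in>insert j' J. bad_shell j \<xi>) \<longleftrightarrow> (\<exists>k. ?A k \<xi> \<and> bad (shift k \<xi>))" for \<xi>
    by (auto simp: bad_shell_def[of j'])
  then have "\<P>(\<xi> in steps_M. \<forall>j\<in>insert j' J. bad_shell j \<xi>) = \<P>(\<xi> in steps_M. \<exists>k. ?A k \<xi> \<and> bad (shift k \<xi>))"
    by simp
  also have "\<dots> \<le> \<P>(\<xi> in steps_M. \<exists>k. ?A k \<xi>) * \<P>(\<zeta> in steps_M. bad \<zeta>)"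
    by (rule prob_stopped_shift_le) (use insert.hyps in \<open>auto intro!: prefix_determined_shells dest: first_hit_unique\<close>)
  also have "\<dots> \<le> \<P>(\<xi> in steps_M. \<forall>j\<in>J. bad_shell j \<xi>) * \<P>(\<zeta> in steps_M. bad \<zeta>)"
  proof (intro mult_right_mono st.finite_measure_mono)
    show "{\<xi> \<in> space steps_M. \<forall>j\<in>J. bad_shell j \<xi>} \<in> st.events"
      using insert.hyps by (simp, intro sets_Collect_steps pred_intros_finite pred_bad_shell)
  qed auto
  also have "\<dots> \<le> \<epsilon> ^ card J * \<epsilon>"
    using insert.IH \<epsilon> \<epsilon>0 by (intro mult_mono) auto
  finally show ?case using insert.hyps by (subst card_insert_disjoint) (auto simp: mult.commute)
qed

text \<open>Union bound over subsets of \<open>{1..m}\<close>: at most 2^m of them, each of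
  probability at most exp(-2m), and 2 < exp 1. The exponent \<open>2 / \<delta>\<close> in the
  hypothesis is made for this.\<close>

lemma prob_many_bad:
  assumes \<epsilon>: "\<P>(\<zeta> in steps_M. bad \<zeta>) \<le> exp (- (2 / \<delta>))"
  shows "\<P>(\<xi> in steps_M. \<delta> * real m \<le> real (card {j\<in>{1..m}. bad_shell j \<xi>})) \<le> exp (- real m)"
proof -
  interpret st: prob_space "steps_M :: (nat \<Rightarrow> int ^ 'd) measure"
    by (rule prob_space_steps_M)
  define \<J> where "\<J> = {J. J \<subseteq> {1..m} \<and> \<delta> * real m \<le> real (card J)}"
  have fin: "finite \<J>" unfolding \<J>_def by simp
  have cardJ: "real (card \<J>) \<le> 2 ^ m"
  proof -
    have "card \<J> \<le> card (Pow {1..m})" unfolding \<J>_def by (intro card_mono) auto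
    then have "card \<J> \<le> 2 ^ m" by (simp add: card_Pow)
    then have "real (card \<J>) \<le> real (2 ^ m)" by (simp only: of_nat_le_iff)
    then show ?thesis by simp
  qed
  have "\<P>(\<xi> in steps_M. \<delta> * real m \<le> real (card {j\<in>{1..m}. bad_shell j \<xi>}))
     \<le> measure steps_M (\<Union>J\<in>\<J>. {\<xi>. \<forall>j\<in>J. bad_shell j \<xi>})"
  proof (rule st.finite_measure_mono)
    show "{\<xi> \<in> space steps_M. \<delta> * real m \<le> real (card {j\<in>{1..m}. bad_shell j \<xi>})} \<subseteq> (\<Union>J\<in>\<J>. {\<xi>. \<forall>j\<in>J. bad_shell j \<xi>})"
    proof
      fix \<xi> assume "\<xi> \<in> {\<xi> \<in> space steps_M. \<delta> * real m \<le> real (card {j\<in>{1..m}. bad_shell j \<xi>})}"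
      then have "{j\<in>{1..m}. bad_shell j \<xi>} \<in> \<J>" by (auto simp: \<J>_def)
      then show "\<xi> \<in> (\<Union>J\<in>\<J>. {\<xi>. \<forall>j\<in>J. bad_shell j \<xi>})" by (intro UN_I) auto
    qed
    show "(\<Union>J\<in>\<J>. {\<xi>. \<forall>j\<in>J. bad_shell j \<xi>}) \<in> st.events"
      using fin by (intro sets.finite_UN sets_Collect_steps pred_intros_finite pred_bad_shell)
        (auto simp: \<J>_def intro: finite_subset)
  qed
  also have "\<dots> \<le> (\<Sum>J\<in>\<J>. measure steps_M {\<xi>. \<forall>j\<in>J. bad_shell j \<xi>})"
    using fin by (intro measure_UNION_le sets_Collect_steps pred_intros_finite pred_bad_shell)
      (auto simp: \<J>_def intro: finite_subset)
  also have "\<dots> \<le> (\<Sum>J\<in>\<J>. exp (- 2 * real m))"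
  proof (rule sum_mono)
    fix J assume J: "J \<in> \<J>"
    then have "finite J" "\<delta> * real m \<le> real (card J)" by (auto simp: \<J>_def intro: finite_subset)
    have "measure steps_M {\<xi>. \<forall>j\<in>J. bad_shell j \<xi>} \<le> exp (- (2 / \<delta>)) ^ card J"
      using prob_bad_shells[OF \<open>finite J\<close> \<epsilon>] by simp
    also have "\<dots> = exp (- (2 / \<delta>) * real (card J))" by (simp add: exp_of_nat_mult[symmetric] mult.commute)
    also have "\<dots> \<le> exp (- 2 * real m)"
      using mult_left_mono[OF \<open>\<delta> * real m \<le> real (card J)\<close>, of "2 / \<delta>"] \<delta> by simp
    finally show "measure steps_M {\<xi>. \<forall>j\<in>J. bad_shell j \<xi>} \<le> exp (- 2 * real m)" .
  qed
  also have "\<dots> = real (card \<J>) * exp (- 2 * real m)" by simp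
  also have "\<dots> \<le> exp (real m) * exp (- 2 * real m)"
  proof (rule mult_right_mono)
    have "(2 :: real) ^ m \<le> exp 1 ^ m" using exp_ge_add_one_self[of 1] by (intro power_mono) auto
    also have "\<dots> = exp (real m)" by (simp add: exp_of_nat_mult[symmetric])
    finally show "real (card \<J>) \<le> exp (real m)" using cardJ by linarith
  qed simp
  also have "\<dots> = exp (- real m)" by (simp add: exp_add[symmetric])
  finally show ?thesis .
qed

end

section \<open>Capacity of the range from the good pieces\<close>

context shells
begin

text \<open>\<open>cap_lower\<close> is fed with the light times of the good pieces. At such a time
  the own piece contributes at most \<open>K\<close>, a piece \<open>a\<close> shells away at most
  \<open>n * \<gamma> a\<close>, and each \<open>a\<close> occurs at most once on either
  side.\<close>

lemma cap_good:
  assumes hits: "\<And>j. j \<in> {1..m} \<Longrightarrow> \<exists>k. first_hit (4 * L * real j) k \<xi>"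
    and few: "real (card {j\<in>{1..m}. bad_shell j \<xi>}) < \<delta> * real m"
    and \<gamma>0: "\<And>i. 0 \<le> \<gamma> i"
    and \<gamma>: "\<And>i (x :: int ^ 'd). 1 \<le> i \<Longrightarrow> 4 * L * (real i - 3/4) \<le> norm (rv x) \<Longrightarrow> green x \<le> \<gamma> i"
    and N: "4 * L * real m + L + 1 \<le> real N"
  shows "2 * real CARD('d) * ((1 - \<delta>)\<^sup>2 * real m * real n / (K + 2 * real n * (\<Sum>i\<in>{1..m}. \<gamma> i)))
    \<le> cap (visited (lattice_ball N) (\<lambda>k. 0 + part \<xi> k))"
proof -
  define \<tau> where "\<tau> = (\<lambda>j. SOME k. first_hit (4 * L * real j) k \<xi>)"
  have \<tau>: "first_hit (4 * L * real j) (\<tau> j) \<xi>" if "j \<in> {1..m}" for j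
    unfolding \<tau>_def using hits[OF that] by (rule someI_ex)
  define J where "J = {j\<in>{1..m}. \<not> bad_shell j \<xi>}"
  have J: "finite J" "J \<subseteq> {1..m}" by (auto simp: J_def)
  have good: "\<not> bad (shift (\<tau> j) \<xi>)" if "j \<in> J" for j
    using that \<tau>[of j] by (auto simp: J_def bad_shell_def)
  define ls where "ls = (\<lambda>j. light (shift (\<tau> j) \<xi>))"
  have ls: "finite (ls j)" "ls j \<subseteq> {..<n}" for j by (auto simp: ls_def light_def)
  have card_ls: "(1 - \<delta>) * real n \<le> real (card (ls j))" if "j \<in> J" for j
    using good[OF that] by (auto simp: bad_def ls_def)
  define y where "y = (\<lambda>(j, i). part \<xi> (\<tau> j + i))"
  have disp: "norm (rv (part \<xi> (\<tau> j + i) - part \<xi> (\<tau> j))) \<le> L" if "j \<in> J" "i \<le> n" for i j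
    using good[OF that(1)] that(2) by (auto simp: bad_def part_shift not_less)
  have pos: "4 * L * real j - L \<le> norm (rv (part \<xi> (\<tau> j + i)))" "norm (rv (part \<xi> (\<tau> j + i))) \<le> 4 * L * real j + 1 + L"
    if "j \<in> J" "i \<le> n" for i j
  proof -
    have h: "4 * L * real j \<le> norm (rv (part \<xi> (\<tau> j)))" "norm (rv (part \<xi> (\<tau> j))) \<le> 4 * L * real j + 1"
      using \<tau>[of j] that J(2) by (auto simp: first_hit_def)
    have "norm (rv (part \<xi> (\<tau> j + i)) - rv (part \<xi> (\<tau> j))) \<le> L" using disp[OF that] by (simp add: rv_diff)
    then show "4 * L * real j - L \<le> norm (rv (part \<xi> (\<tau> j + i)))" "norm (rv (part \<xi> (\<tau> j + i))) \<le> 4 * L * real j + 1 + L"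
      using h norm_triangle_ineq2[of "rv (part \<xi> (\<tau> j + i))" "rv (part \<xi> (\<tau> j))"]
        norm_triangle_ineq3[of "rv (part \<xi> (\<tau> j + i))" "rv (part \<xi> (\<tau> j))"] by linarith+
  qed
  have le_m: "4 * L * real j \<le> 4 * L * real m" if "j \<in> J" for j
    using that J(2) L1 by (intro mult_left_mono) auto
  define I where "I = Sigma J ls"
  have fin: "finite I" unfolding I_def using J ls by (intro finite_SigmaI) auto
  define \<beta> where "\<beta> = K + 2 * real n * (\<Sum>i\<in>{1..m}. \<gamma> i)"
  have \<beta>: "0 < \<beta>" unfolding \<beta>_def using K0 \<gamma>0 by (intro add_pos_nonneg mult_nonneg_nonneg sum_nonneg) auto
  let ?V = "visited (lattice_ball N) (\<lambda>k. 0 + part \<xi> k)"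
  have "real (card I) / \<beta> \<le> (\<Sum>x\<in>?V. esc ?V x)"
  proof (rule cap_lower[OF _ fin _ \<beta>])
    show "finite ?V" by (rule finite_subset[OF visited_subset]) simp
    show "y ` I \<subseteq> ?V"
    proof clarify
      fix j i assume ji: "(j, i) \<in> I"
      then have j: "j \<in> J" "i < n" using ls(2)[of j] by (auto simp: I_def)
      have "norm (rv (part \<xi> l)) \<le> real N" if "l \<le> \<tau> j + i" for l
      proof (cases "l < \<tau> j")
        case True
        then have "norm (rv (part \<xi> l)) < 4 * L * real j" using \<tau>[of j] j J(2) by (auto simp: first_hit_def)
        then show ?thesis using le_m[OF j(1)] N L1 by linarith
      next
        case False
        then obtain i' where i': "l = \<tau> j + i'" by (metis le_Suc_ex not_less)
        then have "i' \<le> n" using that j by simp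
        from pos(2)[OF j(1) this] show ?thesis using le_m[OF j(1)] N unfolding i' by linarith
      qed
      then show "y (j, i) \<in> ?V"
        unfolding visited_eq y_def by (auto simp: lattice_ball_eq)
    qed
    fix ji assume ji: "ji \<in> I"
    obtain j i where ji_eq: "ji = (j, i)" by (cases ji)
    then have j: "j \<in> J" and i: "i \<in> ls j" using ji by (auto simp: I_def)
    have in_n: "i < n" using i ls(2) by auto
    have jm: "1 \<le> j" "j \<le> m" using j J(2) by auto
    have "(\<Sum>z\<in>I. green (y ji - y z)) = (\<Sum>j'\<in>J. \<Sum>i'\<in>ls j'. green (y (j, i) - y (j', i')))"
      unfolding I_def ji_eq using J ls by (subst sum.Sigma) (auto simp: split_def)
    also have "\<dots> = (\<Sum>i'\<in>ls j. green (y (j, i) - y (j, i'))) + (\<Sum>j'\<in>J - {j}. \<Sum>i'\<in>ls j'. green (y (j, i) - y (j', i')))"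
      using j J by (intro sum.remove) auto
    also have "\<dots> \<le> K + (\<Sum>j'\<in>J - {j}. real n * \<gamma> (if j' \<le> j then j - j' else j' - j))"
    proof (intro add_mono sum_mono)
      let ?\<zeta> = "shift (\<tau> j) \<xi>"
      have "(\<Sum>i'\<in>ls j. green (y (j, i) - y (j, i'))) = (\<Sum>i'\<in>ls j. green (part ?\<zeta> i - part ?\<zeta> i'))"
        by (simp add: y_def part_shift)
      also have "\<dots> \<le> pot n ?\<zeta> i"
        unfolding pot_def using ls[of j] by (intro sum_mono2) (auto simp: green_nonneg)
      also have "\<dots> \<le> K" using i by (simp add: ls_def light_def)
      finally show "(\<Sum>i'\<in>ls j. green (y (j, i) - y (j, i'))) \<le> K" .
    next
      fix j' assume j': "j' \<in> J - {j}"
      define a where "a = (if j' \<le> j then j - j' else j' - j)"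
      have a: "1 \<le> a" "real a = \<bar>real j - real j'\<bar>" using j' by (auto simp: a_def)
      have "green (y (j, i) - y (j', i')) \<le> \<gamma> a" if "i' \<in> ls j'" for i'
      proof (rule \<gamma>[OF a(1)])
        have i'n: "i' \<le> n" using that ls(2)[of j'] by auto
        let ?u = "rv (part \<xi> (\<tau> j + i))" and ?v = "rv (part \<xi> (\<tau> j' + i'))"
        note p = pos[OF j, of i] pos[of j' i']
        \<comment> \<open>Two displacements and the overshoot cost at most 2L + 1 \<le> 3L, a
          quarter short of a full spacing; hence the 3/4.\<close>
        have "4 * L * real a = \<bar>4 * L * real j - 4 * L * real j'\<bar>"
          unfolding a(2) using L1 by (simp add: abs_mult right_diff_distrib[symmetric])
        also have "\<dots> \<le> \<bar>norm ?u - norm ?v\<bar> + 2 * L + 1"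
          using p in_n i'n j' by auto
        also have "\<bar>norm ?u - norm ?v\<bar> \<le> norm (?u - ?v)" by (rule norm_triangle_ineq3)
        finally show "4 * L * (real a - 3/4) \<le> norm (rv (y (j, i) - y (j', i')))"
          using L1 by (simp add: y_def rv_diff algebra_simps)
      qed
      then have "(\<Sum>i'\<in>ls j'. green (y (j, i) - y (j', i'))) \<le> (\<Sum>i'\<in>ls j'. \<gamma> a)"
        by (rule sum_mono)
      also have "\<dots> \<le> real n * \<gamma> a"
        using \<gamma>0[of a] card_mono[OF _ ls(2)[of j']] by (simp add: mult_right_mono)
      finally show "(\<Sum>i'\<in>ls j'. green (y (j, i) - y (j', i'))) \<le> real n * \<gamma> a" .
    qed
    also have "(\<Sum>j'\<in>J - {j}. real n * \<gamma> (if j' \<le> j then j - j' else j' - j)) \<le> (\<Sum>j'\<in>{1..m} - {j}. real n * \<gamma> (if j' \<le> j then j - j' else j' - j))"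
      using J \<gamma>0 by (intro sum_mono2) auto
    also have "\<dots> = (\<Sum>j'\<in>{1..<j}. real n * \<gamma> (j - j')) + (\<Sum>j'\<in>{j<..m}. real n * \<gamma> (j' - j))"
    proof -
      have eq: "{1..m} - {j} = {1..<j} \<union> {j<..m}" using j J(2) by auto
      show ?thesis
        unfolding eq by (subst sum.union_disjoint) (auto intro!: arg_cong2[where f="(+)"] sum.cong)
    qed
    also have "(\<Sum>j'\<in>{1..<j}. real n * \<gamma> (j - j')) = (\<Sum>i\<in>(\<lambda>j'. j - j') ` {1..<j}. real n * \<gamma> i)"
      by (subst sum.reindex) (auto simp: inj_on_def)
    also have "\<dots> \<le> (\<Sum>i\<in>{1..m}. real n * \<gamma> i)"
      using jm \<gamma>0 by (intro sum_mono2) auto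
    also have "(\<Sum>j'\<in>{j<..m}. real n * \<gamma> (j' - j)) = (\<Sum>i\<in>(\<lambda>j'. j' - j) ` {j<..m}. real n * \<gamma> i)"
      by (subst sum.reindex) (auto simp: inj_on_def)
    also have "\<dots> \<le> (\<Sum>i\<in>{1..m}. real n * \<gamma> i)"
      using jm \<gamma>0 by (intro sum_mono2) auto
    finally show "(\<Sum>z\<in>I. green (y ji - y z)) \<le> \<beta>"
      by (simp add: \<beta>_def sum_distrib_left[symmetric])
  qed
  \<comment> \<open>One factor \<open>1 - \<delta>\<close> is lost in the number of pieces, the
    other in the number of times within a piece.\<close>
  moreover have "(1 - \<delta>)\<^sup>2 * real m * real n \<le> real (card I)"
  proof -
    have "{1..m} = J \<union> {j\<in>{1..m}. bad_shell j \<xi>}" by (auto simp: J_def)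
    then have "card {1..m} \<le> card J + card {j\<in>{1..m}. bad_shell j \<xi>}" by (metis card_Un_le)
    then have "real m \<le> real (card J) + real (card {j\<in>{1..m}. bad_shell j \<xi>})" by simp
    then have cJ: "(1 - \<delta>) * real m \<le> real (card J)" using few by (simp add: algebra_simps)
    have "(1 - \<delta>)\<^sup>2 * real m * real n = ((1 - \<delta>) * real m) * ((1 - \<delta>) * real n)"
      by (simp add: power2_eq_square)
    also have "\<dots> \<le> real (card J) * ((1 - \<delta>) * real n)"
      using cJ \<delta> by (intro mult_right_mono) auto
    also have "\<dots> = (\<Sum>j\<in>J. (1 - \<delta>) * real n)" by simp
    also have "\<dots> \<le> (\<Sum>j\<in>J. real (card (ls j)))" by (intro sum_mono card_ls)
    also have "\<dots> = real (card I)" unfolding I_def using J ls by (subst card_SigmaI) auto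
    finally show ?thesis .
  qed
  ultimately have "(1 - \<delta>)\<^sup>2 * real m * real n / \<beta> \<le> (\<Sum>x\<in>?V. esc ?V x)"
    using \<beta> by (meson divide_right_mono less_imp_le order_trans)
  then show ?thesis
    unfolding cap_eq_esc \<beta>_def by (intro mult_left_mono) auto
qed

text \<open>Almost surely all shells are hit; then a capacity below the threshold of
  \<open>cap_good\<close> can only come from a proportion \<open>\<delta>\<close> of bad
  shells.\<close>

lemma prob_cap_small:
  assumes \<epsilon>: "\<P>(\<zeta> in steps_M. bad \<zeta>) \<le> exp (- (2 / \<delta>))"
    and \<gamma>0: "\<And>i. 0 \<le> \<gamma> i"
    and \<gamma>: "\<And>i (x :: int ^ 'd). 1 \<le> i \<Longrightarrow> 4 * L * (real i - 3/4) \<le> norm (rv x) \<Longrightarrow> green x \<le> \<gamma> i"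
    and N: "4 * L * real m + L + 1 \<le> real N"
    and t: "t < 2 * real CARD('d) * ((1 - \<delta>)\<^sup>2 * real m * real n / (K + 2 * real n * (\<Sum>i\<in>{1..m}. \<gamma> i)))"
  shows "\<P>(\<omega> in srw (0 :: int ^ 'd). cap (visited (lattice_ball N) \<omega>) \<le> t) \<le> exp (- real m)"
proof -
  interpret st: prob_space "steps_M :: (nat \<Rightarrow> int ^ 'd) measure"
    by (rule prob_space_steps_M)
  have "\<P>(\<omega> in srw (0 :: int ^ 'd). cap (visited (lattice_ball N) \<omega>) \<le> t)
      = \<P>(\<xi> in steps_M. cap (visited (lattice_ball N) (\<lambda>k. (0 :: int ^ 'd) + part \<xi> k)) \<le> t)"
    by (rule prob_srw) (rule pred_visited, rule finite_lattice_ball)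
  also have "\<dots> \<le> \<P>(\<xi> in steps_M. \<delta> * real m \<le> real (card {j\<in>{1..m}. bad_shell j \<xi>}))"
  proof (rule st.finite_measure_mono_AE)
    have "AE \<xi> in (steps_M :: (nat \<Rightarrow> int ^ 'd) measure). \<forall>j\<in>{1..m}. \<exists>k. first_hit (4 * L * real j) k \<xi>"
      using L1 by (intro AE_finite_allI AE_first_hit) auto
    then show "AE \<xi> in steps_M. \<xi> \<in> {\<xi> \<in> space steps_M. cap (visited (lattice_ball N) (\<lambda>k. (0 :: int ^ 'd) + part \<xi> k)) \<le> t}
        \<longrightarrow> \<xi> \<in> {\<xi> \<in> space steps_M. \<delta> * real m \<le> real (card {j\<in>{1..m}. bad_shell j \<xi>})}"
    proof eventually_elim
      case (elim \<xi>)
      show ?case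
      proof (rule ccontr)
        assume "\<not> ?thesis"
        then have c: "cap (visited (lattice_ball N) (\<lambda>k. 0 + part \<xi> k)) \<le> t"
          and f: "real (card {j\<in>{1..m}. bad_shell j \<xi>}) < \<delta> * real m" by auto
        from cap_good[of m \<xi> \<gamma> N, OF _ f \<gamma>0 \<gamma> N] elim c t show False by force
      qed
    qed
    have "\<delta> * real m \<le> real (card {j\<in>{1..m}. bad_shell j \<xi>})
        \<longleftrightarrow> (\<exists>J\<in>{J. J \<subseteq> {1..m} \<and> \<delta> * real m \<le> real (card J)}. \<forall>j\<in>J. bad_shell j \<xi>)" for \<xi>
    proof
      assume "\<delta> * real m \<le> real (card {j\<in>{1..m}. bad_shell j \<xi>})"
      then show "\<exists>J\<in>{J. J \<subseteq> {1..m} \<and> \<delta> * real m \<le> real (card J)}. \<forall>j\<in>J. bad_shell j \<xi>"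
        by (intro bexI[of _ "{j\<in>{1..m}. bad_shell j \<xi>}"]) auto
    next
      assume "\<exists>J\<in>{J. J \<subseteq> {1..m} \<and> \<delta> * real m \<le> real (card J)}. \<forall>j\<in>J. bad_shell j \<xi>"
      then obtain J where J: "J \<subseteq> {j\<in>{1..m}. bad_shell j \<xi>}" "\<delta> * real m \<le> real (card J)" by blast
      have "card J \<le> card {j\<in>{1..m}. bad_shell j \<xi>}" by (rule card_mono[OF _ J(1)]) simp
      then show "\<delta> * real m \<le> real (card {j\<in>{1..m}. bad_shell j \<xi>})" using J(2) by linarith
    qed
    moreover have "{\<xi>. \<exists>J\<in>{J. J \<subseteq> {1..m} \<and> \<delta> * real m \<le> real (card J)}. \<forall>j\<in>J. bad_shell j \<xi>} \<in> st.events"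
      by (intro sets_Collect_steps pred_intros_finite pred_bad_shell) (auto intro: finite_subset)
    ultimately show "{\<xi> \<in> space steps_M. \<delta> * real m \<le> real (card {j\<in>{1..m}. bad_shell j \<xi>})} \<in> st.events"
      by simp
  qed
  also have "\<dots> \<le> exp (- real m)" by (rule prob_many_bad[OF \<epsilon>])
  finally show ?thesis .
qed

end

text \<open>Both the Green potential of the ball and \<open>(real p)\<^sup>2 - sqn x\<close> drop by
  1 under averaging inside the ball, and the latter is nonpositive outside; the maximum principle
  compares them at the origin.\<close>

lemma (in transient) sum_green_ball:
  "(real p)\<^sup>2 \<le> (\<Sum>z\<in>{z :: int ^ 'd. norm (rv z) \<le> real p}. green z)"
proof -
  define B where "B = {z :: int ^ 'd. norm (rv z) \<le> real p}"
  have B: "finite B" unfolding B_def by (rule finite_norm_rv_le)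
  define f where "f = (\<lambda>x. \<Sum>z\<in>B. green (x - z))"
  define v where "v = (\<lambda>x. ((real p)\<^sup>2 - sqn x) - f x)"
  have "v 0 \<le> 0"
  proof (rule max_principle[OF B])
    show "0 \<in> B" by (simp add: B_def)
    fix x assume x: "x \<in> B"
    have "nbr_avg f x = f x - 1"
    proof -
      have "nbr_avg f x = (\<Sum>z\<in>B. green (x - z) - indicator {0} (x - z))"
        unfolding f_def nbr_avg_sum nbr_avg_translate nbr_avg_green ..
      also have "\<dots> = f x - (\<Sum>z\<in>B. indicator {x} z)"
        unfolding f_def sum_subtractf by (intro arg_cong2[where f=minus] sum.cong) (auto simp: indicator_def)
      also have "(\<Sum>z\<in>B. indicator {x} z) = (1 :: real)"
        using x B by (simp add: indicator_def sum.delta if_distrib cong: if_cong)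
      finally show ?thesis .
    qed
    moreover have "nbr_avg v x = ((real p)\<^sup>2 - (sqn x + 1)) - nbr_avg f x"
      unfolding v_def nbr_avg_diff by (simp add: nbr_avg_sqn)
    ultimately show "v x \<le> nbr_avg v x" by (simp add: v_def)
  next
    fix x s :: "int ^ 'd" assume "x + s \<notin> B"
    then have "(real p)\<^sup>2 \<le> (norm (rv (x + s)))\<^sup>2" unfolding B_def by (intro power_mono) auto
    moreover have "0 \<le> f (x + s)" unfolding f_def by (intro sum_nonneg green_nonneg)
    ultimately show "v (x + s) \<le> 0" by (simp add: v_def norm_rv_sq)
  qed
  moreover have "f 0 = (\<Sum>z\<in>B. green z)"
    unfolding f_def by (intro sum.cong) (auto simp: green_minus)
  ultimately show ?thesis by (simp add: v_def B_def)
qed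

lemma card_vec_box:
  fixes l m :: "'d::finite \<Rightarrow> int"
  shows "finite {x :: (int, 'd) vec. \<forall>i. l i \<le> x $ i \<and> x $ i \<le> m i}"
    and "card {x :: (int, 'd) vec. \<forall>i. l i \<le> x $ i \<and> x $ i \<le> m i} \<le> (\<Prod>i\<in>UNIV. nat (m i - l i + 1))"
proof -
  have eq: "{x :: (int, 'd) vec. \<forall>i. l i \<le> x $ i \<and> x $ i \<le> m i} = vec_lambda ` (\<Pi>\<^sub>E i\<in>UNIV. {l i..m i})"
    by (auto simp: image_iff PiE_iff intro!: bexI[of _ "vec_nth _"])
  have fin: "finite (\<Pi>\<^sub>E i\<in>UNIV. {l i..m i})" by (auto intro: finite_PiE)
  show "finite {x :: (int, 'd) vec. \<forall>i. l i \<le> x $ i \<and> x $ i \<le> m i}" unfolding eq using fin by simp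
  have "card (vec_lambda ` (\<Pi>\<^sub>E i\<in>UNIV. {l i..m i})) \<le> card (\<Pi>\<^sub>E i\<in>UNIV. {l i..m i})"
    by (rule card_image_le[OF fin])
  also have "\<dots> = (\<Prod>i\<in>UNIV. nat (m i - l i + 1))"
    by (subst card_PiE) (auto simp: algebra_simps)
  finally show "card {x :: (int, 'd) vec. \<forall>i. l i \<le> x $ i \<and> x $ i \<le> m i} \<le> (\<Prod>i\<in>UNIV. nat (m i - l i + 1))"
    unfolding eq .
qed

lemma rectangle_eq:
  "rectangle N p = {x :: (int, 'd::{finite, one}) vec. \<forall>i. (if i = 1 then 0 else - int p) \<le> x $ i \<and> x $ i \<le> (if i = 1 then int N else int p)}"
  unfolding rectangle_def by auto

lemma finite_rectangle: "finite (rectangle N p :: (int, 'd::{finite, one}) vec set)"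
  unfolding rectangle_eq by (rule card_vec_box)

text \<open>The test measure is uniform on the rectangle enlarged by \<open>p\<close>, which
  contains the ball of radius \<open>p\<close> about each point of the rectangle, so its potential
  there is at least p^2. In dimension four this gives \<open>500 * N * p\<close>.\<close>

lemma cap_rectangle_le:
  fixes N p :: nat
  assumes tr: "transient TYPE('d::{finite, one})" and p: "1 \<le> p" "p \<le> N"
  shows "(\<Sum>x\<in>rectangle N p. esc (rectangle N p) (x :: (int, 'd) vec)) \<le> 4 * 5 ^ (CARD('d) - 1) * real N * real p ^ (CARD('d) - 1) / (real p)\<^sup>2"
proof -
  interpret transient "TYPE((int, 'd) vec)" by (rule tr)
  define I where "I = {y :: (int, 'd) vec. \<forall>i. (if i = 1 then - int p else - 2 * int p) \<le> y $ i \<and> y $ i \<le> (if i = 1 then int N + int p else 2 * int p)}"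
  have fin: "finite I" unfolding I_def by (rule card_vec_box)
  have "card I \<le> (\<Prod>i\<in>(UNIV :: 'd set). nat ((if i = 1 then int N + int p else 2 * int p) - (if i = 1 then - int p else - 2 * int p) + 1))"
    unfolding I_def by (rule card_vec_box)
  also have "\<dots> = (\<Prod>i\<in>(UNIV :: 'd set). if i = 1 then N + 2 * p + 1 else 4 * p + 1)"
    by (intro prod.cong) (auto simp: nat_eq_iff)
  also have "\<dots> = (N + 2 * p + 1) * (\<Prod>i\<in>(UNIV :: 'd set) - {1}. 4 * p + 1)"
    by (subst prod.remove[of _ 1]) (auto intro!: arg_cong2[where f="(*)"] prod.cong)
  also have "\<dots> = (N + 2 * p + 1) * (4 * p + 1) ^ (CARD('d) - 1)"
    by (simp add: card_Diff_singleton)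
  also have "\<dots> \<le> (4 * N) * (5 * p) ^ (CARD('d) - 1)"
    using p by (intro mult_mono power_mono) auto
  finally have "real (card I) \<le> real ((4 * N) * (5 * p) ^ (CARD('d) - 1))" by (simp only: of_nat_le_iff)
  then have cI: "real (card I) \<le> 4 * 5 ^ (CARD('d) - 1) * real N * real p ^ (CARD('d) - 1)"
    by (simp add: power_mult_distrib algebra_simps)
  have "(\<Sum>x\<in>rectangle N p. esc (rectangle N p) (x :: (int, 'd) vec)) \<le> real (card I) / (real p)\<^sup>2"
  proof (rule cap_upper[OF finite_rectangle fin, where y="\<lambda>y. y"])
    fix x :: "(int, 'd) vec" assume x: "x \<in> rectangle N p"
    let ?B = "{z :: (int, 'd) vec. norm (rv z) \<le> real p}"
    have sub: "(\<lambda>z. x - z) ` ?B \<subseteq> I"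
    proof clarify
      fix z :: "(int, 'd) vec" assume z: "norm (rv z) \<le> real p"
      have "\<bar>z $ i\<bar> \<le> int p" for i
      proof -
        have "\<bar>rv z $ i\<bar> \<le> real p" using component_le_norm_cart[of "rv z" i] z by linarith
        then have "real_of_int \<bar>z $ i\<bar> \<le> real_of_int (int p)" by (simp add: rv_def)
        then show ?thesis by (simp only: of_int_le_iff)
      qed
      then have zi: "- int p \<le> z $ i" "z $ i \<le> int p" for i by (simp_all add: abs_le_iff minus_le_iff)
      have xi: "(if i = 1 then 0 else - int p) \<le> x $ i" "x $ i \<le> (if i = 1 then int N else int p)" for i
        using x unfolding rectangle_eq by auto
      show "x - z \<in> I"
        unfolding I_def mem_Collect_eq
      proof
        fix i
        show "(if i = 1 then - int p else - 2 * int p) \<le> (x - z) $ i \<and> (x - z) $ i \<le> (if i = 1 then int N + int p else 2 * int p)"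
          using zi[of i] xi[of i] by auto
      qed
    qed
    have "(real p)\<^sup>2 \<le> (\<Sum>z\<in>?B. green z)" by (rule sum_green_ball)
    also have "\<dots> = (\<Sum>y\<in>(\<lambda>z. x - z) ` ?B. green (x - y))"
      by (subst sum.reindex) (auto simp: inj_on_def)
    also have "\<dots> \<le> (\<Sum>y\<in>I. green (x - y))"
      by (rule sum_mono2[OF fin sub]) (rule green_nonneg)
    finally show "(real p)\<^sup>2 \<le> (\<Sum>y\<in>I. green (x - y))" .
  qed (use p in auto)
  also have "\<dots> \<le> 4 * 5 ^ (CARD('d) - 1) * real N * real p ^ (CARD('d) - 1) / (real p)\<^sup>2"
    by (intro divide_right_mono cI) auto
  finally show ?thesis .
qed

lemma ln_le_sum_inverse:
  fixes b :: real
  assumes "0 < b" "R \<le> a"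
  shows "ln ((real a + 1 + b) / (real R + b)) \<le> (\<Sum>i\<in>{R..a}. 1 / (real i + b))"
  using assms(2)
proof (induction a rule: dec_induct)
  have st: "ln ((t + 1) / t) \<le> 1 / t" if "0 < t" for t :: real
    using that ln_le_minus_one[of "(t + 1) / t"] by (simp add: field_simps)
  {
    case base
    show ?case using st[of "real R + b"] assms(1) by (simp add: algebra_simps)
  next
    case (step a)
    have "ln ((real (Suc a) + 1 + b) / (real R + b)) = ln ((real (Suc a) + b + 1) / (real (Suc a) + b)) + ln ((real a + 1 + b) / (real R + b))"
      using assms(1) by (simp add: ln_div algebra_simps)
    then show ?case using step st[of "real (Suc a) + b"] assms(1) by (simp add: algebra_simps)
  }
qed

text \<open>The test measure puts unit masses on the axis, continued by \<open>a\<close> beyond both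
  ends so that every point sees two arms of length \<open>a\<close>. Distances along the axis below
  \<open>R\<close> are discarded, since the asymptotics of \<open>green\<close> only start
  there.\<close>

lemma cap_rectangle_le_3:
  fixes N p :: nat and c :: real
  assumes tr: "transient TYPE('d::{finite, one})" and d: "CARD('d) = 3"
    and c: "0 < c" and R: "1 \<le> R" "R \<le> a" and p: "1 \<le> p"
    and low: "\<And>x :: (int, 'd) vec. real R \<le> norm (rv x) \<Longrightarrow> c / norm (rv x) \<le> green x"
  shows "(\<Sum>x\<in>rectangle N p. esc (rectangle N p) (x :: (int, 'd) vec))
    \<le> (real N + 2 * real a + 1) / (2 * c * ln ((real a + 1 + 2 * real p) / (real R + 2 * real p)))"
proof -
  interpret transient "TYPE((int, 'd) vec)" by (rule tr)
  let ?I = "{- int a..int N + int a}"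
  let ?l = "ln ((real a + 1 + 2 * real p) / (real R + 2 * real p))"
  have l0: "0 < ?l" using R by (intro ln_gt_zero) auto
  have "(\<Sum>x\<in>rectangle N p. esc (rectangle N p) (x :: (int, 'd) vec)) \<le> real (card ?I) / (2 * c * ?l)"
  proof (rule cap_upper[OF finite_rectangle, where y="\<lambda>k. axis 1 k"])
    fix x :: "(int, 'd) vec" assume x: "x \<in> rectangle N p"
    define t where "t = x $ 1"
    have t: "0 \<le> t" "t \<le> int N" using x by (auto simp: rectangle_def t_def)
    have lat: "norm (rv (x - axis 1 t)) \<le> 2 * real p"
    proof -
      have sq: "(real_of_int ((x - axis 1 t) $ i))\<^sup>2 \<le> (real p)\<^sup>2" for i
      proof -
        have "\<bar>real_of_int ((x - axis 1 t) $ i)\<bar> \<le> real p"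
        proof (cases "i = 1")
          case True
          then show ?thesis by (simp add: axis_def t_def)
        next
          case False
          then have "- int p \<le> x $ i" "x $ i \<le> int p" using x by (auto simp: rectangle_def)
          then have "\<bar>x $ i\<bar> \<le> int p" by (simp add: abs_le_iff)
          then have "real_of_int \<bar>x $ i\<bar> \<le> real_of_int (int p)" by (simp only: of_int_le_iff)
          then show ?thesis using False by (simp add: axis_def)
        qed
        then have "\<bar>real_of_int ((x - axis 1 t) $ i)\<bar>\<^sup>2 \<le> (real p)\<^sup>2" by (intro power_mono) auto
        then show ?thesis by simp
      qed
      have "sqn (x - axis 1 t) \<le> (\<Sum>i\<in>(UNIV::'d set). (real p)\<^sup>2)"
        unfolding sqn_def by (intro sum_mono sq)
      also have "\<dots> \<le> (2 * real p)\<^sup>2" by (simp add: d power_mult_distrib)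
      finally show ?thesis unfolding norm_rv by (intro real_le_lsqrt) auto
    qed
    have g: "c / (real i + 2 * real p) \<le> green (x - axis 1 k)" if k: "\<bar>t - k\<bar> = int i" and i: "R \<le> i" for k i
    proof -
      have xk: "x - axis 1 k = (x - axis 1 t) + axis 1 (t - k)" by (auto simp: axis_def vec_eq_iff)
      have ax: "norm (rv (axis 1 (t - k) :: (int, 'd) vec)) = real i"
      proof -
        have "sqn (axis 1 (t - k) :: (int, 'd) vec) = (real i)\<^sup>2"
        proof -
          have "sqn (axis 1 (t - k) :: (int, 'd) vec) = (real_of_int (t - k))\<^sup>2"
            using sqn_add_axis[of "0 :: (int, 'd) vec" 1 "t - k"] by simp
          also have "\<dots> = (real_of_int \<bar>t - k\<bar>)\<^sup>2" by (simp only: of_int_abs power2_abs)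
          also have "\<dots> = (real i)\<^sup>2" unfolding k by simp
          finally show ?thesis .
        qed
        then show ?thesis by (simp add: norm_rv)
      qed
      have up: "norm (rv (x - axis 1 k)) \<le> real i + 2 * real p"
        using norm_triangle_ineq[of "rv (x - axis 1 t)" "rv (axis 1 (t - k))"] lat ax
        unfolding xk rv_add by linarith
      have "\<bar>rv (x - axis 1 k) $ 1\<bar> = real i"
      proof -
        have "rv (x - axis 1 k) $ 1 = real_of_int (t - k)" by (simp add: rv_def axis_def t_def)
        then have "\<bar>rv (x - axis 1 k) $ 1\<bar> = real_of_int \<bar>t - k\<bar>" by (simp only: of_int_abs)
        then show ?thesis using k by simp
      qed
      then have lo: "real i \<le> norm (rv (x - axis 1 k))" using component_le_norm_cart[of "rv (x - axis 1 k)" 1] by linarith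
      have "c / (real i + 2 * real p) \<le> c / norm (rv (x - axis 1 k))"
        using up lo i R c p by (intro divide_left_mono mult_pos_pos) auto
      also have "\<dots> \<le> green (x - axis 1 k)" using lo i by (intro low) auto
      finally show ?thesis .
    qed
    have "2 * c * ?l \<le> 2 * c * (\<Sum>i\<in>{R..a}. 1 / (real i + 2 * real p))"
      using c p R by (intro mult_left_mono ln_le_sum_inverse) auto
    also have "\<dots> = (\<Sum>i\<in>{R..a}. c / (real i + 2 * real p)) + (\<Sum>i\<in>{R..a}. c / (real i + 2 * real p))"
      by (simp add: sum_distrib_left sum.distrib[symmetric])
    also have "\<dots> \<le> (\<Sum>i\<in>{R..a}. green (x - axis 1 (t + int i))) + (\<Sum>i\<in>{R..a}. green (x - axis 1 (t - int i)))"
      by (intro add_mono sum_mono g) auto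
    also have "\<dots> = (\<Sum>k\<in>(\<lambda>i. t + int i) ` {R..a}. green (x - axis 1 k)) + (\<Sum>k\<in>(\<lambda>i. t - int i) ` {R..a}. green (x - axis 1 k))"
      by (subst (1 2) sum.reindex) (auto simp: inj_on_def)
    also have "\<dots> = (\<Sum>k\<in>(\<lambda>i. t + int i) ` {R..a} \<union> (\<lambda>i. t - int i) ` {R..a}. green (x - axis 1 k))"
      using R by (subst sum.union_disjoint) auto
    also have "\<dots> \<le> (\<Sum>k\<in>?I. green (x - axis 1 k))"
      using t by (intro sum_mono2) (auto simp: green_nonneg)
    finally show "2 * c * ?l \<le> (\<Sum>k\<in>?I. green (x - axis 1 k))" .
  qed (use c l0 in auto)
  also have "real (card ?I) = real N + 2 * real a + 1" by simp
  finally show ?thesis .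
qed

subsection \<open>Choice of scales\<close>

text \<open>The induction carries the telescoping term \<open>1 / (real m - 1/4)\<close>; the first
  summand alone is 16.\<close>

lemma sum_inverse_square_bound: "(\<Sum>i\<in>{1..m}. 1 / (real i - 3/4)\<^sup>2) \<le> 18"
proof (cases "m = 0")
  case False
  then have "1 \<le> m" by simp
  then have "(\<Sum>i\<in>{1..m}. 1 / (real i - 3/4)\<^sup>2) \<le> 18 - 1 / (real m - 1/4)"
  proof (induction m rule: dec_induct)
    case base
    show ?case by (simp add: power2_eq_square)
  next
    case (step m)
    have "1 / (real (Suc m) - 3/4)\<^sup>2 \<le> 1 / ((real m + 1/4)\<^sup>2 - 1/4)"
    proof (rule divide_left_mono)
      have "(1 + 1/4)\<^sup>2 \<le> (real m + 1/4)\<^sup>2" using step by (intro power_mono) auto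
      then have "0 < (real m + 1/4)\<^sup>2 - 1/4" by (simp add: power2_eq_square)
      then show "0 < (real (Suc m) - 3/4)\<^sup>2 * ((real m + 1/4)\<^sup>2 - 1/4)" using step by simp
      have "real (Suc m) - 3/4 = real m + 1/4" by simp
      then show "(real m + 1/4)\<^sup>2 - 1/4 \<le> (real (Suc m) - 3/4)\<^sup>2" by (simp add: add.commute)
    qed auto
    also have "(real m + 1/4)\<^sup>2 - 1/4 = (real m - 1/4) * (real m + 3/4)"
      by (simp add: power2_eq_square algebra_simps)
    also have "1 / ((real m - 1/4) * (real m + 3/4)) = 1 / (real m - 1/4) - 1 / (real (Suc m) - 1/4)"
      using step by (simp add: field_simps)
    finally show ?case using step by simp
  qed
  moreover have "0 \<le> 1 / (real m - 1/4)" using \<open>1 \<le> m\<close> by simp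
  ultimately show ?thesis by linarith
qed simp

text \<open>The first summand is 4, and each later one is at most 1/(i - 1). Carrying
  \<open>1 / real m\<close> through the induction repairs this shift of index.\<close>

lemma sum_inverse_bound:
  assumes "1 \<le> m"
  shows "(\<Sum>i\<in>{1..m}. 1 / (real i - 3/4)) \<le> 5 + ln (real m)"
proof -
  have "(\<Sum>i\<in>{1..m}. 1 / (real i - 3/4)) \<le> 5 + ln (real m) - 1 / real m"
    using assms
  proof (induction m rule: dec_induct)
    case (step m)
    have m: "0 < real m" using step by simp
    have "ln (real m / real (Suc m)) \<le> real m / real (Suc m) - 1"
      using m by (intro ln_le_minus_one) auto
    then have "1 / real (Suc m) \<le> ln (real (Suc m)) - ln (real m)"
      using m by (simp add: ln_div field_simps)
    moreover have "1 / (real (Suc m) - 3/4) \<le> 1 / real m"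
      using m by (intro divide_left_mono) auto
    ultimately show ?case using step by simp
  qed simp
  moreover have "0 \<le> 1 / real m" by simp
  ultimately show ?thesis by linarith
qed

lemma prob_srw_le_1:
  "\<P>(\<omega> in srw x. Q \<omega>) \<le> 1"
  by (rule prob_space.prob_le_1[OF prob_space_srw])

text \<open>With pieces of about L^2 steps the range has capacity at least of order N L / log L,
  against order N p for the rectangle. A large multiple of p times the squared logarithm for
  \<open>L\<close> lets the range win, and the number of shells, at least N / (10 L), is the
  exponent.\<close>

lemma cap_small_upper_bound_4:
  assumes d: "CARD('d::{finite, one}) = 4"
  shows "\<exists>c > 0. \<forall>N p :: nat. 1 \<le> p \<and> p \<le> N \<longrightarrow>
    \<P>(\<omega> in srw (0 :: (int, 'd) vec). cap (visited (lattice_ball N) \<omega>) \<le> cap (rectangle N p :: (int, 'd) vec set))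
      \<le> exp 1 * exp (- (c * real N / (real p * (max (ln (real p)) 1)\<^sup>2)))"
proof -
  have tr: "transient TYPE('d)" by (rule transient_4(1)[OF d])
  \<comment> \<open>This is exp(-2/\<delta>) for the tolerance \<delta> = 1/2; the two parts of
    \<open>prob_bad\<close> receive half of it each.\<close>
  define \<delta>0 :: real where "\<delta>0 = exp (- 4)"
  have \<delta>0: "0 < \<delta>0" "\<delta>0 \<le> 1" "1/81 \<le> \<delta>0"
  proof -
    have "exp (4 :: real) = exp 1 ^ 4" by (simp add: exp_of_nat_mult[symmetric])
    also have "\<dots> \<le> 3 ^ 4" using exp_le by (intro power_mono) auto
    finally show "1/81 \<le> \<delta>0" by (simp add: \<delta>0_def exp_minus field_simps)
  qed (auto simp: \<delta>0_def)
  \<comment> \<open>Solves 2 * 4096 / (A / 2) = \<delta>0 / 2, where 4096 is the constant of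
    \<open>sum_walk_green_4\<close>.\<close>
  define A where "A = 32768 / \<delta>0"
  have A: "0 < A" using \<delta>0 by (simp add: A_def)
  \<comment> \<open>1152 = 2 * 576 bounds the interaction between pieces, and 576 = (512 / 16) *
    18.\<close>
  define a where "a = \<delta>0 / (16 * (A + 1152))"
  have a: "0 < a" using \<delta>0 A by (simp add: a_def)
  \<comment> \<open>A logarithm of \<open>B\<close> re-enters through \<open>\<Lambda>\<close>, so
    \<open>B\<close> has to beat a multiple of its own logarithm.\<close>
  have "filterlim (\<lambda>B::real. B / (9 + 2 * ln B)) at_top at_top" by real_asymp
  then have "\<forall>\<^sub>F B in at_top. 5000 / a < B / (9 + 2 * ln B)" by (simp add: filterlim_at_top_dense)
  then have "\<forall>\<^sub>F B in at_top. 5000 / a < B / (9 + 2 * ln B) \<and> 18 \<le> B"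
    by (intro eventually_conj eventually_ge_at_top)
  then obtain B :: real where B: "5000 / a < B / (9 + 2 * ln B)" "18 \<le> B"
    by (auto simp: eventually_at_top_linorder)
  have lnB: "0 \<le> ln B" using B by simp
  show ?thesis
  proof (intro exI[of _ "1 / (10 * B)"] conjI allI impI)
    show "0 < 1 / (10 * B)" using B by simp
    fix N p :: nat assume p: "1 \<le> p \<and> p \<le> N"
    define l where "l = max (ln (real p)) 1"
    have l: "1 \<le> l" "ln (real p) \<le> l" by (auto simp: l_def)
    define L where "L = B * real p * l\<^sup>2"
    have pl: "1 \<le> real p * l\<^sup>2" using p l mult_mono[of 1 "real p" 1 "l\<^sup>2"] by (simp add: power2_eq_square mult_ge1_I)
    then have L18: "18 \<le> L" using B mult_mono[of 18 B 1 "real p * l\<^sup>2"] by (simp add: L_def mult.assoc)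
    let ?P = "\<P>(\<omega> in srw (0 :: (int, 'd) vec). cap (visited (lattice_ball N) \<omega>) \<le> cap (rectangle N p :: (int, 'd) vec set))"
    have ex: "1 / (10 * B) * real N / (real p * (max (ln (real p)) 1)\<^sup>2) = real N / (10 * L)"
      by (simp add: L_def l_def)
    have "?P \<le> exp 1 * exp (- (real N / (10 * L)))"
    proof (cases "real N < 10 * L")
      \<comment> \<open>Too little room for the shells: the right side is at least 1.\<close>
      case True
      then have "real N / (10 * L) \<le> 1" using L18 by simp
      then have "1 \<le> exp (1 - real N / (10 * L))" by simp
      also have "\<dots> = exp 1 * exp (- (real N / (10 * L)))" by (simp add: exp_add[symmetric])
      finally show ?thesis by (rule order_trans[OF prob_srw_le_1])
    next
      case False
      have Lsq: "324 \<le> L\<^sup>2" using power_mono[of 18 L 2] L18 by simp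
      define n where "n = nat \<lfloor>\<delta>0 * L\<^sup>2 / 2\<rfloor>"
      have n: "real n \<le> \<delta>0 * L\<^sup>2 / 2" "\<delta>0 * L\<^sup>2 / 4 \<le> real n"
      proof -
        have "(1/81) * 324 \<le> \<delta>0 * L\<^sup>2" using \<delta>0 Lsq by (intro mult_mono) auto
        then have 4: "4 \<le> \<delta>0 * L\<^sup>2" by simp
        then show "real n \<le> \<delta>0 * L\<^sup>2 / 2" unfolding n_def by linarith
        show "\<delta>0 * L\<^sup>2 / 4 \<le> real n" unfolding n_def using 4 by linarith
      qed
      have n1: "1 \<le> n"
      proof -
        have "0 < \<delta>0 * L\<^sup>2 / 4" using \<delta>0 Lsq by (intro divide_pos_pos mult_pos_pos; linarith)
        then have "0 < real n" using n(2) by linarith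
        then show ?thesis by simp
      qed
      have nL: "real n \<le> L\<^sup>2"
      proof -
        have "\<delta>0 * L\<^sup>2 \<le> 1 * L\<^sup>2" using \<delta>0 by (intro mult_right_mono) auto
        then show ?thesis using n(1) Lsq by simp
      qed
      define K where "K = A * ln (real n + 15)"
      have ln0: "0 < ln (real n + 15)" by (intro ln_gt_zero) auto
      have K0: "0 < K" using A ln0 by (simp add: K_def)
      define m where "m = nat \<lfloor>(real N - 1 - L) / (4 * L)\<rfloor>"
      have m: "real m \<le> (real N - 1 - L) / (4 * L)" "real N / (10 * L) \<le> real m"
      proof -
        have q: "0 \<le> (real N - 1 - L) / (4 * L)" using False L18 by simp
        then show "real m \<le> (real N - 1 - L) / (4 * L)" unfolding m_def by linarith
        have "real N / (10 * L) \<le> (real N - 1 - L) / (4 * L) - 1"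
        proof -
          have "real N / (10 * L) = (2/5 * real N) / (4 * L)" using L18 by simp
          also have "\<dots> \<le> (real N - 1 - L - 4 * L) / (4 * L)"
            using False L18 by (intro divide_right_mono) auto
          also have "\<dots> = (real N - 1 - L) / (4 * L) - 1" using L18 by (simp add: diff_divide_distrib)
          finally show ?thesis .
        qed
        then show "real N / (10 * L) \<le> real m" unfolding m_def using q by linarith
      qed
      interpret shells "TYPE((int, 'd) vec)" L K "1/2" n
        using tr L18 n1 K0 by (simp add: shells_def shells_axioms_def)
      define \<gamma> where "\<gamma> = (\<lambda>i::nat. 512 / (4 * L * (real i - 3/4))\<^sup>2)"
      have sum\<gamma>: "(\<Sum>i\<in>{1..m}. \<gamma> i) \<le> 576 / L\<^sup>2"
      proof -
        have "(\<Sum>i\<in>{1..m}. \<gamma> i) = (32 / L\<^sup>2) * (\<Sum>i\<in>{1..m}. 1 / (real i - 3/4)\<^sup>2)"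
          by (simp add: \<gamma>_def sum_distrib_left power_mult_distrib)
        also have "\<dots> \<le> (32 / L\<^sup>2) * 18"
          by (intro mult_left_mono sum_inverse_square_bound) simp
        finally show ?thesis by simp
      qed
      define \<Lambda> where "\<Lambda> = ln (16 * L\<^sup>2)"
      have \<Lambda>: "ln (real n + 15) \<le> \<Lambda>" "1 \<le> \<Lambda>" "\<Lambda> \<le> (9 + 2 * ln B) * l"
      proof -
        show "ln (real n + 15) \<le> \<Lambda>" unfolding \<Lambda>_def using nL Lsq by (subst ln_le_cancel_iff) auto
        have "exp 1 \<le> 16 * L\<^sup>2" using exp_le Lsq by linarith
        then show "1 \<le> \<Lambda>" unfolding \<Lambda>_def using Lsq by (subst ln_ge_iff) auto
        have "ln (16 * L\<^sup>2) = 4 * ln 2 + 2 * (ln B + ln (real p) + 2 * ln l)"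
        proof -
          have "ln (16 :: real) = ln (2 ^ 4)" by simp
          also have "\<dots> = 4 * ln 2" by (subst ln_realpow) auto
          finally show ?thesis
            using L18 B p l by (simp add: L_def ln_mult ln_realpow)
        qed
        moreover have "4 * ln (2::real) \<le> 3" using ln2_le_25_over_36 by simp
        moreover have "ln l \<le> l" using ln_le_minus_one[of l] l by simp
        ultimately have "\<Lambda> \<le> 3 + 2 * ln B + 6 * l" using l unfolding \<Lambda>_def by simp
        also have "\<dots> \<le> 3 * l + (2 * ln B) * l + 6 * l"
          using l lnB mult_left_mono[of 1 l "2 * ln B"] by simp
        finally show "\<Lambda> \<le> (9 + 2 * ln B) * l" by (simp add: algebra_simps)
      qed
      have den: "K + 2 * real n * (\<Sum>i\<in>{1..m}. \<gamma> i) \<le> (A + 1152) * \<Lambda>"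
      proof -
        have "2 * real n * (\<Sum>i\<in>{1..m}. \<gamma> i) \<le> 2 * L\<^sup>2 * (576 / L\<^sup>2)"
          using nL by (intro mult_mono sum\<gamma> sum_nonneg) (auto simp: \<gamma>_def)
        also have "\<dots> = 1152 * 1" using L18 by simp
        also have "\<dots> \<le> 1152 * \<Lambda>" using \<Lambda> by simp
        finally have "2 * real n * (\<Sum>i\<in>{1..m}. \<gamma> i) \<le> 1152 * \<Lambda>" .
        moreover have "K \<le> A * \<Lambda>" unfolding K_def using A \<Lambda> by (intro mult_left_mono) auto
        ultimately show ?thesis by (simp add: algebra_simps)
      qed
      have den0: "0 < K + 2 * real n * (\<Sum>i\<in>{1..m}. \<gamma> i)"
        using K0 by (intro add_pos_nonneg mult_nonneg_nonneg sum_nonneg) (auto simp: \<gamma>_def)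
      have "?P \<le> exp (- real m)"
      proof (rule prob_cap_small[where \<gamma>=\<gamma>])
        have "\<P>(\<zeta> in steps_M. bad \<zeta>) \<le> real n / L\<^sup>2 + 2 * (\<Sum>k<n. (nbr_avg ^^ k) green (0 :: (int, 'd) vec)) / (K * (1/2))"
          by (rule prob_bad)
        also have "\<dots> \<le> \<delta>0 / 2 + \<delta>0 / 2"
        proof (rule add_mono)
          show "real n / L\<^sup>2 \<le> \<delta>0 / 2" using n(1) L18 by (simp add: field_simps)
          have "2 * (\<Sum>k<n. (nbr_avg ^^ k) green (0 :: (int, 'd) vec)) / (K * (1/2)) \<le> 2 * (4096 * ln (real n + 15)) / (K * (1/2))"
            using K0 by (intro divide_right_mono mult_left_mono sum_walk_green_4[OF d]) auto
          also have "\<dots> = \<delta>0 / 2" using ln0 \<delta>0 by (simp add: K_def A_def field_simps)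
          finally show "2 * (\<Sum>k<n. (nbr_avg ^^ k) green (0 :: (int, 'd) vec)) / (K * (1/2)) \<le> \<delta>0 / 2" .
        qed
        finally show "\<P>(\<zeta> in steps_M. bad \<zeta>) \<le> exp (- (2 / (1 / 2)))" by (simp add: \<delta>0_def)
        show "0 \<le> \<gamma> i" for i by (simp add: \<gamma>_def)
        show "green x \<le> \<gamma> i" if "1 \<le> i" "4 * L * (real i - 3/4) \<le> norm (rv x)" for i and x :: "(int, 'd) vec"
        proof -
          have pos: "0 < 4 * L * (real i - 3/4)" using that(1) L18 by simp
          have "(4 * L * (real i - 3/4))\<^sup>2 \<le> (norm (rv x))\<^sup>2" using that(2) pos by (intro power_mono) auto
          then have le: "(4 * L * (real i - 3/4))\<^sup>2 \<le> sqn x + 15" by (simp add: norm_rv_sq)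
          have sp: "0 < sqn x + 15" using sqn_nonneg[of x] by linarith
          have "512 / (sqn x + 15) \<le> \<gamma> i" unfolding \<gamma>_def
            by (rule divide_left_mono[OF le _ mult_pos_pos[OF sp zero_less_power[OF pos]]]) simp
          then show ?thesis using transient_4(2)[OF d, of x] by linarith
        qed
        show "4 * L * real m + L + 1 \<le> real N"
          using m(1) L18 by (simp add: field_simps)
        have "cap (rectangle N p :: (int, 'd) vec set) \<le> 2 * real CARD('d) * (500 * real N * real p)"
        proof -
          have "4 * 5 ^ (CARD('d) - 1) * real N * real p ^ (CARD('d) - 1) / (real p)\<^sup>2 = 500 * real N * real p"
            using p by (simp add: d power2_eq_square power3_eq_cube)
          then show ?thesis
            unfolding cap_eq_esc using cap_rectangle_le[OF tr, of p N] p by (intro mult_left_mono) auto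
        qed
        also have "\<dots> < 2 * real CARD('d) * ((1 - 1/2)\<^sup>2 * real m * real n / (K + 2 * real n * (\<Sum>i\<in>{1..m}. \<gamma> i)))"
        proof (rule mult_strict_left_mono)
          have Np: "0 < real N" "0 < real p" using p by auto
          have "real p * (5000 / a) < real p * (B / (9 + 2 * ln B))"
            using B Np by (intro mult_strict_left_mono) auto
          also have "\<dots> = (B * real p * l\<^sup>2) / ((9 + 2 * ln B) * l) / l"
            using l lnB by (simp add: power2_eq_square)
          also have "\<dots> \<le> L / \<Lambda>"
          proof -
            have "(B * real p * l\<^sup>2) / ((9 + 2 * ln B) * l) / l \<le> (B * real p * l\<^sup>2) / ((9 + 2 * ln B) * l) / 1"
              using l lnB B by (intro divide_left_mono) auto
            also have "\<dots> \<le> L / \<Lambda>"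
              unfolding L_def[symmetric] using \<Lambda> L18 by (simp add: divide_left_mono)
            finally show ?thesis .
          qed
          finally have key: "real p * (5000 / a) < L / \<Lambda>" .
          have "500 * real N * real p = (a * real N / 10) * (real p * (5000 / a))" using a by simp
          also have "\<dots> < (a * real N / 10) * (L / \<Lambda>)"
            using key a Np by (intro mult_strict_left_mono) auto
          also have "\<dots> = (1/4) * (real N / (10 * L)) * (\<delta>0 * L\<^sup>2 / 4) / ((A + 1152) * \<Lambda>)"
            using L18 A \<Lambda>(2) by (simp add: a_def power2_eq_square field_simps)
          also have "\<dots> \<le> (1/4) * real m * real n / ((A + 1152) * \<Lambda>)"
            using m n A L18 \<Lambda> \<delta>0 by (intro divide_right_mono mult_mono) auto
          also have "\<dots> \<le> (1/4) * real m * real n / (K + 2 * real n * (\<Sum>i\<in>{1..m}. \<gamma> i))"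
            using den den0 A \<Lambda> by (intro divide_left_mono mult_pos_pos) auto
          finally show "500 * real N * real p < (1 - 1/2)\<^sup>2 * real m * real n / (K + 2 * real n * (\<Sum>i\<in>{1..m}. \<gamma> i))"
            by (simp add: power2_eq_square)
        qed simp
        finally show "cap (rectangle N p :: (int, 'd) vec set) < 2 * real CARD('d) * ((1 - 1/2)\<^sup>2 * real m * real n / (K + 2 * real n * (\<Sum>i\<in>{1..m}. \<gamma> i)))" .
      qed
      also have "\<dots> \<le> exp (- (real N / (10 * L)))" using m(2) by simp
      also have "\<dots> \<le> exp 1 * exp (- (real N / (10 * L)))" by simp
      finally show ?thesis .
    qed
    then show "?P \<le> exp 1 * exp (- (1 / (10 * B) * real N / (real p * (max (ln (real p)) 1)\<^sup>2)))"
      unfolding ex .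
  qed
qed

text \<open>
  Both capacities are sharp to leading order: about \<open>N / (2 c ln m)\<close> for the walk cut into \<open>m\<close> pieces
  and \<open>N / (2 c ln (N / p))\<close> for the rectangle. Taking \<open>m\<close> of order \<open>(N / p) powr (1 - \<eta>)\<close> makes the
  former strictly larger.
\<close>

lemma cap_small_upper_bound_3:
  fixes \<eta> :: real
  assumes d: "CARD('d::{finite, one}) = 3" and \<eta>: "0 < \<eta>" "\<eta> < 1"
  shows "\<exists>C. \<forall>N p :: nat. 1 \<le> p \<and> p \<le> N \<longrightarrow>
    \<P>(\<omega> in srw (0 :: (int, 'd) vec). cap (visited (lattice_ball N) \<omega>) \<le> cap (rectangle N p :: (int, 'd) vec set))
      \<le> C * exp (- ((real N / real p) powr (1 - \<eta>)))"
proof -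
  interpret three_dim "TYPE((int, 'd) vec)" by unfold_locales (rule d)
  have tr: "transient TYPE('d)" by (rule transient_3(1)[OF d])
  obtain c where c: "0 < c"
    and asym: "\<And>\<epsilon>. 0 < \<epsilon> \<Longrightarrow> \<exists>R. \<forall>x :: (int, 'd) vec. R \<le> norm (rv x) \<longrightarrow> \<bar>norm (rv x) * green x - c\<bar> < \<epsilon>"
    using green_asymptotics by blast
  \<comment> \<open>Several factors \<open>1 - \<delta>\<close> and \<open>1 + \<delta>\<close> are
    lost on the way; a tenth of \<open>\<eta>\<close> keeps the total loss below the gain
    \<open>1 - \<eta>\<close>.\<close>
  define \<delta> where "\<delta> = \<eta> / 10"
  have \<delta>: "0 < \<delta>" "\<delta> < 1/10" using \<eta> by (auto simp: \<delta>_def)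
  obtain R0 where R0: "\<And>x :: (int, 'd) vec. R0 \<le> norm (rv x) \<Longrightarrow> \<bar>norm (rv x) * green x - c\<bar> < c * \<delta>"
    using asym[of "c * \<delta>"] c \<delta> by auto
  obtain R :: nat where R: "R0 \<le> real R" "1 \<le> R"
    by (metis linorder_le_cases of_nat_le_iff order_trans real_arch_simple)
  have up: "green x \<le> c * (1 + \<delta>) / norm (rv x)" and low: "c * (1 - \<delta>) / norm (rv x) \<le> green x"
    if "real R \<le> norm (rv x)" for x :: "(int, 'd) vec"
  proof -
    have "0 < norm (rv x)" using that R by linarith
    moreover have "\<bar>norm (rv x) * green x - c\<bar> < c * \<delta>" using that R by (intro R0) linarith
    ultimately show "green x \<le> c * (1 + \<delta>) / norm (rv x)" "c * (1 - \<delta>) / norm (rv x) \<le> green x"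
      by (simp_all add: field_simps abs_less_iff)
  qed
  define \<delta>0 where "\<delta>0 = exp (- (2 / \<delta>))"
  have \<delta>0: "0 < \<delta>0" by (simp add: \<delta>0_def)
  \<comment> \<open>Solves 2 * 12288 / (A * \<delta>) = \<delta>0 / 2, with 12288 from
    \<open>sum_walk_green_3\<close>.\<close>
  define A where "A = 49152 / (\<delta> * \<delta>0)"
  have A: "0 < A" using \<delta> \<delta>0 by (simp add: A_def)
  \<comment> \<open>\<open>A2\<close> collects what stays bounded beside \<open>ln q\<close> on the
    side of the walk, namely the self-potential of a piece and the constant of the harmonic sum;
    \<open>A3\<close> does so for the rectangle.\<close>
  define A2 where "A2 = 8 * A / sqrt \<delta>0 + 12 * c * (1 + \<delta>)"
  define A3 where "A3 = ln ((real R + 2) / \<delta>)"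
  define L0 where "L0 = max (real R) (2 / sqrt \<delta>0)"
  have ev1: "\<forall>\<^sub>F q in at_top. 18 * L0 \<le> q powr \<eta>"
  proof -
    have "filterlim (\<lambda>q::real. q powr \<eta>) at_top at_top" using \<eta> by real_asymp
    then show ?thesis by (simp add: filterlim_at_top)
  qed
  have ev2: "\<forall>\<^sub>F q in at_top. 1 / \<delta> \<le> q powr (1 - \<eta>)"
  proof -
    have "filterlim (\<lambda>q::real. q powr (1 - \<eta>)) at_top at_top" using \<eta> by real_asymp
    then show ?thesis by (simp add: filterlim_at_top)
  qed
  have ev3: "\<forall>\<^sub>F q in at_top. A3 < ln q \<and>
      (1 + 3 * \<delta>) * (A2 + 2 * c * (1 + \<delta>) * (1 - \<eta>) * ln q) < (1 - \<delta>) ^ 3 * (2 * c * (1 - \<delta>) * (ln q - A3))"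
  proof -
    define D where "D = 2 * c * ((1 - \<delta>) ^ 4 - (1 + 3 * \<delta>) * (1 + \<delta>) * (1 - \<eta>))"
    \<comment> \<open>The coefficients of \<open>ln q\<close> decide the comparison: (1 +
      3\<delta>)(1 + \<delta>)(1 - 10\<delta>) < (1 - \<delta>)^4, with Bernoulli on the
      right.\<close>
    have "0 < D"
    proof -
      have e: "\<eta> = 10 * \<delta>" by (simp add: \<delta>_def)
      have s: "\<delta> * \<delta> \<le> \<delta> * (1/10)" using \<delta> by (intro mult_left_mono) auto
      have "(1 + 3 * \<delta>) * (1 + \<delta>) \<le> 1 + 5 * \<delta>" using s \<delta> by (simp add: algebra_simps)
      then have "(1 + 3 * \<delta>) * (1 + \<delta>) * (1 - \<eta>) \<le> (1 + 5 * \<delta>) * (1 - \<eta>)"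
        using \<eta> by (intro mult_right_mono) auto
      also have "\<dots> < 1 - 4 * \<delta>"
      proof -
        have "0 < \<delta> * \<delta>" using \<delta> by simp
        moreover have "(1 + 5 * \<delta>) * (1 - \<eta>) = 1 - 5 * \<delta> - 50 * (\<delta> * \<delta>)" unfolding e by (simp add: algebra_simps)
        ultimately show ?thesis using \<delta> by linarith
      qed
      also have "\<dots> \<le> (1 - \<delta>) ^ 4"
        using Bernoulli_inequality[of "- \<delta>" 4] \<delta> by simp
      finally show ?thesis using c by (simp add: D_def)
    qed
    define M where "M = max A3 (((1 + 3 * \<delta>) * A2 + 2 * c * (1 - \<delta>) ^ 4 * A3) / D)"
    have "filterlim (\<lambda>q::real. ln q) at_top at_top" by real_asymp
    then have "\<forall>\<^sub>F q in at_top. M < ln q" by (simp add: filterlim_at_top_dense)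
    then show ?thesis
    proof eventually_elim
      case (elim q)
      then have "A3 < ln q" "((1 + 3 * \<delta>) * A2 + 2 * c * (1 - \<delta>) ^ 4 * A3) / D < ln q"
        by (auto simp: M_def)
      then have "(1 + 3 * \<delta>) * A2 + 2 * c * (1 - \<delta>) ^ 4 * A3 < D * ln q"
        using \<open>0 < D\<close> by (simp add: field_simps)
      moreover have "(1 - \<delta>) ^ 3 * (2 * c * (1 - \<delta>) * (ln q - A3)) = 2 * c * (1 - \<delta>) ^ 4 * (ln q - A3)"
        by (simp add: power_numeral_reduce)
      moreover have "(1 + 3 * \<delta>) * (A2 + 2 * c * (1 + \<delta>) * (1 - \<eta>) * ln q)
          = (1 + 3 * \<delta>) * A2 + 2 * c * (1 - \<delta>) ^ 4 * ln q - D * ln q"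
        unfolding D_def by (simp add: algebra_simps)
      ultimately show ?case using \<open>A3 < ln q\<close> by (simp add: right_diff_distrib)
    qed
  qed
  have "\<forall>\<^sub>F q in at_top. 18 * L0 \<le> q powr \<eta> \<and> 1 / \<delta> \<le> q powr (1 - \<eta>) \<and> (A3 < ln q \<and>
      (1 + 3 * \<delta>) * (A2 + 2 * c * (1 + \<delta>) * (1 - \<eta>) * ln q) < (1 - \<delta>) ^ 3 * (2 * c * (1 - \<delta>) * (ln q - A3)))
      \<and> (real R + 2) / \<delta> \<le> q"
    by (intro eventually_conj ev1 ev2 ev3 eventually_ge_at_top)
  then obtain q0 where q0: "\<And>q. q0 \<le> q \<Longrightarrow> 18 * L0 \<le> q powr \<eta>" "\<And>q. q0 \<le> q \<Longrightarrow> 1 / \<delta> \<le> q powr (1 - \<eta>)"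
      "\<And>q. q0 \<le> q \<Longrightarrow> A3 < ln q"
      "\<And>q. q0 \<le> q \<Longrightarrow> (1 + 3 * \<delta>) * (A2 + 2 * c * (1 + \<delta>) * (1 - \<eta>) * ln q) < (1 - \<delta>) ^ 3 * (2 * c * (1 - \<delta>) * (ln q - A3))"
      "\<And>q. q0 \<le> q \<Longrightarrow> (real R + 2) / \<delta> \<le> q"
    by (auto simp: eventually_at_top_linorder)
  show ?thesis
  \<comment> \<open>This constant makes the bound trivial whenever N/p is below
    \<open>q0\<close>.\<close>
  proof (intro exI[of _ "exp (q0 powr (1 - \<eta>))"] allI impI)
    fix N p :: nat assume p: "1 \<le> p \<and> p \<le> N"
    define q where "q = real N / real p"
    have q1: "1 \<le> q" using p by (simp add: q_def)
    have qN: "q \<le> real N" using p by (simp add: q_def field_simps)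
    let ?P = "\<P>(\<omega> in srw (0 :: (int, 'd) vec). cap (visited (lattice_ball N) \<omega>) \<le> cap (rectangle N p :: (int, 'd) vec set))"
    have "?P \<le> exp (q0 powr (1 - \<eta>)) * exp (- (q powr (1 - \<eta>)))"
    proof (cases "q0 \<le> q")
      case False
      then have "q powr (1 - \<eta>) \<le> q0 powr (1 - \<eta>)" using q1 \<eta> by (intro powr_mono2) auto
      then have "1 \<le> exp (q0 powr (1 - \<eta>)) * exp (- (q powr (1 - \<eta>)))" by (simp add: exp_add[symmetric])
      then show ?thesis by (rule order_trans[OF prob_srw_le_1])
    next
      case True
      note Q = q0[OF True]
      have lnq: "0 \<le> ln q" using q1 by simp
      define z where "z = q powr (1 - \<eta>)"
      have z: "1 / \<delta> \<le> z" "10 \<le> z"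
      proof -
        show "1 / \<delta> \<le> z" using Q(2) by (simp add: z_def)
        moreover have "10 \<le> 1 / \<delta>" using \<delta> by (simp add: field_simps)
        ultimately show "10 \<le> z" by linarith
      qed
      define m where "m = nat \<lceil>z\<rceil>"
      have m: "z \<le> real m" "real m \<le> z + 1" "1 \<le> m"
        using z(2) unfolding m_def by linarith+
      \<comment> \<open>Chosen so that m spacings, the last displacement and the overshoot fill the
        radius exactly: 4 L m + L + 1 = N.\<close>
      define L where "L = (real N - 1) / (4 * real m + 1)"
      have Nbig: "(real R + 2) / \<delta> \<le> real N" using Q(5) qN by linarith
      then have \<delta>N: "real R + 2 \<le> \<delta> * real N" using \<delta> by (simp add: field_simps)
      have N2: "20 \<le> real N"
      proof -
        have "\<delta> * real N \<le> (1/10) * real N" using \<delta> by (intro mult_right_mono) auto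
        then show ?thesis using \<delta>N by simp
      qed
      \<comment> \<open>N/m is at least of order \<open>q powr \<eta>\<close>, hence
        \<open>L\<close> exceeds any prescribed constant; this is where the exponent below 1 is used
        for the scale of the pieces.\<close>
      have LL0: "L0 \<le> L"
      proof -
        have "18 * L0 * z \<le> q powr \<eta> * z" using Q(1) z by (intro mult_right_mono) auto
        also have "q powr \<eta> * z = q" unfolding z_def using q1 by (simp add: powr_add[symmetric])
        finally have a: "18 * L0 * z \<le> q" .
        have "L0 \<ge> 0" unfolding L0_def by (simp add: le_max_iff_disj)
        have "L0 * (4 * real m + 1) \<le> L0 * (9 * z)"
          using m z \<open>L0 \<ge> 0\<close> by (intro mult_left_mono) auto
        also have "\<dots> \<le> q / 2" using a by simp
        also have "\<dots> \<le> real N - 1" using qN N2 by simp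
        finally show ?thesis unfolding L_def by (simp add: field_simps)
      qed
      have LR: "real R \<le> L" and L1: "1 \<le> L" and Ls: "2 / sqrt \<delta>0 \<le> L"
        using LL0 R by (auto simp: L0_def)
      have Lsq: "4 \<le> \<delta>0 * L\<^sup>2"
      proof -
        have "(2 / sqrt \<delta>0)\<^sup>2 \<le> L\<^sup>2" using Ls \<delta>0 by (intro power_mono) auto
        then show ?thesis using \<delta>0 by (simp add: power_divide field_simps)
      qed
      have Nm: "4 * L * real m + L + 1 = real N"
      proof -
        have "L * (4 * real m + 1) = real N - 1" unfolding L_def by simp
        then show ?thesis by (simp add: algebra_simps)
      qed
      \<comment> \<open>The uncovered length L + 1 is at most a proportion \<delta> of N, because m
        is at least 1/\<delta> and N is large.\<close>
      have Lm: "(1 - \<delta>) * real N \<le> 4 * L * real m"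
      proof -
        have "4 * (1 / \<delta>) \<le> 4 * real m + 1" using z m by simp
        then have "4 * real N \<le> \<delta> * real N * (4 * real m + 1)"
          using \<delta> mult_left_mono[of "4 * (1 / \<delta>)" "4 * real m + 1" "\<delta> * real N"] by simp
        then have "L \<le> \<delta> * real N / 4"
          unfolding L_def using N2 by (subst pos_divide_le_eq) (auto simp: algebra_simps)
        then show ?thesis using Nm \<delta>N by (simp add: algebra_simps)
      qed
      define n where "n = nat \<lfloor>\<delta>0 * L\<^sup>2 / 2\<rfloor>"
      have n: "real n \<le> \<delta>0 * L\<^sup>2 / 2" "\<delta>0 * L\<^sup>2 / 4 \<le> real n"
        unfolding n_def using Lsq by linarith+
      have n1: "1 \<le> n"
      proof -
        have "1 \<le> real n" using n(2) Lsq by linarith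
        then show ?thesis by simp
      qed
      have sn: "0 < sqrt (real n)" using n1 by simp
      define K where "K = A * sqrt (real n)"
      have K0: "0 < K" using A sn by (simp add: K_def)
      interpret shells "TYPE((int, 'd) vec)" L K \<delta> n
        using tr L1 n1 K0 \<delta> by (simp add: shells_def shells_axioms_def)
      define \<gamma> where "\<gamma> = (\<lambda>i::nat. if i = 0 then 0 else c * (1 + \<delta>) / (4 * L * (real i - 3/4)))"
      have \<gamma>0: "0 \<le> \<gamma> i" for i using c \<delta> L1 by (auto simp: \<gamma>_def)
      define S where "S = (\<Sum>i\<in>{1..m}. \<gamma> i)"
      have S0: "0 \<le> S" unfolding S_def by (intro sum_nonneg \<gamma>0)
      have S: "S \<le> c * (1 + \<delta>) * (6 + (1 - \<eta>) * ln q) / (4 * L)"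
      proof -
        have "S = (c * (1 + \<delta>) / (4 * L)) * (\<Sum>i\<in>{1..m}. 1 / (real i - 3/4))"
          unfolding S_def sum_distrib_left by (intro sum.cong) (auto simp: \<gamma>_def)
        also have "\<dots> \<le> (c * (1 + \<delta>) / (4 * L)) * (5 + ln (real m))"
          using c \<delta> L1 by (intro mult_left_mono sum_inverse_bound m) auto
        also have "\<dots> \<le> (c * (1 + \<delta>) / (4 * L)) * (6 + (1 - \<eta>) * ln q)"
        proof (rule mult_left_mono)
          have "ln (real m) \<le> ln (2 * z)" using m z by (subst ln_le_cancel_iff) auto
          also have "\<dots> = ln 2 + (1 - \<eta>) * ln q" using z q1 by (simp add: ln_mult z_def ln_powr)
          also have "ln 2 \<le> (1 :: real)" using ln2_le_25_over_36 by simp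
          finally show "5 + ln (real m) \<le> 6 + (1 - \<eta>) * ln q" by simp
        qed (use c \<delta> L1 in auto)
        finally show ?thesis by simp
      qed
      define W where "W = A2 + 2 * c * (1 + \<delta>) * (1 - \<eta>) * ln q"
      have W0: "0 < W" unfolding W_def A2_def using c \<delta> \<delta>0 A \<eta> lnq
        by (intro add_pos_nonneg mult_nonneg_nonneg add_pos_pos divide_pos_pos) auto
      \<comment> \<open>The self-potential divided by n is only of order 1/L, while the interaction
        carries ln q / L: crude constants do no harm in the former.\<close>
      have den: "K / real n + 2 * S \<le> W / (4 * L)"
      proof -
        have "K / real n = A / sqrt (real n)"
          unfolding K_def using sn by (simp add: field_simps)
        also have "\<dots> \<le> A / (sqrt \<delta>0 * L / 2)"
        proof (rule divide_left_mono)
          show "sqrt \<delta>0 * L / 2 \<le> sqrt (real n)"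
            using n(2) \<delta>0 by (intro real_le_rsqrt) (simp add: power_divide power_mult_distrib)
          show "0 < sqrt (real n) * (sqrt \<delta>0 * L / 2)" using sn \<delta>0 L1 by simp
        qed (use A in simp)
        also have "\<dots> = (8 * A / sqrt \<delta>0) / (4 * L)" by (simp add: mult_ac)
        finally have "K / real n + 2 * S \<le> (8 * A / sqrt \<delta>0) / (4 * L) + 2 * (c * (1 + \<delta>) * (6 + (1 - \<eta>) * ln q) / (4 * L))"
          using S by linarith
        also have "\<dots> = W / (4 * L)"
        proof -
          have "W = (8 * A / sqrt \<delta>0) + 2 * (c * (1 + \<delta>) * (6 + (1 - \<eta>) * ln q))"
            by (simp add: W_def A2_def algebra_simps)
          then show ?thesis by (simp only: add_divide_distrib times_divide_eq_right)
        qed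
        finally show ?thesis .
      qed
      have den0: "0 < K / real n + 2 * S" using K0 n1 S0 by (intro add_pos_nonneg) auto
      have lower: "(1 - \<delta>) ^ 3 * real N / W \<le> (1 - \<delta>)\<^sup>2 * real m * real n / (K + 2 * real n * S)"
      proof -
        have "(1 - \<delta>) ^ 3 * real N / W = (1 - \<delta>)\<^sup>2 * ((1 - \<delta>) * real N) / W"
          by (simp add: power2_eq_square power3_eq_cube)
        also have "\<dots> \<le> (1 - \<delta>)\<^sup>2 * (4 * L * real m) / W"
          using W0 Lm by (intro divide_right_mono mult_left_mono) auto
        also have "\<dots> = (1 - \<delta>)\<^sup>2 * real m / (W / (4 * L))" using L1 by simp
        also have "\<dots> \<le> (1 - \<delta>)\<^sup>2 * real m / (K / real n + 2 * S)"
          using den den0 by (intro divide_left_mono mult_pos_pos) auto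
        also have "\<dots> = (1 - \<delta>)\<^sup>2 * real m * real n / (K + 2 * real n * S)"
          using n1 den0 by (simp add: field_simps)
        finally show ?thesis .
      qed
      have "?P \<le> exp (- real m)"
      proof (rule prob_cap_small[where \<gamma>=\<gamma>])
        have "\<P>(\<zeta> in steps_M. bad \<zeta>) \<le> real n / L\<^sup>2 + 2 * (\<Sum>k<n. (nbr_avg ^^ k) green (0 :: (int, 'd) vec)) / (K * \<delta>)"
          by (rule prob_bad)
        also have "\<dots> \<le> \<delta>0 / 2 + \<delta>0 / 2"
        proof (rule add_mono)
          show "real n / L\<^sup>2 \<le> \<delta>0 / 2" using n(1) L1 by (simp add: field_simps)
          have "2 * (\<Sum>k<n. (nbr_avg ^^ k) green (0 :: (int, 'd) vec)) / (K * \<delta>) \<le> 2 * (12288 * sqrt (real n)) / (K * \<delta>)"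
            using K0 \<delta> by (intro divide_right_mono mult_left_mono sum_walk_green_3[OF d n1]) auto
          also have "\<dots> = \<delta>0 / 2" using sn \<delta>0 \<delta> by (simp add: K_def A_def field_simps)
          finally show "2 * (\<Sum>k<n. (nbr_avg ^^ k) green (0 :: (int, 'd) vec)) / (K * \<delta>) \<le> \<delta>0 / 2" .
        qed
        finally show "\<P>(\<zeta> in steps_M. bad \<zeta>) \<le> exp (- (2 / \<delta>))" by (simp add: \<delta>0_def)
        show "0 \<le> \<gamma> i" for i by (rule \<gamma>0)
        show "green x \<le> \<gamma> i" if i: "1 \<le> i" and x: "4 * L * (real i - 3/4) \<le> norm (rv x)" for i and x :: "(int, 'd) vec"
        proof -
          have "4 * L * (1/4) \<le> 4 * L * (real i - 3/4)" using i L1 by (intro mult_left_mono) auto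
          then have pos: "L \<le> 4 * L * (real i - 3/4)" by simp
          have "green x \<le> c * (1 + \<delta>) / norm (rv x)" using x pos LR by (intro up) linarith
          also have "\<dots> \<le> c * (1 + \<delta>) / (4 * L * (real i - 3/4))"
          proof (rule divide_left_mono[OF x])
            have "0 < 4 * L * (real i - 3/4)" "0 < norm (rv x)" using x pos L1 by linarith+
            then show "0 < norm (rv x) * (4 * L * (real i - 3/4))" by (rule mult_pos_pos[rotated])
          qed (use c \<delta> in simp)
          finally show ?thesis using i by (simp add: \<gamma>_def)
        qed
        show "4 * L * real m + L + 1 \<le> real N" using Nm by simp
        have "cap (rectangle N p :: (int, 'd) vec set) \<le> 2 * real CARD('d) * ((1 + 3 * \<delta>) * real N / (2 * c * (1 - \<delta>) * (ln q - A3)))"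
        proof -
          \<comment> \<open>Arms of length \<delta> N lengthen the segment only by a factor 1 +
            3\<delta>, and their logarithm is still \<open>ln q\<close> up to the constant
            \<open>A3\<close>.\<close>
          define a where "a = nat \<lfloor>\<delta> * real N\<rfloor>"
          have a: "real a \<le> \<delta> * real N" "\<delta> * real N \<le> real a + 1" "R \<le> a"
          proof -
            show 1: "real a \<le> \<delta> * real N" "\<delta> * real N \<le> real a + 1"
              unfolding a_def using \<delta>N by linarith+
            show "R \<le> a" using 1 \<delta>N by linarith
          qed
          have lnle: "ln q - A3 \<le> ln ((real a + 1 + 2 * real p) / (real R + 2 * real p))"
          proof -
            have "ln q - A3 = ln (q / ((real R + 2) / \<delta>))"
              unfolding A3_def using q1 \<delta> by (subst ln_div) auto
            also have "\<dots> \<le> ln ((real a + 1 + 2 * real p) / (real R + 2 * real p))"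
            proof (subst ln_le_cancel_iff)
              have "q / ((real R + 2) / \<delta>) = (\<delta> * real N) / ((real R + 2) * real p)"
                by (simp add: q_def mult_ac)
              also have "\<dots> \<le> (real a + 1 + 2 * real p) / ((real R + 2) * real p)"
                using a by (intro divide_right_mono) auto
              also have "\<dots> \<le> (real a + 1 + 2 * real p) / (real R + 2 * real p)"
              proof (rule divide_left_mono)
                have "real R * 1 \<le> real R * real p" using p by (intro mult_left_mono) auto
                then show "real R + 2 * real p \<le> (real R + 2) * real p" by (simp add: algebra_simps)
                show "0 < (real R + 2) * real p * (real R + 2 * real p)" using p by (intro mult_pos_pos) auto
              qed simp
              finally show "q / ((real R + 2) / \<delta>) \<le> (real a + 1 + 2 * real p) / (real R + 2 * real p)" .
              show "0 < q / ((real R + 2) / \<delta>)" using q1 \<delta> by simp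
              show "0 < (real a + 1 + 2 * real p) / (real R + 2 * real p)" using p by (intro divide_pos_pos) auto
            qed
            finally show ?thesis .
          qed
          have "(\<Sum>x\<in>rectangle N p. esc (rectangle N p) (x :: (int, 'd) vec))
            \<le> (real N + 2 * real a + 1) / (2 * (c * (1 - \<delta>)) * ln ((real a + 1 + 2 * real p) / (real R + 2 * real p)))"
            by (rule cap_rectangle_le_3[OF tr d]) (use c \<delta> R a p low in auto)
          also have "\<dots> \<le> ((1 + 3 * \<delta>) * real N) / (2 * (c * (1 - \<delta>)) * (ln q - A3))"
          proof (rule frac_le)
            show "real N + 2 * real a + 1 \<le> (1 + 3 * \<delta>) * real N" using a \<delta>N by (simp add: algebra_simps)
            show "0 < 2 * (c * (1 - \<delta>)) * (ln q - A3)" using c \<delta> Q(3) by simp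
            show "2 * (c * (1 - \<delta>)) * (ln q - A3) \<le> 2 * (c * (1 - \<delta>)) * ln ((real a + 1 + 2 * real p) / (real R + 2 * real p))"
              using c \<delta> lnle by (intro mult_left_mono) auto
          qed (use \<delta> in auto)
          finally show ?thesis unfolding cap_eq_esc by (intro mult_left_mono) (auto simp: mult.assoc)
        qed
        also have "\<dots> < 2 * real CARD('d) * ((1 - \<delta>)\<^sup>2 * real m * real n / (K + 2 * real n * S))"
        proof (rule mult_strict_left_mono)
          define V where "V = 2 * c * (1 - \<delta>) * (ln q - A3)"
          have V0: "0 < V" unfolding V_def using c \<delta> Q(3) by simp
          have "(1 + 3 * \<delta>) * W < (1 - \<delta>) ^ 3 * V" using Q(4) by (simp add: W_def V_def)
          then have "real N * ((1 + 3 * \<delta>) * W) < real N * ((1 - \<delta>) ^ 3 * V)"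
            using N2 by (intro mult_strict_left_mono) auto
          then have "(1 + 3 * \<delta>) * real N / V < (1 - \<delta>) ^ 3 * real N / W"
            using V0 W0 by (simp add: divide_simps mult_ac)
          then show "(1 + 3 * \<delta>) * real N / (2 * c * (1 - \<delta>) * (ln q - A3)) < (1 - \<delta>)\<^sup>2 * real m * real n / (K + 2 * real n * S)"
            unfolding V_def[symmetric] using lower by linarith
        qed simp
        finally show "cap (rectangle N p :: (int, 'd) vec set) < 2 * real CARD('d) * ((1 - \<delta>)\<^sup>2 * real m * real n / (K + 2 * real n * (\<Sum>i\<in>{1..m}. \<gamma> i)))"
          unfolding S_def .
      qed
      also have "\<dots> \<le> exp (- z)" using m by simp
      also have "\<dots> \<le> exp (q0 powr (1 - \<eta>)) * exp (- z)" by simp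
      finally show ?thesis unfolding z_def .
    qed
    then show "?P \<le> exp (q0 powr (1 - \<eta>)) * exp (- ((real N / real p) powr (1 - \<eta>)))"
      unfolding q_def .
  qed
qed

text \<open>The condition \<open>1 \<le> p\<close> keeps the quotients meaningful, since division by
  0 yields 0. The two dimensions are proved separately and then share \<open>c\<close> and
  \<open>C\<close>.\<close>

theorem theorem1p2:
  fixes \<eta> :: real
  assumes "0 < \<eta>" and "\<eta> < 1"
  shows "\<exists>c C :: real. 0 < c \<and> c \<le> C \<and>
    (\<forall>N p :: nat. 1 \<le> p \<and> p \<le> N \<longrightarrow>
      (c * exp (- (C * real N / real p))
         \<le> \<P>(\<omega> in srw (0 :: int ^ 3). cap (visited (lattice_ball N) \<omega>) \<le> cap (rectangle N p :: (int ^ 3) set))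
       \<and> \<P>(\<omega> in srw (0 :: int ^ 3). cap (visited (lattice_ball N) \<omega>) \<le> cap (rectangle N p :: (int ^ 3) set))
         \<le> C * exp (- ((c * real N / real p) powr (1 - \<eta>))))
      \<and>
      (c * exp (- (C * real N / real p))
         \<le> \<P>(\<omega> in srw (0 :: int ^ 4). cap (visited (lattice_ball N) \<omega>) \<le> cap (rectangle N p :: (int ^ 4) set))
       \<and> \<P>(\<omega> in srw (0 :: int ^ 4). cap (visited (lattice_ball N) \<omega>) \<le> cap (rectangle N p :: (int ^ 4) set))
         \<le> C * exp (- (c * real N / (real p * (max (ln (real p)) 1)\<^sup>2)))))"
proof -
  let ?P3 = "\<lambda>N p. \<P>(\<omega> in srw (0 :: int ^ 3). cap (visited (lattice_ball N) \<omega>) \<le> cap (rectangle N p :: (int ^ 3) set))"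
  let ?P4 = "\<lambda>N p. \<P>(\<omega> in srw (0 :: int ^ 4). cap (visited (lattice_ball N) \<omega>) \<le> cap (rectangle N p :: (int ^ 4) set))"
  have d3: "CARD(3) = 3" and d4: "CARD(4) = 4" by simp_all
  obtain C3 where C3: "\<And>N p. 1 \<le> p \<and> p \<le> N \<Longrightarrow> ?P3 N p \<le> C3 * exp (- ((real N / real p) powr (1 - \<eta>)))"
    using cap_small_upper_bound_3[OF d3 assms] by blast
  obtain c4 where c4: "0 < c4"
      "\<And>N p. 1 \<le> p \<and> p \<le> N \<Longrightarrow> ?P4 N p \<le> exp 1 * exp (- (c4 * real N / (real p * (max (ln (real p)) 1)\<^sup>2)))"
    using cap_small_upper_bound_4[OF d4] by blast
  define b3 :: real where "b3 = (1/2) ^ 3 / 18432 * exp (- 36)"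
  define b4 :: real where "b4 = (1/2) ^ 4 / 18432 * exp (- 48)"
  have l3: "b3 * exp (- (39 * real N / real p)) \<le> ?P3 N p" if "1 \<le> p" "p \<le> N" for N p
  proof -
    have "\<exists>k :: 3. k \<noteq> 1" by (rule exI[of _ 0]) simp
    from cap_small_lower_bound[OF transient_3(1)[OF d3] this that] show ?thesis by (simp add: b3_def)
  qed
  have l4: "b4 * exp (- (51 * real N / real p)) \<le> ?P4 N p" if "1 \<le> p" "p \<le> N" for N p
  proof -
    have "\<exists>k :: 4. k \<noteq> 1" by (rule exI[of _ 0]) simp
    from cap_small_lower_bound[OF transient_4(1)[OF d4] this that] show ?thesis by (simp add: b4_def)
  qed
  \<comment> \<open>Taking \<open>c \<le> 1\<close> allows it to be inserted inside the power in
    dimension three, which only weakens the bound.\<close>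
  define c where "c = Min {b3, b4, c4, 1}"
  define C where "C = Max {51, C3, exp 1}"
  have c: "0 < c" "c \<le> b3" "c \<le> b4" "c \<le> c4" "c \<le> 1"
    using c4(1) by (auto simp: c_def b3_def b4_def)
  have C: "51 \<le> C" "C3 \<le> C" "exp 1 \<le> C" by (auto simp: C_def)
  show ?thesis
  proof (rule exI[of _ c], rule exI[of _ C], intro conjI allI impI)
    show "0 < c" by (rule c)
    show "c \<le> C" using c C by linarith
    fix N p :: nat assume p: "1 \<le> p \<and> p \<le> N"
    have q: "0 \<le> real N / real p" by simp
    have low: "c * exp (- (C * real N / real p)) \<le> b * exp (- (t * real N / real p))" if "c \<le> b" "t \<le> C" for b t
    proof -
      have "t * (real N / real p) \<le> C * (real N / real p)" using that q by (intro mult_right_mono) auto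
      then show ?thesis using that c(1) by (intro mult_mono) auto
    qed
    show "c * exp (- (C * real N / real p)) \<le> ?P3 N p"
      using low[of b3 39] l3[of p N] p c C by linarith
    show "c * exp (- (C * real N / real p)) \<le> ?P4 N p"
      using low[of b4 51] l4[of p N] p c C by linarith
    have "?P3 N p \<le> C3 * exp (- ((real N / real p) powr (1 - \<eta>)))" by (rule C3[OF p])
    also have "\<dots> \<le> C * exp (- ((c * real N / real p) powr (1 - \<eta>)))"
    proof (rule mult_mono)
      have "c * real N / real p \<le> 1 * real N / real p"
        using c by (intro divide_right_mono mult_right_mono) auto
      then have "(c * real N / real p) powr (1 - \<eta>) \<le> (real N / real p) powr (1 - \<eta>)"
        using c assms by (intro powr_mono2) auto
      then show "exp (- ((real N / real p) powr (1 - \<eta>))) \<le> exp (- ((c * real N / real p) powr (1 - \<eta>)))" by simp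
    qed (use C in auto)
    finally show "?P3 N p \<le> C * exp (- ((c * real N / real p) powr (1 - \<eta>)))" .
    have "?P4 N p \<le> exp 1 * exp (- (c4 * real N / (real p * (max (ln (real p)) 1)\<^sup>2)))" by (rule c4(2)[OF p])
    also have "\<dots> \<le> C * exp (- (c * real N / (real p * (max (ln (real p)) 1)\<^sup>2)))"
    proof (rule mult_mono)
      have "c * real N / (real p * (max (ln (real p)) 1)\<^sup>2) \<le> c4 * real N / (real p * (max (ln (real p)) 1)\<^sup>2)"
        using c by (intro divide_right_mono mult_right_mono) auto
      then show "exp (- (c4 * real N / (real p * (max (ln (real p)) 1)\<^sup>2))) \<le> exp (- (c * real N / (real p * (max (ln (real p)) 1)\<^sup>2)))" by simp
    qed (use C in auto)
    finally show "?P4 N p \<le> C * exp (- (c * real N / (real p * (max (ln (real p)) 1)\<^sup>2)))" .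
  qed
qed

end
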